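(* Any 3-dimensional germ $(M,0)$ of an $F$-manifold with $T_tM\cong Q^{(1)}$ for all $t\in M$ can be given as follows: $(M,0)=(\mathbb{C}^3,0)$ with coordinates $t=(t_1,t_2,t_3)$, unit field $e=\partial_1$, and $$\partial_2\circ\partial_2=0,\quad \partial_2\circ(\partial_3-b_2\partial_1)=0,\quad (\partial_3-b_2\partial_1)\circ(\partial_3-b_2\partial_1)=0,$$ where $b_2$ is arbitrary in $t_2\,\mathbb{C}\{t_2,t_3\}$ (every such $b_2$ is allowed). The ideal $(\partial_2 b_2)\subset\mathbb{C}\{t_2,t_3\}$ is, up to coordinate changes, an invariant of the germ of an $F$-manifold. A vector field $E=\varepsilon_1\partial_1+\varepsilon_2\partial_2+\varepsilon_3\partial_3$ with $\varepsilon_1,\varepsilon_2,\varepsilon_3\in\mathbb{C}\{t_1,t_2,t_3\}$ is an Euler field if and only if $\varepsilon_1\in t_1+\mathbb{C}\{t_2,t_3\}$, $\varepsilon_2,\varepsilon_3\in\mathbb{C}\{t_2,t_3\}$ and $$\partial_2(\varepsilon_1)=-b_2\,\partial_2(\varepsilon_3),\qquad \partial_3(\varepsilon_1)=-\varepsilon_2\,\partial_2(b_2)-\partial_3(\varepsilon_3b_2)+b_2 .$$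
   Context: An $F$-manifold $(M,\circ,e)$ is a complex manifold $M$ with a holomorphic commutative and associative ($\mathcal{O}_M$-bilinear) multiplication $\circ$ on the holomorphic tangent bundle $TM$ and a global holomorphic vector field $e$ with $e\circ=\mathrm{id}$ (unit field), such that $\mathrm{Lie}_{X\circ Y}(\circ)=X\circ\mathrm{Lie}_Y(\circ)+Y\circ\mathrm{Lie}_X(\circ)$ for all local holomorphic vector fields $X,Y$. An Euler field is a holomorphic vector field $E$ with $\mathrm{Lie}_E(\circ)=\circ$, i.e. $[E,X\circ Y]-[E,X]\circ Y-X\circ[E,Y]=X\circ Y$ for all $X,Y$. An isomorphism of germs of $F$-manifolds is a biholomorphic map germ respecting base points, multiplications and unit fields. For a germ $(M,0)$, $M$ also denotes a suitable small representative. $Q^{(1)}:=\mathbb{C}[x_1,x_2]/(x_1^2,x_1x_2,x_2^2)$. $\partial_j:=\partial/\partial t_j$. $\mathbb{C}\{t_2,t_3\}$ is the ring of convergent power series. "The ideal is up to coordinate changes an invariant" means: if two germs in this normal form, given by $b_2$ and $\widetilde b_2$, are isomorphic as germs of $F$-manifolds, then some automorphism of $\mathbb{C}\{t_2,t_3\}$ induced by a biholomorphic map germ $(\mathbb{C}^2,0)\to(\mathbb{C}^2,0)$ maps the ideal $(\partial_2b_2)$ onto the ideal $(\partial_2\widetilde b_2)$. *)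

theory Defs
  imports "HOL-Analysis.Analysis" "HOL-Algebra.QuotRing" "HOL-Computational_Algebra.Polynomial"
begin

section \<open>Holomorphic functions and maps of several complex variables\<close>

definition holomorphic_fun :: "(complex^'n \<Rightarrow> complex) \<Rightarrow> (complex^'n) set \<Rightarrow> bool" where
  "holomorphic_fun f S \<longleftrightarrow>
     (\<forall>z\<in>S. \<exists>D. (f has_derivative D) (at z) \<and> (\<forall>c v. D (c *s v) = c * D v))"

definition holomorphic_map :: "(complex^'n \<Rightarrow> complex^'m) \<Rightarrow> (complex^'n) set \<Rightarrow> bool" where
  "holomorphic_map f S \<longleftrightarrow> (\<forall>i. holomorphic_fun (\<lambda>z. f z $ i) S)"

definition biholomorphic :: "(complex^'n \<Rightarrow> complex^'n) \<Rightarrow> (complex^'n) set \<Rightarrow> bool" where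
  "biholomorphic \<phi> S \<longleftrightarrow>
     open S \<and> open (\<phi> ` S) \<and> inj_on \<phi> S \<and>
     holomorphic_map \<phi> S \<and> holomorphic_map (inv_into S \<phi>) (\<phi> ` S)"

definition biholomorphic_germ :: "(complex^'n \<Rightarrow> complex^'n) \<Rightarrow> bool" where
  "biholomorphic_germ \<phi> \<longleftrightarrow> \<phi> 0 = 0 \<and> (\<exists>S. 0 \<in> S \<and> biholomorphic \<phi> S)"

definition pd :: "'n \<Rightarrow> (complex^'n \<Rightarrow> complex) \<Rightarrow> complex^'n \<Rightarrow> complex" where
  "pd i f z = deriv (\<lambda>s. f (z + s *s axis i 1)) 0"


section \<open>Convergent power series\<close>

text \<open>The functions representing an element of the ring of convergent power series in the
  coordinates of \<^typ>\<open>complex^'n\<close>. Only the values near the origin matter; two such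
  functions represent the same series iff they have the same germ at the origin.
  \<open>has_sum\<close> is unconditional, hence absolute, convergence.\<close>

definition convergent_series :: "(complex^'n \<Rightarrow> complex) set" where
  "convergent_series =
     {f. \<exists>c. \<forall>\<^sub>F z in nhds 0.
        ((\<lambda>k::'n \<Rightarrow> nat. c k * (\<Prod>i\<in>UNIV. (z $ i) ^ k i)) has_sum f z) UNIV}"

definition germ0 :: "(complex^'n \<Rightarrow> complex) \<Rightarrow> (complex^'n \<Rightarrow> complex) set" where
  "germ0 f = {g. \<forall>\<^sub>F z in nhds 0. g z = f z}"

definition series_ring :: "(complex^'n \<Rightarrow> complex) set ring" where
  "series_ring =
     \<lparr>carrier = germ0 ` convergent_series,
      monoid.mult = (\<lambda>\<gamma> \<delta>. \<Union>f\<in>\<gamma>. \<Union>g\<in>\<delta>. germ0 (\<lambda>z. f z * g z)),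
      one = germ0 (\<lambda>z. 1),
      zero = germ0 (\<lambda>z. 0),
      add = (\<lambda>\<gamma> \<delta>. \<Union>f\<in>\<gamma>. \<Union>g\<in>\<delta>. germ0 (\<lambda>z. f z + g z))\<rparr>"

definition pullback :: "(complex^'n \<Rightarrow> complex^'n) \<Rightarrow>
    (complex^'n \<Rightarrow> complex) set \<Rightarrow> (complex^'n \<Rightarrow> complex) set" where
  "pullback \<phi> \<gamma> = (\<Union>f\<in>\<gamma>. germ0 (f \<circ> \<phi>))"


section \<open>F-manifolds\<close>

subsection \<open>In local coordinates\<close>

text \<open>On an open subset of \<^typ>\<open>complex^'n\<close> vector fields are written through their
  components with respect to the coordinate fields; a multiplication on the tangent bundle
  assigns to every point a product on \<^typ>\<open>complex^'n\<close>.\<close>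

type_synonym 'n vfield = "complex^'n \<Rightarrow> complex^'n"
type_synonym 'n tmult = "complex^'n \<Rightarrow> complex^'n \<Rightarrow> complex^'n \<Rightarrow> complex^'n"

definition vmult :: "'n tmult \<Rightarrow> 'n vfield \<Rightarrow> 'n vfield \<Rightarrow> 'n vfield" where
  "vmult m X Y = (\<lambda>t. m t (X t) (Y t))"

definition lie_bracket :: "'n vfield \<Rightarrow> 'n vfield \<Rightarrow> 'n::finite vfield" where
  "lie_bracket X Y = (\<lambda>t. \<chi> k. \<Sum>i\<in>UNIV.
      X t $ i * pd i (\<lambda>s. Y s $ k) t - Y t $ i * pd i (\<lambda>s. X s $ k) t)"

definition lie_mult :: "'n::finite tmult \<Rightarrow> 'n vfield \<Rightarrow> 'n vfield \<Rightarrow> 'n vfield \<Rightarrow> 'n vfield" where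
  "lie_mult m X Y Z = (\<lambda>t. lie_bracket X (vmult m Y Z) t
      - vmult m (lie_bracket X Y) Z t - vmult m Y (lie_bracket X Z) t)"

definition F_structure :: "(complex^'n) set \<Rightarrow> 'n::finite tmult \<Rightarrow> 'n vfield \<Rightarrow> bool" where
  "F_structure V m e \<longleftrightarrow>
     open V \<and>
     (\<forall>u v. holomorphic_map (\<lambda>t. m t u v) V) \<and>
     holomorphic_map e V \<and>
     (\<forall>t\<in>V.
        (\<forall>u v w. m t (u + v) w = m t u w + m t v w) \<and>
        (\<forall>c u v. m t (c *s u) v = c *s m t u v) \<and>
        (\<forall>u v. m t u v = m t v u) \<and>
        (\<forall>u v w. m t (m t u v) w = m t u (m t v w)) \<and>
        (\<forall>v. m t (e t) v = v)) \<and>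
     (\<forall>W X Y A B. open W \<and> W \<subseteq> V \<and> holomorphic_map X W \<and> holomorphic_map Y W \<and>
          holomorphic_map A W \<and> holomorphic_map B W \<longrightarrow>
        (\<forall>t\<in>W. lie_mult m (vmult m X Y) A B t
           = m t (X t) (lie_mult m Y A B t) + m t (Y t) (lie_mult m X A B t)))"

definition Euler_field :: "(complex^'n) set \<Rightarrow> 'n::finite tmult \<Rightarrow> 'n vfield \<Rightarrow> bool" where
  "Euler_field V m E \<longleftrightarrow>
     open V \<and> holomorphic_map E V \<and>
     (\<forall>W X Y. open W \<and> W \<subseteq> V \<and> holomorphic_map X W \<and> holomorphic_map Y W \<longrightarrow>
        (\<forall>t\<in>W. lie_mult m E X Y t = m t (X t) (Y t)))"

definition F_compatible :: "(complex^'n \<Rightarrow> complex^'n) \<Rightarrow> (complex^'n) set \<Rightarrow>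
    'n::finite tmult \<Rightarrow> 'n vfield \<Rightarrow> 'n tmult \<Rightarrow> 'n vfield \<Rightarrow> bool" where
  "F_compatible \<phi> S m e m' e' \<longleftrightarrow>
     biholomorphic \<phi> S \<and>
     (\<forall>z\<in>S. let D = frechet_derivative \<phi> (at z) in
        D (e z) = e' (\<phi> z) \<and> (\<forall>u v. D (m z u v) = m' (\<phi> z) (D u) (D v)))"


subsection \<open>On complex manifolds\<close>

text \<open>A chart is a pair of its domain and its coordinate map. Multiplication and unit field
  are given by their expressions in every chart of the atlas, as functions of the coordinates;
  the transition maps have to respect them. The integrability condition of an F-manifold is
  local, so it is imposed inside the charts.\<close>

type_synonym ('a, 'n) chart = "'a set \<times> ('a \<Rightarrow> complex^'n)"

record ('a, 'n) F_data =
  pts :: "'a topology"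
  atlas :: "('a, 'n) chart set"
  fmult :: "('a, 'n) chart \<Rightarrow> 'n tmult"
  funit :: "('a, 'n) chart \<Rightarrow> 'n vfield"

definition F_manifold :: "('a, 'n::finite) F_data \<Rightarrow> bool" where
  "F_manifold M \<longleftrightarrow>
     Hausdorff_space (pts M) \<and>
     second_countable (pts M) \<and>
     topspace (pts M) = \<Union> (fst ` atlas M) \<and>
     (\<forall>(U, x)\<in>atlas M. openin (pts M) U \<and> open (x ` U) \<and>
        homeomorphic_map (subtopology (pts M) U) (top_of_set (x ` U)) x \<and>
        F_structure (x ` U) (fmult M (U, x)) (funit M (U, x))) \<and>
     (\<forall>(U, x)\<in>atlas M. \<forall>(V, y)\<in>atlas M.
        F_compatible (y \<circ> inv_into U x) (x ` (U \<inter> V))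
          (fmult M (U, x)) (funit M (U, x)) (fmult M (V, y)) (funit M (V, y)))"

definition F_germ_iso :: "('a, 'n::finite) F_data \<Rightarrow> 'a \<Rightarrow> ('b, 'n) F_data \<Rightarrow> 'b \<Rightarrow> bool" where
  "F_germ_iso M p N q \<longleftrightarrow>
     (\<exists>P Q f. openin (pts M) P \<and> p \<in> P \<and> openin (pts N) Q \<and> q \<in> Q \<and>
        homeomorphic_map (subtopology (pts M) P) (subtopology (pts N) Q) f \<and> f p = q \<and>
        (\<forall>(U, x)\<in>atlas M. \<forall>(V, y)\<in>atlas N.
           F_compatible (y \<circ> f \<circ> inv_into U x) (x ` {r \<in> U \<inter> P. f r \<in> V})
             (fmult M (U, x)) (funit M (U, x)) (fmult N (V, y)) (funit N (V, y))))"

definition open_F_data :: "(complex^'n) set \<Rightarrow> 'n tmult \<Rightarrow> 'n vfield \<Rightarrow>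
    (complex^'n, 'n::finite) F_data" where
  "open_F_data U m e =
     \<lparr>pts = top_of_set U, atlas = {(U, id)}, fmult = (\<lambda>_. m), funit = (\<lambda>_. e)\<rparr>"


section \<open>The algebra \<open>\<complex>[x\<^sub>1,x\<^sub>2]/(x\<^sub>1\<^sup>2, x\<^sub>1x\<^sub>2, x\<^sub>2\<^sup>2)\<close>\<close>

text \<open>\<^typ>\<open>complex poly poly\<close> is the polynomial ring in two variables: the inner
  variable is \<open>x\<^sub>1\<close>, the outer one \<open>x\<^sub>2\<close>.\<close>

definition Q1_x1 :: "complex poly poly" where "Q1_x1 = [:[:0, 1:]:]"
definition Q1_x2 :: "complex poly poly" where "Q1_x2 = [:0, 1:]"

definition Q1_rel :: "complex poly poly \<Rightarrow> complex poly poly \<Rightarrow> bool" where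
  "Q1_rel p q \<longleftrightarrow> (\<exists>a b c. p - q = a * Q1_x1\<^sup>2 + b * (Q1_x1 * Q1_x2) + c * Q1_x2\<^sup>2)"

lemma Q1_rel_refl: "Q1_rel p p"
  unfolding Q1_rel_def by (intro exI[of _ 0]) simp

lemma Q1_rel_minus: "Q1_rel p q \<Longrightarrow> Q1_rel (- p) (- q)"
proof -
  assume "Q1_rel p q"
  then obtain a b c where "p - q = a * Q1_x1\<^sup>2 + b * (Q1_x1 * Q1_x2) + c * Q1_x2\<^sup>2"
    unfolding Q1_rel_def by blast
  then have "- p - - q = (- a) * Q1_x1\<^sup>2 + (- b) * (Q1_x1 * Q1_x2) + (- c) * Q1_x2\<^sup>2"
    by (simp add: algebra_simps)
  then show ?thesis unfolding Q1_rel_def by blast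
qed

lemma Q1_rel_add: "Q1_rel p q \<Longrightarrow> Q1_rel p' q' \<Longrightarrow> Q1_rel (p + p') (q + q')"
proof -
  assume "Q1_rel p q" "Q1_rel p' q'"
  then obtain a b c a' b' c' where
    1: "p - q = a * Q1_x1\<^sup>2 + b * (Q1_x1 * Q1_x2) + c * Q1_x2\<^sup>2" and
    2: "p' - q' = a' * Q1_x1\<^sup>2 + b' * (Q1_x1 * Q1_x2) + c' * Q1_x2\<^sup>2"
    unfolding Q1_rel_def by blast
  have "p + p' - (q + q') = (p - q) + (p' - q')" by simp
  also have "\<dots> = (a + a') * Q1_x1\<^sup>2 + (b + b') * (Q1_x1 * Q1_x2) + (c + c') * Q1_x2\<^sup>2"
    unfolding 1 2 by (simp add: algebra_simps)
  finally show ?thesis unfolding Q1_rel_def by blast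
qed

lemma Q1_rel_sym: "Q1_rel p q \<Longrightarrow> Q1_rel q p"
  using Q1_rel_add[OF Q1_rel_minus Q1_rel_refl[of "p + q"], of p q]
  by (simp add: algebra_simps)

lemma Q1_rel_trans: "Q1_rel p q \<Longrightarrow> Q1_rel q r \<Longrightarrow> Q1_rel p r"
  using Q1_rel_add[OF Q1_rel_add[of p q q r] Q1_rel_refl[of "- q"]]
  by (simp add: algebra_simps)

lemma Q1_rel_mult_left: "Q1_rel p q \<Longrightarrow> Q1_rel (r * p) (r * q)"
proof -
  assume "Q1_rel p q"
  then obtain a b c where "p - q = a * Q1_x1\<^sup>2 + b * (Q1_x1 * Q1_x2) + c * Q1_x2\<^sup>2"
    unfolding Q1_rel_def by blast
  then have "r * p - r * q = (r * a) * Q1_x1\<^sup>2 + (r * b) * (Q1_x1 * Q1_x2) + (r * c) * Q1_x2\<^sup>2"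
    by (simp add: algebra_simps flip: right_diff_distrib)
  then show ?thesis unfolding Q1_rel_def by blast
qed

lemma Q1_rel_mult: "Q1_rel p q \<Longrightarrow> Q1_rel p' q' \<Longrightarrow> Q1_rel (p * p') (q * q')"
  using Q1_rel_mult_left[of p' q' p] Q1_rel_mult_left[of p q q'] Q1_rel_trans
  by (metis mult.commute)

quotient_type Q1 = "complex poly poly" / Q1_rel
  by (rule equivpI)
    (auto simp: reflp_def symp_def transp_def intro: Q1_rel_refl Q1_rel_sym Q1_rel_trans)

lemma Q1_rel_0_1: "\<not> Q1_rel 0 1"
proof
  assume "Q1_rel 0 1"
  then obtain a b c where
    "0 - 1 = a * Q1_x1\<^sup>2 + b * (Q1_x1 * Q1_x2) + c * Q1_x2\<^sup>2"
    unfolding Q1_rel_def by blast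
  then have "poly (poly (0 - 1) 0) 0
      = poly (poly (a * Q1_x1\<^sup>2 + b * (Q1_x1 * Q1_x2) + c * Q1_x2\<^sup>2) 0) 0"
    by simp
  then show False
    by (simp add: Q1_x1_def Q1_x2_def power2_eq_square)
qed

instantiation Q1 :: comm_ring_1
begin
lift_definition zero_Q1 :: Q1 is 0 .
lift_definition one_Q1 :: Q1 is 1 .
lift_definition plus_Q1 :: "Q1 \<Rightarrow> Q1 \<Rightarrow> Q1" is "(+)" by (rule Q1_rel_add)
lift_definition uminus_Q1 :: "Q1 \<Rightarrow> Q1" is uminus by (rule Q1_rel_minus)
lift_definition minus_Q1 :: "Q1 \<Rightarrow> Q1 \<Rightarrow> Q1" is "(-)"
  using Q1_rel_add[OF _ Q1_rel_minus] by simp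
lift_definition times_Q1 :: "Q1 \<Rightarrow> Q1 \<Rightarrow> Q1" is "(*)" by (rule Q1_rel_mult)
instance
  by standard (transfer, simp add: algebra_simps Q1_rel_refl Q1_rel_0_1)+
end

lift_definition Q1_const :: "complex \<Rightarrow> Q1" is "\<lambda>c. [:[:c:]:]" .

definition algebra_iso_Q1 ::
    "(complex^'n \<Rightarrow> complex^'n \<Rightarrow> complex^'n) \<Rightarrow> complex^'n \<Rightarrow> bool" where
  "algebra_iso_Q1 \<mu> u \<longleftrightarrow>
     (\<exists>\<phi> :: Q1 \<Rightarrow> complex^'n. bij \<phi> \<and>
        (\<forall>a b. \<phi> (a + b) = \<phi> a + \<phi> b) \<and>
        (\<forall>c a. \<phi> (Q1_const c * a) = c *s \<phi> a) \<and>
        (\<forall>a b. \<phi> (a * b) = \<mu> (\<phi> a) (\<phi> b)) \<and>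
        \<phi> 1 = u)"

definition tangent_algebras_Q1 :: "('a, 'n::finite) F_data \<Rightarrow> bool" where
  "tangent_algebras_Q1 M \<longleftrightarrow>
     (\<forall>(U, x)\<in>atlas M. \<forall>p\<in>U.
        algebra_iso_Q1 (fmult M (U, x) (x p)) (funit M (U, x) (x p)))"


section \<open>The normal form\<close>

text \<open>The coordinates of \<^typ>\<open>complex^3\<close> are \<open>t\<^sub>1, t\<^sub>2, t\<^sub>3\<close>. A series in \<open>t\<^sub>2, t\<^sub>3\<close> is a
  function on \<^typ>\<open>complex^2\<close>, so there \<open>t\<^sub>2, t\<^sub>3\<close> have the indices 1 and 2;
  composing with \<open>pr23\<close> gives the corresponding function on \<^typ>\<open>complex^3\<close>.\<close>

definition pr23 :: "complex^3 \<Rightarrow> complex^2" where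
  "pr23 t = vector [t $ 2, t $ 3]"

definition t2_multiples :: "(complex^2 \<Rightarrow> complex) set" where
  "t2_multiples =
     {b \<in> convergent_series. \<exists>h\<in>convergent_series. \<forall>\<^sub>F z in nhds 0. b z = z $ 1 * h z}"

definition coord_field :: "3 \<Rightarrow> 3 vfield" where
  "coord_field i = (\<lambda>t. axis i 1)"

definition D3_field :: "(complex^2 \<Rightarrow> complex) \<Rightarrow> 3 vfield" where
  "D3_field b2 = (\<lambda>t. coord_field 3 t - b2 (pr23 t) *s coord_field 1 t)"

text \<open>\<open>U\<close> is a representative of the germ of \<^typ>\<open>complex^3\<close> at 0. Together with bilinearity,
  commutativity and the unit, the three relations determine \<open>m\<close> on \<open>U\<close>.\<close>

definition normal_form :: "(complex^2 \<Rightarrow> complex) \<Rightarrow> (complex^3) set \<Rightarrow> 3 tmult \<Rightarrow> bool" where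
  "normal_form b2 U m \<longleftrightarrow>
     b2 \<in> t2_multiples \<and> 0 \<in> U \<and>
     F_manifold (open_F_data U m (coord_field 1)) \<and>
     (\<forall>t\<in>U. vmult m (coord_field 2) (coord_field 2) t = 0 \<and>
             vmult m (coord_field 2) (D3_field b2) t = 0 \<and>
             vmult m (D3_field b2) (D3_field b2) t = 0)"

definition series_in_t23 :: "(complex^3 \<Rightarrow> complex) \<Rightarrow> bool" where
  "series_in_t23 f \<longleftrightarrow> (\<exists>g\<in>convergent_series. \<forall>\<^sub>F t in nhds 0. f t = g (pr23 t))"

end

theory Submission
  imports Defs "HOL-Complex_Analysis.Cauchy_Integral_Formula"
begin

unbundle no fps_syntax

text \<open>In an algebra isomorphic to \<open>Q1\<close> every vector is a multiple of the unit \<open>e\<close> plus a nilpotent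
  vector, and nilpotent vectors multiply to zero. Hence such a multiplication is
  \<open>u \<circ> v = \<lambda>(u) v + \<lambda>(v) u - \<lambda>(u) \<lambda>(v) e\<close> for the one-form \<open>\<lambda>(v) = trace (v \<circ>) / 3\<close>, and the
  integrability condition of an F-manifold is equivalent to \<open>Lie\<^sub>e \<lambda> = 0\<close>. Rectifying \<open>e\<close> to
  \<open>\<partial>\<^sub>1\<close> turns \<open>\<lambda>\<close> into \<open>dt\<^sub>1 + a dt\<^sub>2 + b dt\<^sub>3\<close> with \<open>a\<close> and \<open>b\<close> depending on \<open>t\<^sub>2, t\<^sub>3\<close> only; a
  shift of \<open>t\<^sub>1\<close> by a function of \<open>t\<^sub>2, t\<^sub>3\<close> removes \<open>a\<close> and makes \<open>b\<close> vanish on \<open>t\<^sub>2 = 0\<close>. An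
  isomorphism of normal forms respects \<open>\<lambda>\<close>, hence \<open>d\<lambda> = \<partial>\<^sub>2 b dt\<^sub>2 \<and> dt\<^sub>3\<close>, so \<open>\<partial>\<^sub>2 b\<close> changes by a
  Jacobian determinant. A field \<open>E\<close> is an Euler field iff \<open>Lie\<^sub>E \<lambda> = \<lambda>\<close> and \<open>[e, E] = e\<close>.\<close>

section \<open>Complex differentiability in several variables\<close>

text \<open>The denominator 3 arises because multiplication by v is \<lambda>(v) times the identity
  plus a nilpotent map. This trace formula makes \<lambda> holomorphic, although the isomorphisms
  with \<open>Q1\<close> are given only point by point. Putting X = Y = e into the integrability
  condition gives Lie_e(\<circ>) = 2 Lie_e(\<circ>), so Lie_e(\<circ>) = 0; in dimension at least 2
  this forces Lie_e \<lambda> = 0. Conversely, \<lambda>(e) = 1 and Lie_e \<lambda> = 0 make the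
  differentials of \<lambda>(X) and \<lambda>(Y) cancel in the Lie derivative of \<lambda> along X
  \<circ> Y. A map that preserves \<partial>_1 descends to the (t_2, t_3)-plane; the Jacobian
  identity for the map and for its inverse gives divisibility both ways, hence equality of ideals.
  The analytic burden: holomorphy means a complex-linear derivative at every point, while the normal
  form speaks of power series. Cauchy's integral over a coordinate circle expresses partial
  derivatives through values; from it come smoothness, uniform limits, series expansion and the
  holomorphic dependence of a flow on its initial values.\<close>

lemma has_derivative_vec_componentwise:
  fixes f :: "'a::real_normed_vector \<Rightarrow> 'b::euclidean_space^'n"
  assumes "\<And>i. ((\<lambda>x. f x $ i) has_derivative (\<lambda>h. f' h $ i)) (at x within S)"
  shows "(f has_derivative f') (at x within S)"
  unfolding has_derivative_componentwise_within[of f]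
proof
  fix b :: "'b^'n" assume "b \<in> Basis"
  then obtain i u where b: "b = axis i u" by (auto simp: Basis_vec_def)
  show "((\<lambda>x. f x \<bullet> b) has_derivative (\<lambda>x. f' x \<bullet> b)) (at x within S)"
    unfolding b inner_axis using assms[of i] by (rule has_derivative_inner_left)
qed

lemma has_derivative_vec_nth:
  fixes f :: "'a::real_normed_vector \<Rightarrow> 'b::real_normed_vector^'n"
  assumes "(f has_derivative f') (at x within S)"
  shows "((\<lambda>x. f x $ i) has_derivative (\<lambda>h. f' h $ i)) (at x within S)"
  using bounded_linear.has_derivative[OF bounded_linear_vec_nth assms] .

text \<open>Holomorphy at a single point. Working pointwise lets the calculus rules run inside
  \<open>eventually\<close> statements, which is how germs are handled throughout.\<close>

definition complex_diff :: "(complex^'n \<Rightarrow> complex) \<Rightarrow> complex^'n \<Rightarrow> bool" where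
  "complex_diff f z \<longleftrightarrow> (\<exists>D. (f has_derivative D) (at z) \<and> (\<forall>c v. D (c *s v) = c * D v))"

text \<open>\<open>pd\<close> is total, so this complex-linear form exists everywhere; it is the
  derivative exactly where \<open>complex_diff\<close> holds.\<close>

definition dirder :: "(complex^'n \<Rightarrow> complex) \<Rightarrow> complex^'n \<Rightarrow> complex^'n \<Rightarrow> complex" where
  "dirder f z h = (\<Sum>i\<in>UNIV. h $ i * pd i f z)"

lemma holomorphic_fun_iff: "holomorphic_fun f S \<longleftrightarrow> (\<forall>z\<in>S. complex_diff f z)"
  by (simp add: holomorphic_fun_def complex_diff_def)

lemma bounded_linear_smult_vec: "bounded_linear (\<lambda>s::complex. s *s (v::complex^'n))"
proof -
  have "((\<lambda>s. s *s v) has_derivative (\<lambda>s. s *s v)) (at 0)"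
    by (rule has_derivative_vec_componentwise) (auto intro!: derivative_eq_intros)
  then show ?thesis by (rule has_derivative_bounded_linear)
qed

text \<open>Complex linearity of \<open>D\<close> makes the restriction to a complex line
  differentiable in one complex variable; through this all one-variable theorems enter.\<close>

lemma has_field_derivative_line:
  fixes f :: "complex^'n \<Rightarrow> complex"
  assumes "(f has_derivative D) (at (z + w *s v))" and "\<And>c v. D (c *s v) = c * D v"
  shows "((\<lambda>s. f (z + s *s v)) has_field_derivative D v) (at w)"
proof -
  have "((\<lambda>s. z + s *s v) has_derivative (\<lambda>s. s *s v)) (at w)"
    by (auto intro!: derivative_eq_intros bounded_linear_imp_has_derivative bounded_linear_smult_vec)
  from has_derivative_compose[OF this, of f D] assms(1)
  have "((\<lambda>s. f (z + s *s v)) has_derivative (\<lambda>s. D (s *s v))) (at w)" by simp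
  then show ?thesis by (simp add: has_field_derivative_def assms(2) mult.commute[of _ "D v"])
qed

lemma pd_eqI:
  assumes "(f has_derivative D) (at z)" and "\<And>c v. D (c *s v) = c * D v"
  shows "pd i f z = D (axis i 1)"
  unfolding pd_def by (rule DERIV_imp_deriv, rule has_field_derivative_line) (use assms in auto)

lemma dirder_eqI:
  assumes "(f has_derivative D) (at z)" and l: "\<And>c v. D (c *s v) = c * D v"
  shows "D = dirder f z"
proof
  fix h
  interpret D: bounded_linear D using assms(1) by (rule has_derivative_bounded_linear)
  have "D h = D (\<Sum>i\<in>UNIV. (h $ i) *s axis i 1)" by (simp add: basis_expansion)
  also have "\<dots> = dirder f z h"
    by (simp only: D.sum l dirder_def pd_eqI[OF assms])
  finally show "D h = dirder f z h" .
qed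

lemma dirder_scale: "dirder f z (c *s v) = c * dirder f z v"
  by (simp add: dirder_def sum_distrib_left mult.assoc)

lemma dirder_add: "dirder f z (u + v) = dirder f z u + dirder f z v"
  by (simp add: dirder_def sum.distrib algebra_simps)

lemma dirder_axis [simp]: "dirder f z (axis i 1) = pd i f z"
  by (simp add: dirder_def axis_def if_distrib[of "\<lambda>x. x * _"] cong: if_cong)

lemma complex_diffD: "complex_diff f z \<Longrightarrow> (f has_derivative dirder f z) (at z)"
  unfolding complex_diff_def using dirder_eqI by blast

lemma complex_diffI:
  "(f has_derivative D) (at z) \<Longrightarrow> (\<And>c v. D (c *s v) = c * D v) \<Longrightarrow> complex_diff f z"
  unfolding complex_diff_def by blast

lemma complex_diff_continuous: "complex_diff f z \<Longrightarrow> isCont f z"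
  by (auto dest!: complex_diffD intro: has_derivative_continuous)

lemma holomorphic_fun_continuous_on: "holomorphic_fun f S \<Longrightarrow> continuous_on S f"
  by (simp add: holomorphic_fun_iff complex_diff_continuous continuous_at_imp_continuous_on)

lemma holomorphic_map_continuous_on: "holomorphic_map f S \<Longrightarrow> continuous_on S f"
  using continuous_on_vec_lambda[of S "\<lambda>i z. f z $ i"]
  by (auto simp: holomorphic_map_def intro: holomorphic_fun_continuous_on)

lemma complex_diff_line:
  assumes "complex_diff f (z + w *s v)"
  shows "((\<lambda>s. f (z + s *s v)) has_field_derivative dirder f (z + w *s v) v) (at w)"
  by (rule has_field_derivative_line[OF complex_diffD[OF assms]]) (rule dirder_scale)

lemma complex_diff_const [simp]: "complex_diff (\<lambda>z. c) z"
  and pd_const [simp]: "pd i (\<lambda>z. c) z = 0"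
proof -
  have *: "((\<lambda>z. c) has_derivative (\<lambda>h. 0)) (at z)" by simp
  show "complex_diff (\<lambda>z. c) z" by (rule complex_diffI[OF *]) simp
  show "pd i (\<lambda>z. c) z = 0" by (subst pd_eqI[OF *]) simp_all
qed

lemma complex_diff_coord [simp]: "complex_diff (\<lambda>z. z $ j) z"
  and pd_coord: "pd i (\<lambda>z. z $ j) z = (if i = j then 1 else 0)"
proof -
  have *: "((\<lambda>z. z $ j) has_derivative (\<lambda>h. h $ j)) (at z)"
    by (rule bounded_linear_imp_has_derivative) (rule bounded_linear_vec_nth)
  show "complex_diff (\<lambda>z. z $ j) z" by (rule complex_diffI[OF *]) simp
  show "pd i (\<lambda>z. z $ j) z = (if i = j then 1 else 0)"
    by (subst pd_eqI[OF *]) (simp_all add: axis_def)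
qed

lemma
  assumes "complex_diff f z" "complex_diff g z"
  shows complex_diff_add: "complex_diff (\<lambda>z. f z + g z) z"
    and pd_add: "pd i (\<lambda>z. f z + g z) z = pd i f z + pd i g z"
    and dirder_fadd: "dirder (\<lambda>z. f z + g z) z h = dirder f z h + dirder g z h"
proof -
  have *: "((\<lambda>z. f z + g z) has_derivative (\<lambda>h. dirder f z h + dirder g z h)) (at z)"
    using assms by (intro derivative_intros complex_diffD)
  have l: "dirder f z (c *s v) + dirder g z (c *s v) = c * (dirder f z v + dirder g z v)" for c v
    by (simp add: dirder_scale algebra_simps)
  show "complex_diff (\<lambda>z. f z + g z) z" by (rule complex_diffI[OF * l])
  show "pd i (\<lambda>z. f z + g z) z = pd i f z + pd i g z" by (subst pd_eqI[OF * l]) simp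
  show "dirder (\<lambda>z. f z + g z) z h = dirder f z h + dirder g z h"
    using dirder_eqI[OF * l] by metis
qed

lemma
  assumes "complex_diff f z" "complex_diff g z"
  shows complex_diff_mult: "complex_diff (\<lambda>z. f z * g z) z"
    and pd_mult: "pd i (\<lambda>z. f z * g z) z = f z * pd i g z + pd i f z * g z"
    and dirder_fmult: "dirder (\<lambda>z. f z * g z) z h = f z * dirder g z h + dirder f z h * g z"
proof -
  have *: "((\<lambda>z. f z * g z) has_derivative (\<lambda>h. f z * dirder g z h + dirder f z h * g z)) (at z)"
    using assms by (intro derivative_intros complex_diffD)
  have l: "f z * dirder g z (c *s v) + dirder f z (c *s v) * g z
      = c * (f z * dirder g z v + dirder f z v * g z)" for c v
    by (simp add: dirder_scale algebra_simps)
  show "complex_diff (\<lambda>z. f z * g z) z" by (rule complex_diffI[OF * l])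
  show "pd i (\<lambda>z. f z * g z) z = f z * pd i g z + pd i f z * g z" by (subst pd_eqI[OF * l]) simp
  show "dirder (\<lambda>z. f z * g z) z h = f z * dirder g z h + dirder f z h * g z"
    using dirder_eqI[OF * l] by metis
qed

lemma
  assumes "complex_diff f z"
  shows complex_diff_minus: "complex_diff (\<lambda>z. - f z) z"
    and pd_minus: "pd i (\<lambda>z. - f z) z = - pd i f z"
  using complex_diff_mult[OF complex_diff_const assms, of "-1"]
    pd_mult[OF complex_diff_const assms, of i "-1"] by auto

lemma
  assumes "complex_diff f z" "complex_diff g z"
  shows complex_diff_diff: "complex_diff (\<lambda>z. f z - g z) z"
    and pd_diff: "pd i (\<lambda>z. f z - g z) z = pd i f z - pd i g z"
  using complex_diff_add[OF assms(1) complex_diff_minus[OF assms(2)]]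
    pd_add[OF assms(1) complex_diff_minus[OF assms(2)]] pd_minus[OF assms(2)] by auto

lemma
  assumes "\<And>k. k \<in> K \<Longrightarrow> complex_diff (f k) z"
  shows complex_diff_sum: "complex_diff (\<lambda>z. \<Sum>k\<in>K. f k z) z"
    and pd_sum: "pd i (\<lambda>z. \<Sum>k\<in>K. f k z) z = (\<Sum>k\<in>K. pd i (f k) z)"
proof -
  have "complex_diff (\<lambda>z. \<Sum>k\<in>K. f k z) z
    \<and> pd i (\<lambda>z. \<Sum>k\<in>K. f k z) z = (\<Sum>k\<in>K. pd i (f k) z)"
    using assms
    by (induction K rule: infinite_finite_induct) (auto simp: complex_diff_add pd_add)
  then show "complex_diff (\<lambda>z. \<Sum>k\<in>K. f k z) z"
    "pd i (\<lambda>z. \<Sum>k\<in>K. f k z) z = (\<Sum>k\<in>K. pd i (f k) z)" by auto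
qed

lemma complex_diff_power: "complex_diff f z \<Longrightarrow> complex_diff (\<lambda>z. f z ^ k) z"
  by (induction k) (auto intro: complex_diff_mult)

lemma complex_diff_prod:
  "(\<And>k. k \<in> K \<Longrightarrow> complex_diff (f k) z) \<Longrightarrow> complex_diff (\<lambda>z. \<Prod>k\<in>K. f k z) z"
  by (induction K rule: infinite_finite_induct) (auto intro: complex_diff_mult)

lemma
  fixes f :: "complex^'n \<Rightarrow> complex^'m"
  assumes g: "complex_diff g (f z)" and f: "\<And>j. complex_diff (\<lambda>z. f z $ j) z"
  shows complex_diff_compose: "complex_diff (\<lambda>z. g (f z)) z"
    and pd_compose: "pd i (\<lambda>z. g (f z)) z = (\<Sum>j\<in>UNIV. pd j g (f z) * pd i (\<lambda>z. f z $ j) z)"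
    and dirder_compose: "dirder (\<lambda>z. g (f z)) z h = dirder g (f z) (\<chi> j. dirder (\<lambda>z. f z $ j) z h)"
proof -
  have fd: "(f has_derivative (\<lambda>h. \<chi> j. dirder (\<lambda>z. f z $ j) z h)) (at z)"
    by (rule has_derivative_vec_componentwise) (use complex_diffD[OF f] in simp)
  from has_derivative_compose[OF fd complex_diffD[OF g]]
  have *: "((\<lambda>z. g (f z)) has_derivative
      (\<lambda>h. dirder g (f z) (\<chi> j. dirder (\<lambda>z. f z $ j) z h))) (at z)" .
  have l: "dirder g (f z) (\<chi> j. dirder (\<lambda>z. f z $ j) z (c *s v))
      = c * dirder g (f z) (\<chi> j. dirder (\<lambda>z. f z $ j) z v)" for c v
  proof -
    have "(\<chi> j. dirder (\<lambda>z. f z $ j) z (c *s v)) = c *s (\<chi> j. dirder (\<lambda>z. f z $ j) z v)"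
      by (simp add: vec_eq_iff dirder_scale)
    then show ?thesis by (simp add: dirder_scale)
  qed
  show "complex_diff (\<lambda>z. g (f z)) z" by (rule complex_diffI[OF * l])
  show "dirder (\<lambda>z. g (f z)) z h = dirder g (f z) (\<chi> j. dirder (\<lambda>z. f z $ j) z h)"
    using dirder_eqI[OF * l] by metis
  show "pd i (\<lambda>z. g (f z)) z = (\<Sum>j\<in>UNIV. pd j g (f z) * pd i (\<lambda>z. f z $ j) z)"
    by (subst pd_eqI[OF * l]) (simp add: dirder_def[of g] mult.commute)
qed

lemma
  assumes "\<forall>\<^sub>F w in nhds z. f w = g w"
  shows complex_diff_cong_ev: "complex_diff f z \<longleftrightarrow> complex_diff g z"
    and pd_cong_ev: "pd i f z = pd i g z"
proof -
  have *: "(f has_derivative D) (at z) \<longleftrightarrow> (g has_derivative D) (at z)" for D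
  proof -
    have fg: "f z = g z" using assms by (rule eventually_nhds_x_imp_x)
    have ev: "eventually (\<lambda>w. f w = g w) (at z)"
      using assms by (simp add: eventually_nhds_conv_at)
    show ?thesis
      using has_derivative_transform_eventually[of f D z UNIV g]
        has_derivative_transform_eventually[of g D z UNIV f] ev fg
      by (auto simp: eq_commute)
  qed
  show "complex_diff f z \<longleftrightarrow> complex_diff g z" by (simp add: complex_diff_def *)
  have "((\<lambda>s::complex. z + s *s axis i 1) \<longlongrightarrow> z) (nhds 0)"
  proof -
    have "isCont (\<lambda>s::complex. z + s *s axis i 1) 0"
      by (intro continuous_intros bounded_linear.continuous[OF bounded_linear_smult_vec])
    then have "((\<lambda>s::complex. z + s *s axis i 1) \<longlongrightarrow> z + 0 *s axis i 1) (nhds 0)"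
      unfolding isCont_def tendsto_at_iff_tendsto_nhds[of "\<lambda>s::complex. z + s *s axis i 1"] .
    then show ?thesis by simp
  qed
  then have "\<forall>\<^sub>F s in nhds 0. f (z + s *s axis i 1) = g (z + s *s axis i 1)"
    by (rule eventually_compose_filterlim[OF assms])
  then show "pd i f z = pd i g z" unfolding pd_def by (rule deriv_cong_ev) simp
qed

section \<open>Cauchy integrals and integrals depending on a parameter\<close>

lemma holomorphic_on_line:
  fixes f :: "complex^'n \<Rightarrow> complex"
  assumes "\<And>s. norm s \<le> r \<Longrightarrow> complex_diff f (z + s *s v)"
  shows "continuous_on (cball 0 r) (\<lambda>s. f (z + s *s v))" "(\<lambda>s. f (z + s *s v)) holomorphic_on ball 0 r"
proof -
  have d: "((\<lambda>s. f (z + s *s v)) has_field_derivative dirder f (z + w *s v) v) (at w)" if "norm w \<le> r" for w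
    using assms[OF that] by (rule complex_diff_line)
  show "continuous_on (cball 0 r) (\<lambda>s. f (z + s *s v))"
    by (rule continuous_at_imp_continuous_on) (auto dest!: d DERIV_isCont)
  show "(\<lambda>s. f (z + s *s v)) holomorphic_on ball 0 r"
    by (auto simp: holomorphic_on_open dest!: less_imp_le d)
qed

definition circle :: "real \<Rightarrow> real \<Rightarrow> complex" where
  "circle r \<theta> = of_real r * exp (2 * of_real pi * \<i> * of_real \<theta>)"

lemma norm_circle: "r \<ge> 0 \<Longrightarrow> norm (circle r \<theta>) = r"
  by (simp add: circle_def norm_mult)

lemma continuous_circle [continuous_intros]: "continuous_on S g \<Longrightarrow> continuous_on S (\<lambda>x. circle r (g x))"
  unfolding circle_def by (intro continuous_intros)

text \<open>Cauchy's formula for the first derivative, on the coordinate line through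
  \<open>z\<close>. The parametrisation over [0, 1] turns du / u^2 into 2 \<pi> \<i> d\<theta> / u,
  which leaves one division by \<open>circle r \<theta>\<close>.\<close>

lemma pd_Cauchy_integral:
  fixes f :: "complex^'n \<Rightarrow> complex"
  assumes r: "r > 0" and f: "\<And>s. norm s \<le> r \<Longrightarrow> complex_diff f (z + s *s axis i 1)"
  shows "pd i f z = integral {0..1} (\<lambda>\<theta>. f (z + circle r \<theta> *s axis i 1) / circle r \<theta>)"
proof -
  let ?g = "\<lambda>s. f (z + s *s axis i 1)"
  have "contour_integral (circlepath 0 r) (\<lambda>u. ?g u / (u - 0)\<^sup>2) = of_real (2 * pi) * \<i> * deriv ?g 0"
    using r by (intro Cauchy_contour_integral_circlepath_2 holomorphic_on_line f) auto
  moreover have "contour_integral (circlepath 0 r) (\<lambda>u. ?g u / (u - 0)\<^sup>2)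
      = integral {0..1} (\<lambda>\<theta>. of_real (2 * pi) * \<i> * (?g (circle r \<theta>) / circle r \<theta>))"
    unfolding contour_integral_integral
  proof (rule integral_cong)
    fix x :: real assume "x \<in> {0..1}"
    then have v: "vector_derivative (circlepath 0 r) (at x) = 2 * pi * \<i> * circle r x"
      by (simp add: vector_derivative_circlepath circle_def mult_ac)
    have c: "circlepath 0 r x = circle r x" by (simp add: circlepath circle_def mult_ac)
    have "circle r x \<noteq> 0" using norm_circle[of r x] r by auto
    then show "?g (circlepath 0 r x) / (circlepath 0 r x - 0)\<^sup>2 * vector_derivative (circlepath 0 r) (at x)
        = of_real (2 * pi) * \<i> * (?g (circle r x) / circle r x)"
      by (simp add: v c power2_eq_square)
  qed
  ultimately have "of_real (2 * pi) * \<i> * deriv ?g 0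
      = of_real (2 * pi) * \<i> * integral {0..1} (\<lambda>\<theta>. ?g (circle r \<theta>) / circle r \<theta>)"
    by (simp only: integral_mult_right)
  then show ?thesis by (simp add: pd_def)
qed

text \<open>Radius \<open>r\<close> for the centre and radius \<open>r\<close> for the coordinate
  circle: with \<open>2 * r\<close> inside \<open>S\<close>, Cauchy's formula holds with one fixed
  radius for all centres in \<open>ball z r\<close>.\<close>

lemma cball_line_subset:
  assumes "cball z (2 * r) \<subseteq> S" "w \<in> ball z r" "norm s \<le> r"
  shows "w + s *s axis i (1::complex) \<in> S"
proof -
  have "norm (s *s axis i (1::complex)) = norm s"
  proof -
    have "s *s axis i (1::complex) = axis i s" by (simp add: vec_eq_iff axis_def)
    then show ?thesis by (simp add: norm_axis_1 norm_vec_def axis_def L2_set_def if_distrib[of norm] if_distrib[of "\<lambda>x. x^2"] cong: if_cong)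
  qed
  moreover have "dist z (w + s *s axis i 1) \<le> dist z w + norm (s *s axis i (1::complex))"
    by (metis dist_triangle dist_add_cancel dist_commute dist_norm diff_add_cancel add_diff_cancel_left')
  ultimately have "dist z (w + s *s axis i 1) \<le> 2 * r" using assms by simp
  then show ?thesis using assms(1) by auto
qed

text \<open>Cauchy's formula carries joint continuity from \<open>F\<close> over to its derivative
  in \<open>z\<close>. Differentiation under the integral sign rests on this.\<close>

lemma continuous_on_pd_param:
  fixes F :: "complex^'n \<Rightarrow> 'b::t2_space \<Rightarrow> complex"
  assumes S: "open S" and hol: "\<And>t. t \<in> T \<Longrightarrow> holomorphic_fun (\<lambda>z. F z t) S"
    and cont: "continuous_on (S \<times> T) (\<lambda>(z, t). F z t)"
  shows "continuous_on (S \<times> T) (\<lambda>(z, t). pd i (\<lambda>z. F z t) z)"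
  unfolding continuous_on_eq_continuous_within
proof safe
  fix z t assume z: "z \<in> S" and t: "t \<in> T"
  obtain r0 where "r0 > 0" "cball z r0 \<subseteq> S" using S z open_contains_cball by blast
  then obtain r where r: "r > 0" "cball z (2 * r) \<subseteq> S" by (metis field_sum_of_halves half_gt_zero mult_2)
  have in_S: "w + s *s axis i 1 \<in> S" if "w \<in> ball z r" "norm s \<le> r" for w s
    using cball_line_subset[OF r(2) that] .
  have eq: "pd i (\<lambda>z. F z u) w = integral (cbox 0 1) (\<lambda>\<theta>. F (w + circle r \<theta> *s axis i 1) u / circle r \<theta>)"
    if "w \<in> ball z r" "u \<in> T" for w u
    using pd_Cauchy_integral[of r "\<lambda>z. F z u" w i] r(1) hol[OF that(2)] in_S[OF that(1)]
    by (simp add: holomorphic_fun_iff)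
  have "continuous_on (ball z r \<times> T)
      (\<lambda>x. integral (cbox 0 1) (\<lambda>\<theta>. F (fst x + circle r \<theta> *s axis i 1) (snd x) / circle r \<theta>))"
  proof (rule integral_continuous_on_param)
    have "continuous_on ((ball z r \<times> T) \<times> cbox 0 1)
       (\<lambda>y. (\<lambda>(z,t). F z t) (fst (fst y) + circle r (snd y) *s axis i 1, snd (fst y)))"
      by (rule continuous_on_compose2[OF cont])
         (use r in_S in \<open>auto intro!: continuous_intros bounded_linear.continuous_on[OF bounded_linear_smult_vec] simp: norm_circle\<close>)
    moreover have "circle r x \<noteq> 0" for x using r(1) norm_circle[of r x] by auto
    ultimately show "continuous_on ((ball z r \<times> T) \<times> cbox 0 1)
       (\<lambda>(x, \<theta>). F (fst x + circle r \<theta> *s axis i 1) (snd x) / circle r \<theta>)"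
      by (auto simp: split_beta intro!: continuous_intros)
  qed
  then have "continuous_on (ball z r \<times> T) (\<lambda>(z, t). pd i (\<lambda>z. F z t) z)"
    by (rule continuous_on_eq) (auto simp: eq)
  then have "continuous (at (z, t) within ball z r \<times> T) (\<lambda>(z, t). pd i (\<lambda>z. F z t) z)"
    using r(1) t by (auto simp: continuous_on_eq_continuous_within)
  moreover have "at (z, t) within ball z r \<times> T = at (z, t) within S \<times> T"
    by (rule at_within_nhd[of _ "ball z r \<times> UNIV"]) (use r in \<open>auto intro!: open_Times\<close>)
  ultimately show "continuous (at (z, t) within S \<times> T) (\<lambda>(z, t). pd i (\<lambda>z. F z t) z)" by simp
qed

lemma
  fixes F :: "complex^'n \<Rightarrow> real \<Rightarrow> complex"
  assumes S: "open S" and hol: "\<And>t. t \<in> {0..1} \<Longrightarrow> holomorphic_fun (\<lambda>z. F z t) S"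
    and cont: "continuous_on (S \<times> {0..1}) (\<lambda>(z, t). F z t)"
  shows holomorphic_integral: "holomorphic_fun (\<lambda>z. integral {0..1} (F z)) S"
    and pd_integral: "z \<in> S \<Longrightarrow>
      pd i (\<lambda>z. integral {0..1} (F z)) z = integral {0..1} (\<lambda>t. pd i (\<lambda>z. F z t) z)"
proof -
  have "complex_diff (\<lambda>z. integral {0..1} (F z)) z \<and>
      pd i (\<lambda>z. integral {0..1} (F z)) z = integral {0..1} (\<lambda>t. pd i (\<lambda>z. F z t) z)" if z: "z \<in> S" for z i
  proof -
    obtain r where r: "r > 0" "ball z r \<subseteq> S" using S z open_contains_ball by blast
    \<comment> \<open>\<open>leibniz_rule\<close> takes the derivative as a continuous family of
      bounded linear maps; its continuity is checked on each vector \<open>h\<close>, where it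
      reduces to partial derivatives.\<close>
    define fx where "fx = (\<lambda>x t. Blinfun (dirder (\<lambda>z. F z t) x))"
    have der: "((\<lambda>z. F z t) has_derivative dirder (\<lambda>z. F z t) x) (at x)" if "x \<in> S" "t \<in> {0..1}" for x t
      using hol[OF that(2)] that by (auto simp: holomorphic_fun_iff intro: complex_diffD)
    have fx: "blinfun_apply (fx x t) = dirder (\<lambda>z. F z t) x" if "x \<in> S" "t \<in> {0..1}" for x t
      unfolding fx_def using has_derivative_bounded_linear[OF der[OF that]]
      by (rule bounded_linear_Blinfun_apply)
    have c1: "continuous_on (S \<times> {0..1}) (\<lambda>(x, t). dirder (\<lambda>z. F z t) x h)" for h
      unfolding dirder_def split_beta
      by (intro continuous_intros continuous_on_pd_param[OF S hol cont, unfolded split_beta])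
    have cfx: "continuous_on (S \<times> {0..1}) (\<lambda>(x, t). fx x t)"
      by (rule continuous_on_blinfun_componentwise, rule continuous_on_eq[OF c1]) (auto simp: fx)
    have D: "((\<lambda>z. integral (cbox 0 1) (F z)) has_derivative integral (cbox 0 1) (fx z)) (at z within ball z r)"
    proof (rule leibniz_rule)
      show "((\<lambda>x. F x t) has_derivative blinfun_apply (fx x t)) (at x within ball z r)"
        if "x \<in> ball z r" "t \<in> cbox 0 1" for x t
        using der[of x t] fx[of x t] that r by (simp add: has_derivative_at_withinI subset_iff)
      show "F x integrable_on cbox 0 1" if "x \<in> ball z r" for x
        using that r by (intro integrable_continuous continuous_on_compose2[OF cont, of _ "\<lambda>t. (x, t)", simplified])
          (auto intro!: continuous_intros)
      show "continuous_on (ball z r \<times> cbox 0 1) (\<lambda>(x, t). fx x t)"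
        using cfx by (rule continuous_on_subset) (use r in auto)
    qed (use r in auto)
    have "fx z integrable_on cbox 0 1"
      using z by (intro integrable_continuous continuous_on_compose2[OF cfx, of _ "\<lambda>t. (z, t)", simplified])
          (auto intro!: continuous_intros)
    from blinfun_apply_integral[OF this]
    have ap: "blinfun_apply (integral (cbox 0 1) (fx z)) h = integral {0..1} (\<lambda>t. dirder (\<lambda>z. F z t) z h)" for h
      using z by (auto simp: fx intro!: integral_cong)
    have D': "((\<lambda>z. integral {0..1} (F z)) has_derivative (\<lambda>h. integral {0..1} (\<lambda>t. dirder (\<lambda>z. F z t) z h))) (at z)"
      using D r by (simp add: at_within_open[of z "ball z r"] ap[abs_def, symmetric] flip: ap)
    have l: "integral {0..1} (\<lambda>t. dirder (\<lambda>z. F z t) z (c *s v)) = c * integral {0..1} (\<lambda>t. dirder (\<lambda>z. F z t) z v)" for c v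
      by (simp add: dirder_scale)
    show ?thesis using complex_diffI[OF D' l] pd_eqI[OF D' l, of i] by simp
  qed
  then show "holomorphic_fun (\<lambda>z. integral {0..1} (F z)) S"
    "z \<in> S \<Longrightarrow> pd i (\<lambda>z. integral {0..1} (F z)) z = integral {0..1} (\<lambda>t. pd i (\<lambda>z. F z t) z)"
    by (auto simp: holomorphic_fun_iff)
qed

lemma holomorphic_fun_diff: "holomorphic_fun f S \<Longrightarrow> z \<in> S \<Longrightarrow> complex_diff f z"
  by (simp add: holomorphic_fun_iff)

lemma holomorphic_fun_subset: "holomorphic_fun f S \<Longrightarrow> T \<subseteq> S \<Longrightarrow> holomorphic_fun f T"
  by (auto simp: holomorphic_fun_def)

lemma
  assumes "complex_diff f (z + c)"
  shows complex_diff_shift: "complex_diff (\<lambda>z. f (z + c)) z"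
    and pd_shift: "pd i (\<lambda>z. f (z + c)) z = pd i f (z + c)"
proof -
  have d: "complex_diff (\<lambda>z. (z + c) $ j) z" for j
    by (simp add: complex_diff_add)
  show "complex_diff (\<lambda>z. f (z + c)) z" using complex_diff_compose[OF assms d] .
  show "pd i (\<lambda>z. f (z + c)) z = pd i f (z + c)"
    by (simp add: pd_def add_ac)
qed

text \<open>Near \<open>z\<close> the function \<open>pd i f\<close> is a parameter integral of
  \<open>f\<close> over a circle, hence holomorphic. Differentiating under the integral in direction
  \<open>j\<close> gives the Cauchy integral of \<open>pd j f\<close>, which is
  \<open>pd i (pd j f)\<close>.\<close>

lemma
  fixes f :: "complex^'n \<Rightarrow> complex"
  assumes S: "open S" and f: "holomorphic_fun f S"
  shows holomorphic_pd: "holomorphic_fun (pd i f) S"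
    and pd_commute: "z \<in> S \<Longrightarrow> pd j (pd i f) z = pd i (pd j f) z"
proof -
  \<comment> \<open>Symmetry presupposes that \<open>pd j f\<close> is holomorphic on all of
    \<open>S\<close>, which is the first half; the implication lets one local argument serve
    both.\<close>
  have *: "complex_diff (pd i f) z \<and> (holomorphic_fun (pd j f) S \<longrightarrow> pd j (pd i f) z = pd i (pd j f) z)"
    if z: "z \<in> S" for z i j
  proof -
    obtain r0 where "r0 > 0" "cball z r0 \<subseteq> S" using S z open_contains_cball by blast
    then obtain r where r: "r > 0" "cball z (2 * r) \<subseteq> S" by (metis field_sum_of_halves half_gt_zero mult_2)
    have in_S: "w + s *s axis i 1 \<in> S" if "w \<in> ball z r" "norm s \<le> r" for w s
      using cball_line_subset[OF r(2) that] .
    define F where "F = (\<lambda>w \<theta>. f (w + circle r \<theta> *s axis i 1) / circle r \<theta>)"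
    have nz: "circle r x \<noteq> 0" for x using r(1) norm_circle[of r x] by auto
    have cd: "complex_diff f (w + circle r t *s axis i 1)" if "w \<in> ball z r" for w t
      using f in_S[OF that] r(1) by (auto simp: norm_circle intro: holomorphic_fun_diff)
    have eq: "pd i g w = integral {0..1} (\<lambda>\<theta>. g (w + circle r \<theta> *s axis i 1) / circle r \<theta>)"
      if "w \<in> ball z r" "holomorphic_fun g S" for w g
      using pd_Cauchy_integral[of r g w i] r(1) in_S[OF that(1)] that(2) by (simp add: holomorphic_fun_iff)
    have Fd: "complex_diff (\<lambda>w. F w t) w" and Fpd: "pd j (\<lambda>w. F w t) w = pd j f (w + circle r t *s axis i 1) / circle r t"
      if "w \<in> ball z r" for w t
      using complex_diff_mult[OF complex_diff_shift[OF cd[OF that]] complex_diff_const]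
        pd_mult[OF complex_diff_shift[OF cd[OF that]] complex_diff_const] 
      by (simp_all add: F_def divide_inverse pd_shift[OF cd[OF that]])
    have cF: "continuous_on (ball z r \<times> {0..1}) (\<lambda>(w, t). F w t)"
      unfolding F_def split_beta using nz r
      by (intro continuous_intros continuous_on_compose2[OF holomorphic_fun_continuous_on[OF f]]
            bounded_linear.continuous_on[OF bounded_linear_smult_vec])
         (auto intro!: in_S simp: norm_circle)
    have hF: "holomorphic_fun (\<lambda>w. F w t) (ball z r)" for t
      using Fd by (simp add: holomorphic_fun_iff)
    have ev: "\<forall>\<^sub>F w in nhds z. pd i f w = integral {0..1} (F w)"
      using eventually_nhds_in_open[of "ball z r" z] r(1)
      by (auto elim!: eventually_mono simp: eq f F_def)
    have 1: "complex_diff (pd i f) z"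
      using holomorphic_integral[OF open_ball hF cF] r(1)
      by (simp add: complex_diff_cong_ev[OF ev] holomorphic_fun_iff)
    have "pd j (pd i f) z = pd i (pd j f) z" if "holomorphic_fun (pd j f) S"
      using pd_integral[OF open_ball hF cF, of z j] r(1)
      by (simp add: pd_cong_ev[OF ev] Fpd eq[OF _ that])
    with 1 show ?thesis by blast
  qed
  show h: "holomorphic_fun (pd i f) S" for i using * by (simp add: holomorphic_fun_iff)
  show "z \<in> S \<Longrightarrow> pd j (pd i f) z = pd i (pd j f) z" using * h by simp
qed

section \<open>Uniform limits of holomorphic functions\<close>

lemma norm_dirder_diff_le:
  fixes h :: "complex^'n"
  assumes "\<And>i. norm (a i - b i) \<le> e"
  shows "norm ((\<Sum>i\<in>UNIV. h $ i * a i) - (\<Sum>i\<in>UNIV. h $ i * b i)) \<le> (real CARD('n) * e) * norm h"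
proof -
  have "(\<Sum>i\<in>UNIV. h $ i * a i) - (\<Sum>i\<in>UNIV. h $ i * b i) = (\<Sum>i\<in>UNIV. h $ i * (a i - b i))"
    by (simp only: sum_subtractf right_diff_distrib)
  also have "norm \<dots> \<le> (\<Sum>i\<in>(UNIV::'n set). norm h * e)"
  proof (rule sum_norm_le)
    fix i
    have "norm (h $ i) * norm (a i - b i) \<le> norm h * e"
      by (rule mult_mono) (simp_all add: assms Finite_Cartesian_Product.norm_nth_le)
    then show "norm (h $ i * (a i - b i)) \<le> norm h * e" by (simp only: norm_mult)
  qed
  finally show ?thesis by (simp add: mult_ac)
qed

text \<open>Cauchy's formula turns uniform convergence of the functions into uniform convergence of
  their partial derivatives on a smaller ball; then the theorem on limits of differentiable
  sequences applies.\<close>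

lemma holomorphic_uniform_limit:
  fixes f :: "nat \<Rightarrow> complex^'n \<Rightarrow> complex"
  assumes S: "open S" and f: "\<And>n. holomorphic_fun (f n) S" and lim: "uniform_limit S f g sequentially"
  shows "holomorphic_fun g S"
  unfolding holomorphic_fun_iff
proof
  fix z assume z: "z \<in> S"
  have cg: "continuous_on S g"
    by (rule uniform_limit_theorem[OF _ lim]) (simp_all add: holomorphic_fun_continuous_on f)
  obtain r0 where "r0 > 0" "cball z r0 \<subseteq> S" using S z open_contains_cball by blast
  then obtain r where r: "r > 0" "cball z (2 * r) \<subseteq> S" by (metis field_sum_of_halves half_gt_zero mult_2)
  have in_S: "w + s *s axis i 1 \<in> S" if "w \<in> ball z r" "norm s \<le> r" for w s i
    using cball_line_subset[OF r(2) that] .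
  have nz: "circle r x \<noteq> 0" for x using r(1) norm_circle[of r x] by auto
  \<comment> \<open>The Cauchy integrals of the limit are the candidates for its partial
    derivatives.\<close>
  define G where "G = (\<lambda>w i. integral {0..1} (\<lambda>\<theta>. g (w + circle r \<theta> *s axis i 1) / circle r \<theta>))"
  have eq: "pd i (f n) w = integral {0..1} (\<lambda>\<theta>. f n (w + circle r \<theta> *s axis i 1) / circle r \<theta>)"
    if "w \<in> ball z r" for w i n
    using pd_Cauchy_integral[of r "f n" w i] r(1) in_S[OF that] f by (simp add: holomorphic_fun_iff)
  have co: "continuous_on {0..1} (\<lambda>\<theta>. u (w + circle r \<theta> *s axis i 1) / circle r \<theta>)"
    if "continuous_on S u" "w \<in> ball z r" for u :: "complex^'n \<Rightarrow> complex" and w i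
    using nz r that
    by (intro continuous_intros continuous_on_compose2[OF that(1)]
          bounded_linear.continuous_on[OF bounded_linear_smult_vec])
       (auto intro!: in_S simp: norm_circle)
  \<comment> \<open>The integrand is divided by a number of modulus \<open>r\<close>, which explains
    the tolerance \<open>e * r\<close>.\<close>
  have bound: "norm (pd i (f n) w - G w i) \<le> e" if w: "w \<in> ball z r" and e: "\<forall>x\<in>S. dist (f n x) (g x) < e * r" for w i n e
  proof -
    have cf: "continuous_on {0..1} (\<lambda>\<theta>. f n (w + circle r \<theta> *s axis i 1) / circle r \<theta>)"
      using f w by (intro co[of "f n" w i]) (auto intro: holomorphic_fun_continuous_on)
    have cg': "continuous_on {0..1} (\<lambda>\<theta>. g (w + circle r \<theta> *s axis i 1) / circle r \<theta>)"
      by (rule co[of g w i, OF cg w])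
    have "pd i (f n) w - G w i = integral {0..1} (\<lambda>\<theta>. f n (w + circle r \<theta> *s axis i 1) / circle r \<theta>
        - g (w + circle r \<theta> *s axis i 1) / circle r \<theta>)"
      unfolding eq[OF w] G_def
      by (rule integral_diff[symmetric]) (rule integrable_continuous_interval cf cg')+
    also have "norm \<dots> \<le> e * (1 - 0)"
    proof (rule integral_bound)
      show "continuous_on {0..1} (\<lambda>\<theta>. f n (w + circle r \<theta> *s axis i 1) / circle r \<theta>
        - g (w + circle r \<theta> *s axis i 1) / circle r \<theta>)"
        by (rule continuous_on_diff[OF cf cg'])
      fix t :: real
      have "w + circle r t *s axis i 1 \<in> S" using in_S[OF w] r(1) by (simp add: norm_circle)
      then have "norm (f n (w + circle r t *s axis i 1) - g (w + circle r t *s axis i 1)) \<le> e * r"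
        using e by (auto simp: dist_norm intro: less_imp_le)
      then show "norm (f n (w + circle r t *s axis i 1) / circle r t - g (w + circle r t *s axis i 1) / circle r t) \<le> e"
        using r(1) by (simp add: diff_divide_distrib[symmetric] norm_divide norm_circle divide_le_eq)
    qed simp
    finally show ?thesis by simp
  qed
  have der: "(f n has_derivative dirder (f n) x) (at x within ball z r)" if "x \<in> ball z r" for n x
  proof -
    have "x \<in> S" using in_S[OF that, of 0] r(1) by simp
    with f[of n] have "complex_diff (f n) x" by (rule holomorphic_fun_diff)
    then show ?thesis by (rule has_derivative_at_withinI[OF complex_diffD])
  qed
  have near: "\<forall>\<^sub>F n in sequentially. \<forall>x\<in>ball z r. \<forall>h::complex^'n. norm (dirder (f n) x h - (\<Sum>i\<in>UNIV. h $ i * G x i)) \<le> e * norm h"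
    if "e > 0" for e :: real
  proof -
    define e' where "e' = e / real CARD('n)"
    have e': "e' > 0" "real CARD('n) * e' = e" using that by (auto simp: e'_def)
    have "\<forall>\<^sub>F n in sequentially. \<forall>x\<in>S. dist (f n x) (g x) < e' * r"
      using lim[unfolded uniform_limit_iff, rule_format, of "e' * r"] e'(1) r(1) by simp
    then show ?thesis
    proof eventually_elim
      case (elim n)
      have "norm (dirder (f n) x h - (\<Sum>i\<in>UNIV. h $ i * G x i)) \<le> e * norm h" if "x \<in> ball z r" for x h
        unfolding dirder_def e'(2)[symmetric]
        by (rule norm_dirder_diff_le) (rule bound[OF that elim])
      then show ?case by blast
    qed
  qed
  have zr: "z \<in> ball z r" using r by simp
  have "\<exists>h. \<forall>x\<in>ball z r. (\<lambda>n. f n x) \<longlonglongrightarrow> h x \<and>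
      (h has_derivative (\<lambda>v. \<Sum>i\<in>UNIV. v $ i * G x i)) (at x within ball z r)"
    by (rule has_derivative_sequence[OF convex_ball der near zr tendsto_uniform_limitI[OF lim z]])
  then obtain h where h: "\<And>x. x \<in> ball z r \<Longrightarrow> (\<lambda>n. f n x) \<longlonglongrightarrow> h x"
      "\<And>x. x \<in> ball z r \<Longrightarrow> (h has_derivative (\<lambda>v. \<Sum>i\<in>UNIV. v $ i * G x i)) (at x within ball z r)"
    by blast
  have hg: "h x = g x" if "x \<in> ball z r" for x
  proof -
    have "x \<in> S" using in_S[OF that, of 0] r(1) by simp
    then show ?thesis using tendsto_uniform_limitI[OF lim] h(1)[OF that] LIMSEQ_unique by blast
  qed
  have "(h has_derivative (\<lambda>v. \<Sum>i\<in>UNIV. v $ i * G z i)) (at z)"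
    using h(2)[of z] r(1) by (simp add: at_within_open[of z "ball z r"])
  then have "complex_diff h z"
    by (rule complex_diffI) (simp add: sum_distrib_left mult.assoc)
  moreover have "\<forall>\<^sub>F x in nhds z. h x = g x"
    using eventually_nhds_in_open[of "ball z r" z] r(1) by (auto elim!: eventually_mono simp: hg)
  ultimately show "complex_diff g z" using complex_diff_cong_ev by blast
qed

section \<open>Primitives in one coordinate\<close>

text \<open>For s from 0 to 1 this is the path of integration of \<open>primitive\<close>; s = 0
  gives the projection to the hyperplane z_i = 0.\<close>

definition rescale :: "'n \<Rightarrow> complex \<Rightarrow> complex^'n \<Rightarrow> complex^'n" where
  "rescale i s z = (\<chi> j. if j = i then s * z $ j else z $ j)"

lemma rescale_line: "rescale i s z = rescale i 0 z + s *s (z $ i *s axis i 1)"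
  by (simp add: rescale_def vec_eq_iff axis_def)

lemma rescale_1 [simp]: "rescale i 1 z = z"
  by (simp add: rescale_def vec_eq_iff)

lemma norm_rescale_le: "norm s \<le> 1 \<Longrightarrow> norm (rescale i s z) \<le> norm z"
  unfolding norm_vec_def[of "rescale i s z"] norm_vec_def[of z]
  by (rule L2_set_mono) (auto simp: rescale_def norm_mult mult_left_le_one_le)

lemma continuous_on_rescale [continuous_intros]:
  "continuous_on S f \<Longrightarrow> continuous_on S g \<Longrightarrow> continuous_on S (\<lambda>x. rescale i (f x) (g x))"
  unfolding rescale_def
proof (intro continuous_on_vec_lambda)
  fix j assume "continuous_on S f" "continuous_on S g"
  then show "continuous_on S (\<lambda>x. if j = i then f x * g x $ j else g x $ j)"
    by (cases "j = i") (auto intro!: continuous_intros)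
qed

text \<open>The integral of \<open>g\<close> from 0 to z_i in the \<open>i\<close>-th variable,
  substituted to the fixed interval [0, 1] so that its dependence on all of \<open>z\<close> is that
  of a parameter integral.\<close>

definition primitive :: "'n \<Rightarrow> (complex^'n \<Rightarrow> complex) \<Rightarrow> complex^'n \<Rightarrow> complex" where
  "primitive i g z = z $ i * integral {0..1} (\<lambda>s. g (rescale i (of_real s) z))"

context
  fixes S :: "(complex^'n) set" and i :: 'n and g :: "complex^'n \<Rightarrow> complex"
  assumes S: "open S" and rescale: "\<And>z s. z \<in> S \<Longrightarrow> 0 \<le> s \<Longrightarrow> s \<le> 1 \<Longrightarrow> rescale i (of_real s) z \<in> S"
    and g: "holomorphic_fun g S"
begin

lemma rescale_holomorphic:
  assumes s: "s \<in> {0..1}"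
  shows "holomorphic_fun (\<lambda>z. g (rescale i (of_real s) z)) S"
    and "z \<in> S \<Longrightarrow> pd i (\<lambda>z. g (rescale i (of_real s) z)) z = of_real s * pd i g (rescale i (of_real s) z)"
proof -
  have c: "complex_diff (\<lambda>z. rescale i (of_real s) z $ j) z" for j z
    by (cases "j = i") (simp_all add: rescale_def complex_diff_mult)
  have p: "pd i (\<lambda>z. rescale i (of_real s) z $ j) z = (if j = i then of_real s else 0)" for j z
    by (auto simp: rescale_def pd_mult pd_coord)
  have gd: "complex_diff g (rescale i (of_real s) z)" if "z \<in> S" for z
    using g rescale[OF that] s by (auto intro: holomorphic_fun_diff)
  show "holomorphic_fun (\<lambda>z. g (rescale i (of_real s) z)) S"
    using complex_diff_compose[OF gd c] by (simp add: holomorphic_fun_iff)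
  show "z \<in> S \<Longrightarrow> pd i (\<lambda>z. g (rescale i (of_real s) z)) z = of_real s * pd i g (rescale i (of_real s) z)"
    by (simp add: pd_compose[OF gd c] p if_distrib[of "\<lambda>x. _ * x"] cong: if_cong)
qed

lemma rescale_continuous: "continuous_on (S \<times> {0..1}) (\<lambda>(z, s). g (rescale i (of_real s) z))"
  unfolding split_beta
  by (rule continuous_on_compose2[OF holomorphic_fun_continuous_on[OF g]]) (auto intro!: continuous_intros rescale)

lemma rescale_continuous': "z \<in> S \<Longrightarrow> continuous_on {0..1} (\<lambda>s. g (rescale i (of_real s) z))"
  by (rule continuous_on_compose2[OF holomorphic_fun_continuous_on[OF g]]) (auto intro!: continuous_intros rescale)

lemma rescale_vector_derivative:
  assumes "z \<in> S" "s \<in> {0..1}"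
  shows "((\<lambda>s. g (rescale i (of_real s) z)) has_vector_derivative z $ i * pd i g (rescale i (of_real s) z)) (at s within T)"
proof -
  have "complex_diff g (rescale i 0 z + of_real s *s (z $ i *s axis i 1))"
    unfolding rescale_line[symmetric] using g rescale[of z s] assms by (auto intro: holomorphic_fun_diff)
  from complex_diff_line[OF this]
  have "((\<lambda>s. g (rescale i s z)) has_field_derivative z $ i * pd i g (rescale i (of_real s) z)) (at (of_real s))"
    unfolding rescale_line[symmetric] by (simp add: dirder_scale)
  then show ?thesis by (rule has_vector_derivative_real_field)
qed

lemma holomorphic_rescale_integral: "holomorphic_fun (\<lambda>z. integral {0..1} (\<lambda>s. g (rescale i (of_real s) z))) S"
  by (rule holomorphic_integral[OF S _ rescale_continuous]) (rule rescale_holomorphic)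

lemma holomorphic_primitive: "holomorphic_fun (primitive i g) S"
  unfolding primitive_def[abs_def] using holomorphic_rescale_integral
  by (simp add: holomorphic_fun_iff complex_diff_mult)

text \<open>The product rule and differentiation under the integral leave the integral of s z_i (pd
  i g) + g, taken at the rescaled point. The integrand is d/ds of s g, so only the value at s = 1
  survives.\<close>

lemma pd_primitive:
  assumes z: "z \<in> S"
  shows "pd i (primitive i g) z = g z"
proof -
  have 1: "((\<lambda>s. of_real s * (z $ i * pd i g (rescale i (of_real s) z)) + 1 * g (rescale i (of_real s) z))
       has_integral (of_real 1 * g (rescale i (of_real 1) z) - of_real 0 * g (rescale i (of_real 0) z))) {0..1}"
    by (rule fundamental_theorem_of_calculus)
       (auto intro!: has_vector_derivative_mult rescale_vector_derivative z derivative_eq_intros)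
  have cp: "continuous_on {0..1} (\<lambda>s. of_real s * pd i g (rescale i (of_real s) z))"
    using z by (intro continuous_intros continuous_on_compose2[OF holomorphic_fun_continuous_on[OF holomorphic_pd[OF S g]]])
      (auto intro!: continuous_intros rescale)
  have "pd i (\<lambda>z. integral {0..1} (\<lambda>s. g (rescale i (complex_of_real s) z))) z
      = integral {0..1} (\<lambda>s. pd i (\<lambda>z. g (rescale i (complex_of_real s) z)) z)"
    by (rule pd_integral[OF S rescale_holomorphic(1) rescale_continuous z])
  also have "\<dots> = integral {0..1} (\<lambda>s. of_real s * pd i g (rescale i (of_real s) z))"
    using z by (intro integral_cong rescale_holomorphic(2))
  finally have "pd i (primitive i g) z = z $ i * integral {0..1} (\<lambda>s. of_real s * pd i g (rescale i (of_real s) z))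
      + integral {0..1} (\<lambda>s. g (rescale i (of_real s) z))"
    unfolding primitive_def[abs_def]
    using holomorphic_rescale_integral z by (simp add: pd_mult holomorphic_fun_iff pd_coord)
  also have "\<dots> = integral {0..1} (\<lambda>s. z $ i * (of_real s * pd i g (rescale i (of_real s) z)) + g (rescale i (of_real s) z))"
    by (subst integral_add) (auto intro!: integrable_continuous_interval rescale_continuous' z continuous_intros cp)
  also have "\<dots> = g z"
    using integral_unique[OF 1] by (simp add: mult_ac)
  finally show ?thesis .
qed

lemma primitive_pd:
  assumes z: "z \<in> S"
  shows "primitive i (pd i g) z = g z - g (rescale i 0 z)"
proof -
  have 1: "((\<lambda>s. (z $ i * pd i g (rescale i (of_real s) z)))
       has_integral (g (rescale i (of_real 1) z) - g (rescale i (of_real 0) z))) {0..1}"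
    by (rule fundamental_theorem_of_calculus)
       (auto intro!: rescale_vector_derivative z)
  then show ?thesis using integral_unique[OF 1] by (simp add: primitive_def)
qed

end

section \<open>Power series expansion\<close>

lemma
  fixes f :: "complex^'n \<Rightarrow> complex"
  assumes "open S" "holomorphic_fun f S"
  shows holomorphic_iterated_pd: "holomorphic_fun ((pd i ^^ m) f) S"
    and higher_deriv_line: "(\<And>s. norm s < r \<Longrightarrow> z + s *s axis i 1 \<in> S) \<Longrightarrow> norm w < r \<Longrightarrow>
      (deriv ^^ m) (\<lambda>s. f (z + s *s axis i 1)) w = (pd i ^^ m) f (z + w *s axis i 1)"
proof -
  show h: "holomorphic_fun ((pd i ^^ m) f) S" for m
    by (induction m) (simp_all add: assms holomorphic_pd)
  show "(\<And>s. norm s < r \<Longrightarrow> z + s *s axis i 1 \<in> S) \<Longrightarrow> norm w < r \<Longrightarrow>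
      (deriv ^^ m) (\<lambda>s. f (z + s *s axis i 1)) w = (pd i ^^ m) f (z + w *s axis i 1)"
  proof (induction m arbitrary: w)
    case (Suc m)
    have "\<forall>\<^sub>F x in nhds w. (deriv ^^ m) (\<lambda>s. f (z + s *s axis i 1)) x = (pd i ^^ m) f (z + x *s axis i 1)"
      using eventually_nhds_in_open[of "ball 0 r" w] Suc.prems
      by (auto elim!: eventually_mono intro!: Suc.IH)
    then have "deriv ((deriv ^^ m) (\<lambda>s. f (z + s *s axis i 1))) w
        = deriv (\<lambda>x. (pd i ^^ m) f (z + x *s axis i 1)) w"
      by (rule deriv_cong_ev) simp
    also have "\<dots> = pd i ((pd i ^^ m) f) (z + w *s axis i 1)"
      using complex_diff_line[OF holomorphic_fun_diff[OF h Suc.prems(1)[OF Suc.prems(2)]]]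
      by (auto intro: DERIV_imp_deriv)
    finally show ?case by simp
  qed simp
qed

text \<open>The multi-indices in the variables expanded so far; the power series is built by adding
  one variable at a time.\<close>

definition supp_in :: "'n set \<Rightarrow> ('n \<Rightarrow> nat) set" where
  "supp_in I = {k. \<forall>i. i \<notin> I \<longrightarrow> k i = 0}"

lemma bij_betw_supp_in_insert:
  assumes "i \<notin> I"
  shows "bij_betw (\<lambda>(k, m). k(i := m)) (supp_in I \<times> UNIV) (supp_in (insert i I))"
  by (rule bij_betwI[where g = "\<lambda>k. (k(i := 0), k i)"])
     (use assms in \<open>auto simp: supp_in_def fun_eq_iff\<close>)

lemma prod_insert_upd:
  fixes g :: "'n \<Rightarrow> 'x::comm_monoid_mult"
  assumes "finite I" "i \<notin> I"
  shows "(\<Prod>j\<in>insert i I. g j ^ (k(i := m)) j) = (\<Prod>j\<in>I. g j ^ k j) * g i ^ m"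
proof -
  have "(\<Prod>j\<in>I. g j ^ (k(i := m)) j) = (\<Prod>j\<in>I. g j ^ k j)"
    using assms(2) by (intro prod.cong) auto
  then show ?thesis using assms by (simp add: mult.commute)
qed

text \<open>The majorant behind Cauchy's estimates, summed one variable at a time as a geometric
  series.\<close>

lemma summable_on_geometric_prod:
  fixes q :: "'n \<Rightarrow> real"
  assumes "finite I" and q: "\<And>i. 0 \<le> q i" "\<And>i. q i < 1"
  shows "(\<lambda>k. \<Prod>i\<in>I. q i ^ k i) summable_on supp_in I"
  using assms(1)
proof induction
  case empty
  have "supp_in {} = {\<lambda>_::'n. 0}" by (auto simp: supp_in_def)
  then show ?case by simp
next
  case (insert i I)
  have "(\<lambda>y. case y of (k, m) \<Rightarrow> (\<Prod>j\<in>I. q j ^ k j) * q i ^ m) summable_on supp_in I \<times> UNIV"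
  proof (rule summable_on_SigmaI)
    fix k
    have "((\<lambda>m. q i ^ m) has_sum 1 / (1 - q i)) UNIV"
      using q[of i] by (intro sums_nonneg_imp_has_sum geometric_sums) auto
    then show "((\<lambda>m. case (k, m) of (k, m) \<Rightarrow> (\<Prod>j\<in>I. q j ^ k j) * q i ^ m) has_sum
        (\<Prod>j\<in>I. q j ^ k j) * (1 / (1 - q i))) UNIV"
      by (simp only: prod.case has_sum_cmult_right)
  next
    show "(\<lambda>k. (\<Prod>j\<in>I. q j ^ k j) * (1 / (1 - q i))) summable_on supp_in I"
      by (intro summable_on_cmult_left insert.IH)
  qed (auto intro!: mult_nonneg_nonneg prod_nonneg zero_le_power q)
  moreover have "(case y of (k, m) \<Rightarrow> (\<Prod>j\<in>I. q j ^ k j) * q i ^ m)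
      = (\<Prod>j\<in>insert i I. q j ^ (case y of (k, m) \<Rightarrow> k(i := m)) j)" for y
    using prod_insert_upd[OF insert.hyps, of q] by (cases y) (simp del: prod.insert)
  ultimately have "(\<lambda>y. \<Prod>j\<in>insert i I. q j ^ (case y of (k, m) \<Rightarrow> k(i := m)) j) summable_on supp_in I \<times> UNIV"
    by (simp only:)
  then show ?case
    using summable_on_reindex_bij_betw[OF bij_betw_supp_in_insert[OF insert.hyps(2)],
        of "\<lambda>k. \<Prod>j\<in>insert i I. q j ^ k j"] by simp
qed

definition polydisc :: "real \<Rightarrow> (complex^'n) set" where
  "polydisc r = {z. \<forall>i. norm (z $ i) < r}"

lemma open_polydisc: "open (polydisc r :: (complex^'n) set)"
proof -
  have "polydisc r = (\<Inter>i\<in>UNIV. {z::complex^'n. norm (z $ i) < r})" by (auto simp: polydisc_def)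
  moreover have "open {z::complex^'n. norm (z $ i) < r}" for i
    by (intro open_Collect_less continuous_intros)
  ultimately show ?thesis by (metis (no_types, lifting) finite open_INT)
qed

lemma rescale_axis: "rescale i s z = rescale i 0 z + (s * z $ i) *s axis i 1"
  by (simp add: rescale_def vec_eq_iff axis_def)

text \<open>Taylor's theorem on the line through \<open>z\<close> in direction \<open>i\<close>,
  with base point on z_i = 0. The coefficients are again holomorphic, depend on the other
  coordinates only and satisfy Cauchy's inequality, so the step can be repeated in the next
  variable.\<close>

lemma coord_line_expansion:
  fixes c :: "complex^'n \<Rightarrow> complex" and i :: 'n
  assumes r: "0 < r" "r < R" and c: "holomorphic_fun c (polydisc R)"
    and B: "\<And>z. (\<forall>i. norm (z $ i) \<le> r) \<Longrightarrow> norm (c z) \<le> B"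
  defines "d \<equiv> (\<lambda>m z. (pd i ^^ m) c (rescale i 0 z) / fact m)"
  shows "holomorphic_fun (d m) (polydisc R)"
    and "(\<forall>i. norm (z $ i) \<le> r) \<Longrightarrow> norm (d m z) \<le> B / r ^ m"
    and "(\<forall>i. norm (z $ i) < r) \<Longrightarrow> ((\<lambda>m. d m z * (z $ i) ^ m) has_sum c z) UNIV"
proof -
  have sc: "rescale i 0 z + s *s axis i 1 \<in> polydisc R" if "\<forall>i. norm (z $ i) < R" "norm s < R" for z s
    using that by (auto simp: polydisc_def rescale_def axis_def)
  have sc0: "rescale i 0 z \<in> polydisc R" if "\<forall>i. norm (z $ i) < R" for z
    using sc[OF that, of 0] r by simp
  have "complex_diff (\<lambda>z. rescale i 0 z $ j) z" for j z
    by (cases "j = i") (simp_all add: rescale_def)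
  note comp = complex_diff_compose[OF _ this]
  show "holomorphic_fun (d m) (polydisc R)"
    unfolding holomorphic_fun_iff
  proof
    fix z :: "complex^'n" assume "z \<in> polydisc R"
    then have "complex_diff ((pd i ^^ m) c) (rescale i 0 z)"
      using sc0 by (intro holomorphic_fun_diff[OF holomorphic_iterated_pd[OF open_polydisc c]]) (simp add: polydisc_def)
    from complex_diff_mult[OF comp[OF this] complex_diff_const]
    show "complex_diff (d m) z" by (simp add: d_def divide_inverse)
  qed
  have dm: "d m z = (deriv ^^ m) (\<lambda>s. c (rescale i 0 z + s *s axis i 1)) 0 / fact m"
    if "\<forall>i. norm (z $ i) < R" for z m
    using higher_deriv_line[OF open_polydisc c sc[OF that], of R 0 m] r by (simp add: d_def)
  have cd: "complex_diff c (rescale i 0 z + s *s axis i 1)" if "\<forall>i. norm (z $ i) < R" "norm s < R" for s z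
    using c sc[OF that] by (rule holomorphic_fun_diff)
  have bound: "norm (d m z) \<le> B / r ^ m" if "\<forall>i. norm (z $ i) \<le> r" for z m
  proof -
    have z: "\<forall>i. norm (z $ i) < R" using that r(2) by (meson le_less_trans)
    have "norm ((deriv ^^ m) (\<lambda>s. c (rescale i 0 z + s *s axis i 1)) 0) \<le> fact m * B / r ^ m"
    proof (rule Cauchy_inequality)
      show "norm (c (rescale i 0 z + x *s axis i 1)) \<le> B" if "norm (0 - x) = r" for x
        using \<open>\<forall>i. norm (z $ i) \<le> r\<close> that r by (intro B) (auto simp: rescale_def axis_def)
    qed (use r z in \<open>auto intro!: holomorphic_on_line cd\<close>)
    then show ?thesis by (simp add: dm[OF z] norm_divide field_simps)
  qed
  then show "(\<forall>i. norm (z $ i) \<le> r) \<Longrightarrow> norm (d m z) \<le> B / r ^ m" .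
  show "((\<lambda>m. d m z * (z $ i) ^ m) has_sum c z) UNIV" if z: "\<forall>i. norm (z $ i) < r"
  proof (rule norm_summable_imp_has_sum)
    have z': "\<forall>i. norm (z $ i) < R" "\<forall>i. norm (z $ i) \<le> r" using z r(2) by (meson less_trans less_imp_le)+
    have "summable (\<lambda>m. B * (norm (z $ i) / r) ^ m)"
      using r z by (intro summable_mult summable_geometric) (auto simp: norm_divide)
    then show "summable (\<lambda>m. norm (d m z * (z $ i) ^ m))"
    proof (rule summable_comparison_test')
      show "norm (norm (d m z * (z $ i) ^ m)) \<le> B * (norm (z $ i) / r) ^ m" for m
        using mult_right_mono[OF bound[OF z'(2), of m], of "norm (z $ i) ^ m"]
        by (simp add: norm_mult norm_power power_divide)
    qed
    have "(\<lambda>m. (deriv ^^ m) (\<lambda>s. c (rescale i 0 z + s *s axis i 1)) 0 / fact m * (z $ i - 0) ^ m)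
        sums c (rescale i 0 z + (z $ i) *s axis i 1)"
      by (rule holomorphic_power_series[where r = r]) (use r z z' in \<open>auto intro!: holomorphic_on_line cd\<close>)
    then show "(\<lambda>m. d m z * (z $ i) ^ m) sums c z"
      using rescale_axis[of i 1 z] by (simp add: dm[OF z'(1)])
  qed
qed

text \<open>Translation along axis \<open>j\<close> commutes with partial derivatives. Expanding in
  a new variable therefore does not bring back the variables already expanded.\<close>

lemma iterated_pd_independent:
  assumes "\<And>z s. c (z + s *s axis j 1) = c z"
  shows "(pd i ^^ m) c (z + s *s axis j 1) = (pd i ^^ m) c z"
proof (induction m arbitrary: z)
  case (Suc m)
  have "(pd i ^^ m) c (z + s *s axis j 1 + t *s axis i 1) = (pd i ^^ m) c (z + t *s axis i 1)" for t
    using Suc[of "z + t *s axis i 1"] by (simp add: add_ac)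
  then show ?case unfolding funpow.simps comp_def pd_def[of i "(pd i ^^ m) c"] by simp
qed (simp add: assms)

text \<open>Induction on the set \<open>I\<close> of expanded variables. The bound is carried along
  because it makes the double series absolutely summable, and the independence because for
  \<open>I = UNIV\<close> it turns the coefficient functions into constants.\<close>

lemma multi_power_series:
  fixes f :: "complex^'n \<Rightarrow> complex"
  assumes r: "0 < r" "r < R" and f: "holomorphic_fun f (polydisc R)"
    and M: "\<And>z. (\<forall>i. norm (z $ i) \<le> r) \<Longrightarrow> norm (f z) \<le> M"
  shows "\<exists>c. (\<forall>k\<in>supp_in I. holomorphic_fun (c k) (polydisc R) \<and>
            (\<forall>z. (\<forall>i. norm (z $ i) \<le> r) \<longrightarrow> norm (c k z) \<le> M * (\<Prod>i\<in>I. (1 / r) ^ k i)) \<and>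
            (\<forall>j\<in>I. \<forall>z s. c k (z + s *s axis j 1) = c k z)) \<and>
         (\<forall>z. (\<forall>i. norm (z $ i) < r) \<longrightarrow> ((\<lambda>k. c k z * (\<Prod>i\<in>I. (z $ i) ^ k i)) has_sum f z) (supp_in I))"
proof -
  have "finite I" by simp
  then show ?thesis
  proof (induction I)
    case empty
    have "supp_in {} = {\<lambda>_::'n. 0}" by (auto simp: supp_in_def)
    then show ?case
      by (intro exI[of _ "\<lambda>_. f"]) (auto simp: f M intro!: has_sum_finiteI)
  next
    case (insert i I)
    from insert.IH obtain c where
      hol: "\<And>k. k \<in> supp_in I \<Longrightarrow> holomorphic_fun (c k) (polydisc R)" and
      bd: "\<And>k z. k \<in> supp_in I \<Longrightarrow> (\<forall>i. norm (z $ i) \<le> r) \<Longrightarrow> norm (c k z) \<le> M * (\<Prod>i\<in>I. (1 / r) ^ k i)" and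
      indep: "\<And>k j z s. k \<in> supp_in I \<Longrightarrow> j \<in> I \<Longrightarrow> c k (z + s *s axis j 1) = c k z" and
      sum: "\<And>z. (\<forall>i. norm (z $ i) < r) \<Longrightarrow> ((\<lambda>k. c k z * (\<Prod>i\<in>I. (z $ i) ^ k i)) has_sum f z) (supp_in I)"
      by blast
    define d where "d = (\<lambda>k m z. (pd i ^^ m) (c k) (rescale i 0 z) / fact m)"
    \<comment> \<open>The exponent of the new variable is stored in \<open>k i\<close>; resetting it
      to 0 recovers the index of the old coefficient.\<close>
    define c' where "c' = (\<lambda>k. d (k(i := 0)) (k i))"
    have k0: "k(i := 0) \<in> supp_in I" if "k \<in> supp_in (insert i I)" for k :: "'n \<Rightarrow> nat"
      using that by (auto simp: supp_in_def)
    have exp1: "holomorphic_fun (d k m) (polydisc R)" if "k \<in> supp_in I" for k m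
      unfolding d_def by (rule coord_line_expansion(1)[OF r hol[OF that] bd[OF that]])
    have exp2: "norm (d k m z) \<le> M * (\<Prod>i\<in>I. (1 / r) ^ k i) / r ^ m"
      if "k \<in> supp_in I" "\<forall>i. norm (z $ i) \<le> r" for k m z
      unfolding d_def by (rule coord_line_expansion(2)[OF r hol[OF that(1)] bd[OF that(1)] that(2)])
    have exp3: "((\<lambda>m. d k m z * (z $ i) ^ m) has_sum c k z) UNIV"
      if "k \<in> supp_in I" "\<forall>i. norm (z $ i) < r" for k z
      unfolding d_def by (rule coord_line_expansion(3)[OF r hol[OF that(1)] bd[OF that(1)] that(2)])
    have prod_ins: "(\<Prod>j\<in>insert i I. g j ^ (k(i := m)) j) = (\<Prod>j\<in>I. g j ^ k j) * g i ^ m"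
      for g :: "'n \<Rightarrow> 'x::comm_monoid_mult" and k and m :: nat
      by (rule prod_insert_upd[OF insert.hyps])
    show ?case
    proof (intro exI[of _ c'] conjI ballI allI impI)
      fix k assume k: "k \<in> supp_in (insert i I)"
      show "holomorphic_fun (c' k) (polydisc R)"
        unfolding c'_def by (rule exp1[OF k0[OF k]])
      show "norm (c' k z) \<le> M * (\<Prod>i\<in>insert i I. (1 / r) ^ k i)" if "\<forall>i. norm (z $ i) \<le> r" for z
      proof -
        have "(\<Prod>j\<in>insert i I. (1 / r) ^ k j) = (\<Prod>j\<in>I. (1 / r) ^ (k(i := 0)) j) * (1 / r) ^ k i"
          using prod_ins[of "\<lambda>_. 1 / r" "k(i := 0)" "k i"] by simp
        then have "M * (\<Prod>j\<in>insert i I. (1 / r) ^ k j) = M * (\<Prod>j\<in>I. (1 / r) ^ (k(i := 0)) j) / r ^ k i"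
          by (simp only: power_one_over mult.assoc times_divide_eq_right mult_1_right)
        then show ?thesis
          using exp2[OF k0[OF k] that, of "k i"] by (simp only: c'_def)
      qed
      show "c' k (z + s *s axis j 1) = c' k z" if j: "j \<in> insert i I" for j z s
      proof (cases "j = i")
        case True
        then have "rescale i 0 (z + s *s axis j 1) = rescale i 0 z" by (simp add: rescale_def vec_eq_iff axis_def)
        then show ?thesis by (simp add: c'_def d_def)
      next
        case False
        then have *: "rescale i 0 (z + s *s axis j 1) = rescale i 0 z + s *s axis j 1"
          by (auto simp: rescale_def vec_eq_iff axis_def)
        show ?thesis
          using iterated_pd_independent[of "c (k(i := 0))" j "k i" i "rescale i 0 z" s] indep[OF k0[OF k]] j False
          by (simp add: c'_def d_def *)
      qed
    next
      fix z :: "complex^'n" assume z: "\<forall>i. norm (z $ i) < r"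
      then have z': "\<forall>i. norm (z $ i) \<le> r" by (simp add: less_imp_le)
      define t where "t = (\<lambda>(k, m). d k m z * (z $ i) ^ m * (\<Prod>i\<in>I. (z $ i) ^ k i))"
      define q where "q = (\<lambda>i. norm (z $ i) / r)"
      have q: "0 \<le> q j" "q j < 1" for j using z r by (auto simp: q_def)
      have M0: "0 \<le> M" using M[of 0] r by (metis (no_types, lifting) less_imp_le norm_ge_zero norm_zero order_trans zero_index)
      \<comment> \<open>Cauchy's bound against the powers of the coordinates leaves \<open>M\<close>
        times a product of powers of the ratios \<open>q j\<close>, all smaller than 1.\<close>
      have "(\<lambda>y. norm (t y)) summable_on supp_in I \<times> UNIV"
      proof (rule Infinite_Sum.abs_summable_on_comparison_test)
        have "(\<lambda>k. \<Prod>j\<in>insert i I. q j ^ k j) summable_on supp_in (insert i I)"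
          using insert.hyps(1) q by (intro summable_on_geometric_prod) auto
        then have "(\<lambda>y. \<Prod>j\<in>insert i I. q j ^ (case y of (k, m) \<Rightarrow> k(i := m)) j) summable_on supp_in I \<times> UNIV"
          using summable_on_reindex_bij_betw[OF bij_betw_supp_in_insert[OF insert.hyps(2)],
            of "\<lambda>k. \<Prod>j\<in>insert i I. q j ^ k j"] by simp
        then have "(\<lambda>y. M * (\<Prod>j\<in>insert i I. q j ^ (case y of (k, m) \<Rightarrow> k(i := m)) j)) summable_on supp_in I \<times> UNIV"
          by (rule summable_on_cmult_right)
        then show "(\<lambda>y. norm (M * (\<Prod>j\<in>insert i I. q j ^ (case y of (k, m) \<Rightarrow> k(i := m)) j))) summable_on supp_in I \<times> UNIV"
          by (rule summable_on_iff_abs_summable_on_real[THEN iffD1])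
        fix y assume "y \<in> supp_in I \<times> (UNIV :: nat set)"
        then obtain k m where y: "y = (k, m)" and k: "k \<in> supp_in I" by auto
        have "norm (t y) = norm (d k m z) * (norm (z $ i) ^ m * (\<Prod>i\<in>I. norm (z $ i) ^ k i))"
          by (simp add: t_def y norm_mult norm_power prod_norm[symmetric])
        also have "\<dots> \<le> M * (\<Prod>i\<in>I. (1 / r) ^ k i) / r ^ m * (norm (z $ i) ^ m * (\<Prod>i\<in>I. norm (z $ i) ^ k i))"
          using exp2[OF k z', of m] by (intro mult_right_mono) (auto intro!: mult_nonneg_nonneg prod_nonneg)
        also have "\<dots> = M * ((\<Prod>j\<in>I. q j ^ k j) * q i ^ m)"
          by (simp add: q_def power_divide prod_dividef)
        also have "\<dots> \<le> norm (M * (\<Prod>j\<in>insert i I. q j ^ (case y of (k, m) \<Rightarrow> k(i := m)) j))"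
          using prod_ins[of q k m] M0 by (simp add: y del: prod.insert)
        finally show "norm (t y) \<le> norm (M * (\<Prod>j\<in>insert i I. q j ^ (case y of (k, m) \<Rightarrow> k(i := m)) j))" .
      qed
      then have st: "t summable_on supp_in I \<times> UNIV" by (rule abs_summable_summable)
      have "(t has_sum f z) (supp_in I \<times> UNIV)"
      proof (rule has_sum_SigmaI[OF _ sum[OF z] st])
        fix k assume k: "k \<in> supp_in I"
        show "((\<lambda>m. t (k, m)) has_sum c k z * (\<Prod>i\<in>I. (z $ i) ^ k i)) UNIV"
          using has_sum_cmult_left[OF exp3[OF k z], of "\<Prod>i\<in>I. (z $ i) ^ k i"] by (simp add: t_def)
      qed
      moreover have "t y = (\<lambda>k. c' k z * (\<Prod>j\<in>insert i I. (z $ j) ^ k j)) (case y of (k, m) \<Rightarrow> k(i := m))"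
        if "y \<in> supp_in I \<times> UNIV" for y
      proof -
        obtain k m where y: "y = (k, m)" and k: "k \<in> supp_in I" using \<open>y \<in> supp_in I \<times> UNIV\<close> by auto
        have "k(i := 0) = k" using k insert.hyps(2) by (auto simp: supp_in_def)
        then show ?thesis using prod_ins[of "\<lambda>j. z $ j" k m] by (simp add: y t_def c'_def mult_ac del: prod.insert)
      qed
      ultimately have "((\<lambda>y. (\<lambda>k. c' k z * (\<Prod>j\<in>insert i I. (z $ j) ^ k j)) (case y of (k, m) \<Rightarrow> k(i := m))) has_sum f z) (supp_in I \<times> UNIV)"
        by (simp cong: has_sum_cong)
      then show "((\<lambda>k. c' k z * (\<Prod>i\<in>insert i I. (z $ i) ^ k i)) has_sum f z) (supp_in (insert i I))"
        by (rule has_sum_reindex_bij_betw[OF bij_betw_supp_in_insert[OF insert.hyps(2)], THEN iffD1])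
    qed
  qed
qed

section \<open>Convergent series as germs of holomorphic functions\<close>

lemma norm_le_card_mult:
  fixes z :: "complex^'n"
  assumes "\<And>i. norm (z $ i) \<le> r"
  shows "norm z \<le> real CARD('n) * r"
proof -
  have "norm z \<le> (\<Sum>i\<in>(UNIV::'n set). norm (z $ i))"
    unfolding norm_vec_def by (rule L2_set_le_sum) simp
  also have "\<dots> \<le> (\<Sum>i\<in>(UNIV::'n set). r)" by (rule sum_mono) (rule assms)
  finally show ?thesis by simp
qed

lemma holomorphic_imp_convergent_series:
  fixes f :: "complex^'n \<Rightarrow> complex"
  assumes \<rho>: "\<rho> > 0" and f: "holomorphic_fun f (ball 0 \<rho>)"
  shows "f \<in> convergent_series"
proof -
  \<comment> \<open>A point of \<open>polydisc R\<close> has norm at most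
    \<open>CARD('n) * R\<close>; the \<open>+ 1\<close> keeps it strictly inside the ball of radius
    \<rho>.\<close>
  define R where "R = \<rho> / (real CARD('n) + 1)"
  define r where "r = R / 2"
  have R: "R > 0" using \<rho> by (auto simp: R_def)
  then have r: "0 < r" "r < R" by (auto simp: r_def)
  have cR: "real CARD('n) * R < \<rho>"
    using \<rho> by (simp add: R_def field_simps)
  have "real CARD('n) * r \<le> real CARD('n) * R" using r by (intro mult_left_mono) auto
  then have cr: "real CARD('n) * r < \<rho>" using cR by (rule le_less_trans)
  have sub: "z \<in> ball 0 \<rho>" if z: "z \<in> polydisc R" for z :: "complex^'n"
  proof -
    have "norm (z $ i) \<le> R" for i using z by (simp add: polydisc_def less_imp_le)
    then have "norm z \<le> real CARD('n) * R" by (rule norm_le_card_mult)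
    with cR show ?thesis by simp
  qed
  have fR: "holomorphic_fun f (polydisc R)"
    by (rule holomorphic_fun_subset[OF f]) (rule subsetI, rule sub)
  have "compact (f ` cball 0 (real CARD('n) * r))"
    by (rule compact_continuous_image[OF continuous_on_subset[OF holomorphic_fun_continuous_on[OF f]]])
      (use cR cr in \<open>auto simp: subset_iff\<close>)
  then obtain M where M: "\<And>w. w \<in> cball 0 (real CARD('n) * r) \<Longrightarrow> norm (f w) \<le> M"
    using compact_imp_bounded[of "f ` cball 0 (real CARD('n) * r)"] unfolding bounded_iff by blast
  have M': "norm (f z) \<le> M" if "\<forall>i. norm (z $ i) \<le> r" for z
    using norm_le_card_mult[of z r] that by (intro M) simp
  have U: "supp_in UNIV = (UNIV :: ('n \<Rightarrow> nat) set)" by (simp add: supp_in_def)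
  obtain c where c: "\<forall>k\<in>UNIV. holomorphic_fun (c k) (polydisc R) \<and>
            (\<forall>z. (\<forall>i. norm (z $ i) \<le> r) \<longrightarrow> norm (c k z) \<le> M * (\<Prod>i\<in>UNIV. (1 / r) ^ k i)) \<and>
            (\<forall>j\<in>UNIV. \<forall>z s. c k (z + s *s axis j 1) = c k z)"
    "\<forall>z. (\<forall>i. norm (z $ i) < r) \<longrightarrow> ((\<lambda>k. c k z * (\<Prod>i\<in>UNIV. (z $ i) ^ k i)) has_sum f z) UNIV"
    using multi_power_series[OF r fR M', of UNIV] unfolding U by blast
  have indep: "c k (z + s *s axis j 1) = c k z" for k z s j
    using c(1) by blast
  have sum: "((\<lambda>k. c k z * (\<Prod>i\<in>UNIV. (z $ i) ^ k i)) has_sum f z) UNIV" if "\<forall>i. norm (z $ i) < r" for z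
    using c(2) that by blast
  \<comment> \<open>Walking from 0 to \<open>z\<close> one axis at a time shows that the
    coefficients are constants.\<close>
  have "c k (\<Sum>j\<in>J. z $ j *s axis j 1) = c k 0" if "finite J" for k J and z :: "complex^'n"
    using that
  proof (induction J)
    case (insert j J)
    then show ?case using indep[of k "\<Sum>j\<in>J. z $ j *s axis j 1" "z $ j" j] by (simp add: add.commute)
  qed simp
  from this[of UNIV] have c0: "c k z = c k 0" for k z
    by (simp add: basis_expansion)
  have sum0: "((\<lambda>k. c k 0 * (\<Prod>i\<in>UNIV. (z $ i) ^ k i)) has_sum f z) UNIV" if "z \<in> polydisc r" for z
    using sum[of z] that unfolding c0[of _ z] by (simp add: polydisc_def)
  have "\<forall>\<^sub>F z in nhds 0. z \<in> (polydisc r :: (complex^'n) set)"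
    using r by (intro eventually_nhds_in_open open_polydisc) (simp add: polydisc_def)
  then have "\<forall>\<^sub>F z in nhds 0. ((\<lambda>k. c k 0 * (\<Prod>i\<in>UNIV. (z $ i) ^ k i)) has_sum f z) UNIV"
    by (rule eventually_mono) (rule sum0)
  then show ?thesis unfolding convergent_series_def by (intro CollectI exI)
qed

text \<open>Abel's argument: on a small ball every term is bounded by its size \<open>A k\<close> at
  the point with all coordinates equal to \<open>r\<close>, where the series converges absolutely.
  So finite partial sums converge uniformly, and their limit is holomorphic.\<close>

lemma convergent_series_imp_holomorphic:
  fixes f :: "complex^'n \<Rightarrow> complex"
  assumes "f \<in> convergent_series"
  shows "\<exists>r>0. holomorphic_fun f (ball 0 r)"
proof -
  obtain c where "\<forall>\<^sub>F z in nhds 0. ((\<lambda>k. c k * (\<Prod>i\<in>UNIV. (z $ i) ^ k i)) has_sum f z) UNIV"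
    using assms by (auto simp: convergent_series_def)
  then obtain \<rho> where \<rho>: "\<rho> > 0" and
    sum: "\<And>z. z \<in> ball 0 \<rho> \<Longrightarrow> ((\<lambda>k. c k * (\<Prod>i\<in>UNIV. (z $ i) ^ k i)) has_sum f z) UNIV"
    unfolding eventually_nhds_metric by (auto simp: dist_commute)
  define r where "r = \<rho> / (real CARD('n) + 1)"
  have r: "0 < r" "r \<le> \<rho>" "real CARD('n) * r < \<rho>" using \<rho> by (auto simp: r_def field_simps)
  define t where "t = (\<lambda>k (z::complex^'n). c k * (\<Prod>i\<in>UNIV. (z $ i) ^ k i))"
  define A where "A = (\<lambda>k. norm (t k (\<chi> i. of_real r)))"
  have "(\<chi> i. of_real r) \<in> ball (0 :: complex^'n) \<rho>"
    using norm_le_card_mult[of "(\<chi> i. of_real r) :: complex^'n" r] r by simp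
  from sum[OF this] have "(\<lambda>k. t k (\<chi> i. of_real r)) summable_on UNIV"
    unfolding t_def by (rule has_sum_imp_summable)
  then have As: "A summable_on UNIV"
    unfolding A_def by (rule summable_on_iff_abs_summable_on_complex[THEN iffD1])
  have tA: "norm (t k z) \<le> A k" if "z \<in> ball 0 r" for z k
  proof -
    have "norm (z $ i) \<le> r" for i
      using that Finite_Cartesian_Product.norm_nth_le[of z i] by simp
    then have "(\<Prod>i\<in>UNIV. norm (z $ i) ^ k i) \<le> (\<Prod>i\<in>UNIV. r ^ k i)"
      by (intro prod_mono) (auto intro: power_mono)
    then show ?thesis using r(1)
      by (auto simp: A_def t_def norm_mult norm_power prod_norm[symmetric] intro: mult_left_mono)
  qed
  \<comment> \<open>The index set carries no order; the partial sums run over finite sets that miss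
    at most \<open>1 / real (Suc n)\<close> of the total of \<open>A\<close>.\<close>
  have "\<exists>F. finite F \<and> dist (sum A F) (infsum A UNIV) \<le> 1 / real (Suc n)" for n
    using infsum_finite_approximation[OF As, of "1 / real (Suc n)"] by auto
  then obtain F where F: "\<And>n. finite (F n)" "\<And>n. dist (sum A (F n)) (infsum A UNIV) \<le> 1 / real (Suc n)"
    by metis
  have near: "norm (f z - (\<Sum>k\<in>F n. t k z)) \<le> 1 / real (Suc n)" if z: "z \<in> ball 0 r" for z n
  proof -
    have "(t' has_sum f z - (\<Sum>k\<in>F n. t' k)) (UNIV - F n)" if "t' = (\<lambda>k. t k z)" for t'
      using sum[of z] z r(2) that by (intro has_sum_Diff has_sum_finite F) (auto simp: t_def)
    then have 1: "((\<lambda>k. t k z) has_sum f z - (\<Sum>k\<in>F n. t k z)) (UNIV - F n)" by blast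
    have 2: "(A has_sum infsum A UNIV - sum A (F n)) (UNIV - F n)"
      using As by (intro has_sum_Diff has_sum_finite F) auto
    have 3: "(\<lambda>k. norm (t k z)) summable_on (UNIV - F n)"
      by (rule summable_on_iff_abs_summable_on_complex[THEN iffD1]) (rule has_sum_imp_summable[OF 1])
    have "norm (f z - (\<Sum>k\<in>F n. t k z)) \<le> infsum (\<lambda>k. norm (t k z)) (UNIV - F n)"
      by (rule norm_has_sum_bound[OF has_sum_infsum[OF 3] 1])
    also have "\<dots> \<le> infsum A UNIV - sum A (F n)"
      by (rule has_sum_mono[OF has_sum_infsum[OF 3] 2]) (rule tA[OF z])
    also have "\<dots> \<le> 1 / real (Suc n)" using F(2)[of n] by (simp add: dist_norm abs_le_iff)
    finally show ?thesis .
  qed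
  have "holomorphic_fun f (ball 0 r)"
  proof (rule holomorphic_uniform_limit)
    show "holomorphic_fun (\<lambda>z. \<Sum>k\<in>F n. t k z) (ball 0 r)" for n
      unfolding holomorphic_fun_iff t_def
      by (intro ballI complex_diff_sum complex_diff_mult complex_diff_prod complex_diff_power
            complex_diff_const complex_diff_coord)
    show "uniform_limit (ball 0 r) (\<lambda>n z. \<Sum>k\<in>F n. t k z) f sequentially"
    proof (rule uniform_limitI)
      fix e :: real assume "e > 0"
      then have "\<forall>\<^sub>F n in sequentially. 1 / real (Suc n) < e"
        using LIMSEQ_inverse_real_of_nat by (auto simp: inverse_eq_divide dest: order_tendstoD(2))
      then show "\<forall>\<^sub>F n in sequentially. \<forall>z\<in>ball 0 r. dist (\<Sum>k\<in>F n. t k z) (f z) < e"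
        by eventually_elim (auto simp: dist_norm norm_minus_commute intro: le_less_trans[OF near])
    qed
  qed simp
  with r(1) show ?thesis by blast
qed

theorem convergent_series_iff:
  "f \<in> convergent_series \<longleftrightarrow> (\<exists>r>0. holomorphic_fun f (ball 0 r))"
  using holomorphic_imp_convergent_series convergent_series_imp_holomorphic by metis

lemma ball_holomorphic_local:
  "(\<exists>r>0. holomorphic_fun f (ball z r)) \<longleftrightarrow> (\<forall>\<^sub>F w in nhds z. complex_diff f w)"
  unfolding eventually_nhds_metric holomorphic_fun_iff by (auto simp: dist_commute)

text \<open>Membership in the ring of series becomes a property of the neighbourhood filter of 0,
  the form used for all germs below.\<close>

lemma convergent_series_ev: "f \<in> convergent_series \<longleftrightarrow> (\<forall>\<^sub>F w in nhds 0. complex_diff f w)"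
  by (simp add: convergent_series_iff ball_holomorphic_local)

section \<open>Biholomorphic maps\<close>

text \<open>The complex Jacobian. It agrees with \<open>frechet_derivative\<close> on holomorphic
  maps, but is complex linear by definition, so linearity needs no differentiability.\<close>

definition vder :: "(complex^'n \<Rightarrow> complex^'m) \<Rightarrow> complex^'n \<Rightarrow> complex^'n \<Rightarrow> complex^'m" where
  "vder f z h = (\<chi> k. dirder (\<lambda>w. f w $ k) z h)"

lemma vder_nth [simp]: "vder f z h $ k = dirder (\<lambda>w. f w $ k) z h"
  by (simp add: vder_def)

lemma vder_scale: "vder f z (c *s h) = c *s vder f z h"
  by (simp add: vec_eq_iff dirder_scale)

lemma vder_add: "vder f z (h + k) = vder f z h + vder f z k"
  by (simp add: vec_eq_iff dirder_add)

lemma vder_diff: "vder f z (h - k) = vder f z h - vder f z k"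
  using vder_add[of f z "h - k" k] by simp

lemma has_derivative_vder:
  "(\<And>k. complex_diff (\<lambda>w. f w $ k) z) \<Longrightarrow> (f has_derivative vder f z) (at z)"
  by (rule has_derivative_vec_componentwise) (simp add: complex_diffD)

lemma holomorphic_map_diff: "holomorphic_map f S \<Longrightarrow> z \<in> S \<Longrightarrow> complex_diff (\<lambda>w. f w $ k) z"
  by (simp add: holomorphic_map_def holomorphic_fun_iff)

lemma frechet_derivative_eq_vder:
  "holomorphic_map f S \<Longrightarrow> z \<in> S \<Longrightarrow> frechet_derivative f (at z) = vder f z"
  by (metis frechet_derivative_at has_derivative_vder holomorphic_map_diff)

lemma vder_compose:
  assumes "\<And>k. complex_diff (\<lambda>w. g w $ k) (f z)" "\<And>k. complex_diff (\<lambda>w. f w $ k) z"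
  shows "vder (\<lambda>w. g (f w)) z h = vder g (f z) (vder f z h)"
  using dirder_compose[OF assms(1) assms(2)] by (simp add: vec_eq_iff vder_def[of f])

lemma vder_cong_ev:
  assumes "\<forall>\<^sub>F w in nhds z. f w = g w"
  shows "vder f z = vder g z"
proof -
  have "\<forall>\<^sub>F w in nhds z. f w $ k = g w $ k" for k using assms by (rule eventually_mono) simp
  then have "pd i (\<lambda>w. f w $ k) z = pd i (\<lambda>w. g w $ k) z" for i k by (rule pd_cong_ev)
  then show ?thesis by (simp add: fun_eq_iff vec_eq_iff dirder_def)
qed

lemma vder_id: "vder (\<lambda>w. w) z h = h"
  by (simp add: vec_eq_iff dirder_def pd_coord if_distrib[of "\<lambda>x. _ * x"] cong: if_cong)

lemma holomorphic_map_compose: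
  assumes f: "holomorphic_map f S" and g: "holomorphic_map g T" and "f ` S \<subseteq> T"
  shows "holomorphic_map (\<lambda>w. g (f w)) S"
  unfolding holomorphic_map_def holomorphic_fun_iff
  using assms(3) by (intro allI ballI complex_diff_compose[OF holomorphic_map_diff[OF g] holomorphic_map_diff[OF f]]) auto

lemma holomorphic_map_subset: "holomorphic_map f S \<Longrightarrow> T \<subseteq> S \<Longrightarrow> holomorphic_map f T"
  by (auto simp: holomorphic_map_def intro: holomorphic_fun_subset)

lemma holomorphic_fun_cong:
  assumes "open S" "\<And>z. z \<in> S \<Longrightarrow> f z = g z" "holomorphic_fun g S"
  shows "holomorphic_fun f S"
  unfolding holomorphic_fun_iff
proof
  fix z assume z: "z \<in> S"
  have "\<forall>\<^sub>F w in nhds z. f w = g w"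
    using eventually_nhds_in_open[OF assms(1) z] by (rule eventually_mono) (rule assms(2))
  from complex_diff_cong_ev[OF this] show "complex_diff f z"
    using assms(3) z by (simp add: holomorphic_fun_iff)
qed

lemma holomorphic_map_cong:
  assumes "open S" "\<And>z. z \<in> S \<Longrightarrow> f z = g z" "holomorphic_map g S"
  shows "holomorphic_map f S"
  unfolding holomorphic_map_def
  using assms by (auto simp: holomorphic_map_def intro: holomorphic_fun_cong[OF assms(1)])

lemma open_vimage_Int:
  assumes "open A" "continuous_on A f" "open B"
  shows "open {w \<in> A. f w \<in> B}"
  using continuous_open_preimage[OF assms(2,1,3)] by (simp add: vimage_def Int_def conj_commute)

text \<open>Two local maps that invert each other wherever they compose: the part of
  \<open>A\<close> sent into \<open>B\<close> has as image the part of \<open>B\<close> sent into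
  \<open>A\<close> by \<beta>, and both are open by continuity.\<close>

lemma biholomorphicI:
  assumes A: "open A" "holomorphic_map \<alpha> A" and B: "open B" "holomorphic_map \<beta> B"
    and \<beta>\<alpha>: "\<And>w. w \<in> A \<Longrightarrow> \<alpha> w \<in> B \<Longrightarrow> \<beta> (\<alpha> w) = w" and \<alpha>\<beta>: "\<And>w. w \<in> B \<Longrightarrow> \<beta> w \<in> A \<Longrightarrow> \<alpha> (\<beta> w) = w"
  shows "biholomorphic \<alpha> {w \<in> A. \<alpha> w \<in> B}"
proof -
  let ?S = "{w \<in> A. \<alpha> w \<in> B}"
  have im: "\<alpha> ` ?S = {w \<in> B. \<beta> w \<in> A}"
    using \<beta>\<alpha> \<alpha>\<beta> by (auto simp: image_iff) (metis \<alpha>\<beta>)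
  have inj: "inj_on \<alpha> ?S" using \<beta>\<alpha> by (metis (mono_tags, lifting) inj_onI mem_Collect_eq)
  have inv: "inv_into ?S \<alpha> w = \<beta> w" if "w \<in> B" "\<beta> w \<in> A" for w
    using inv_into_f_f[OF inj, of "\<beta> w"] that \<alpha>\<beta>[OF that] by simp
  have o2: "open {w \<in> B. \<beta> w \<in> A}"
    using open_vimage_Int[OF B(1) holomorphic_map_continuous_on[OF B(2)] A(1)] .
  have "holomorphic_map (inv_into ?S \<alpha>) {w \<in> B. \<beta> w \<in> A}"
    by (rule holomorphic_map_cong[OF o2 _ holomorphic_map_subset[OF B(2)]]) (auto simp: inv)
  then show ?thesis
    unfolding biholomorphic_def im
    using open_vimage_Int[OF A(1) holomorphic_map_continuous_on[OF A(2)] B(1)] o2 inj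
      holomorphic_map_subset[OF A(2), of ?S] by blast
qed

lemma biholomorphicD:
  assumes "biholomorphic \<phi> S"
  shows "open S" "open (\<phi> ` S)" "holomorphic_map \<phi> S" "holomorphic_map (inv_into S \<phi>) (\<phi> ` S)" "inj_on \<phi> S"
    "z \<in> S \<Longrightarrow> inv_into S \<phi> (\<phi> z) = z"
  using assms by (auto simp: biholomorphic_def)

lemma biholomorphic_subset:
  assumes "biholomorphic \<phi> S" "open T" "T \<subseteq> S"
  shows "biholomorphic \<phi> T"
proof -
  note \<phi> = biholomorphicD[OF assms(1)]
  have "biholomorphic \<phi> {w \<in> T. \<phi> w \<in> \<phi> ` S}"
    by (rule biholomorphicI[OF assms(2) holomorphic_map_subset[OF \<phi>(3) assms(3)] \<phi>(2,4)])
       (use assms(3) \<phi>(6) in \<open>auto simp: f_inv_into_f\<close>)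
  moreover have "{w \<in> T. \<phi> w \<in> \<phi> ` S} = T" using assms(3) by auto
  ultimately show ?thesis by simp
qed

lemma biholomorphic_inverse:
  assumes "biholomorphic \<phi> S"
  shows "biholomorphic (inv_into S \<phi>) (\<phi> ` S)"
proof -
  note \<phi> = biholomorphicD[OF assms(1)]
  have "biholomorphic (inv_into S \<phi>) {w \<in> \<phi> ` S. inv_into S \<phi> w \<in> S}"
    by (rule biholomorphicI[OF \<phi>(2,4) \<phi>(1,3)]) (use \<phi>(6) in \<open>auto simp: f_inv_into_f\<close>)
  moreover have "{w \<in> \<phi> ` S. inv_into S \<phi> w \<in> S} = \<phi> ` S" using \<phi>(6) by auto
  ultimately show ?thesis by simp
qed

lemma biholomorphic_compose:
  assumes "biholomorphic \<phi> S" "biholomorphic \<psi> T"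
  shows "biholomorphic (\<psi> \<circ> \<phi>) {z \<in> S. \<phi> z \<in> T}"
proof -
  note \<phi> = biholomorphicD[OF assms(1)] and \<psi> = biholomorphicD[OF assms(2)]
  let ?A = "{z \<in> S. \<phi> z \<in> T}" and ?B = "{w \<in> \<psi> ` T. inv_into T \<psi> w \<in> \<phi> ` S}"
  have oA: "open ?A" by (rule open_vimage_Int[OF \<phi>(1) holomorphic_map_continuous_on[OF \<phi>(3)] \<psi>(1)])
  have oB: "open ?B" by (rule open_vimage_Int[OF \<psi>(2) holomorphic_map_continuous_on[OF \<psi>(4)] \<phi>(2)])
  have "biholomorphic (\<lambda>z. \<psi> (\<phi> z)) {w \<in> ?A. \<psi> (\<phi> w) \<in> ?B}"
  proof (rule biholomorphicI[OF oA _ oB, where \<beta> = "\<lambda>w. inv_into S \<phi> (inv_into T \<psi> w)"])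
    show "holomorphic_map (\<lambda>z. \<psi> (\<phi> z)) ?A"
      by (rule holomorphic_map_compose[OF holomorphic_map_subset[OF \<phi>(3)] \<psi>(3)]) auto
    show "holomorphic_map (\<lambda>w. inv_into S \<phi> (inv_into T \<psi> w)) ?B"
      by (rule holomorphic_map_compose[OF holomorphic_map_subset[OF \<psi>(4)] \<phi>(4)]) auto
  qed (use \<phi>(6) \<psi>(6) in \<open>auto simp: f_inv_into_f\<close>)
  moreover have "{w \<in> ?A. \<psi> (\<phi> w) \<in> ?B} = ?A" using \<psi>(6) by auto
  ultimately show ?thesis by (simp add: comp_def)
qed

lemma biholomorphic_cong:
  assumes "biholomorphic \<phi> S" "\<And>z. z \<in> S \<Longrightarrow> \<psi> z = \<phi> z"
  shows "biholomorphic \<psi> S"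
proof -
  note \<phi> = biholomorphicD[OF assms(1)]
  have im: "\<psi> ` S = \<phi> ` S" using assms(2) by simp
  have "biholomorphic \<psi> {w \<in> S. \<psi> w \<in> \<phi> ` S}"
    by (rule biholomorphicI[OF \<phi>(1) holomorphic_map_cong[OF \<phi>(1) assms(2) \<phi>(3)] \<phi>(2,4)])
       (use \<phi>(6) assms(2) in \<open>auto simp: f_inv_into_f\<close>)
  moreover have "{w \<in> S. \<psi> w \<in> \<phi> ` S} = S" using im by auto
  ultimately show ?thesis by simp
qed

lemma vder_inverse:
  assumes "biholomorphic \<phi> S" "z \<in> S"
  shows "vder (inv_into S \<phi>) (\<phi> z) (vder \<phi> z h) = h" "vder \<phi> z (vder (inv_into S \<phi>) (\<phi> z) h) = h"
proof -
  note \<phi> = biholomorphicD[OF assms(1)]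
  have d: "complex_diff (\<lambda>w. \<phi> w $ k) z" "complex_diff (\<lambda>w. inv_into S \<phi> w $ k) (\<phi> z)" for k
    using \<phi> assms(2) by (auto intro: holomorphic_map_diff)
  have "\<forall>\<^sub>F w in nhds z. inv_into S \<phi> (\<phi> w) = w"
    using eventually_nhds_in_open[OF \<phi>(1) assms(2)] by (rule eventually_mono) (rule \<phi>(6))
  from vder_cong_ev[OF this] show "vder (inv_into S \<phi>) (\<phi> z) (vder \<phi> z h) = h"
    using vder_compose[OF d(2,1), of h] by (simp add: vder_id)
  have "\<forall>\<^sub>F w in nhds (\<phi> z). \<phi> (inv_into S \<phi> w) = w"
    using eventually_nhds_in_open[OF \<phi>(2) imageI[OF assms(2)]] by (rule eventually_mono) (rule f_inv_into_f)
  from vder_cong_ev[OF this] show "vder \<phi> z (vder (inv_into S \<phi>) (\<phi> z) h) = h"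
    using vder_compose[of \<phi> "inv_into S \<phi>" "\<phi> z" h] d \<phi>(6)[OF assms(2)] by (simp add: vder_id)
qed

section \<open>The holomorphic inverse function theorem\<close>

lemma linear_vder: "linear (vder f z)"
proof (rule linearI)
  fix r :: real and x
  have "r *\<^sub>R x = complex_of_real r *s x" and "r *\<^sub>R vder f z x = complex_of_real r *s vder f z x"
    by (simp_all add: vec_eq_iff scaleR_conv_of_real[where ?'a = complex])
  then show "vder f z (r *\<^sub>R x) = r *\<^sub>R vder f z x" by (simp only: vder_scale)
qed (rule vder_add)

text \<open>The real inverse function theorem supplies the inverse. Its derivative inverts a
  complex-linear map and is therefore complex linear, which is all that holomorphy asks for.\<close>

theorem holomorphic_inverse_function:
  fixes \<phi> :: "complex^'n \<Rightarrow> complex^'n"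
  assumes A: "open A" "z0 \<in> A" "holomorphic_map \<phi> A" and inj: "\<And>h. vder \<phi> z0 h = 0 \<Longrightarrow> h = 0"
  shows "\<exists>S. z0 \<in> S \<and> S \<subseteq> A \<and> biholomorphic \<phi> S"
proof -
  have bl: "bounded_linear (vder \<phi> z)" for z
    using linear_vder linear_conv_bounded_linear by blast
  have ap: "blinfun_apply (Blinfun (vder \<phi> z)) = vder \<phi> z" for z
    using bl by (rule bounded_linear_Blinfun_apply)
  have cont: "continuous_on A (\<lambda>z. Blinfun (vder \<phi> z))"
  proof (rule continuous_on_blinfun_componentwise)
    fix b :: "complex^'n"
    have "continuous_on A (\<lambda>z. dirder (\<lambda>w. \<phi> w $ k) z b)" for k
      unfolding dirder_def using A
      by (intro continuous_intros holomorphic_fun_continuous_on holomorphic_pd) (auto simp: holomorphic_map_def)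
    then show "continuous_on A (\<lambda>z. blinfun_apply (Blinfun (vder \<phi> z)) b)"
      unfolding ap vder_def by (intro continuous_on_vec_lambda)
  qed
  have "inj (vder \<phi> z0)"
    unfolding linear_injective_0[OF linear_vder] using inj by blast
  then obtain G where G: "linear G" "G \<circ> vder \<phi> z0 = id"
    using linear_injective_left_inverse[OF linear_vder] by blast
  have Gap: "blinfun_apply (Blinfun G) = G"
    using G(1) by (intro bounded_linear_Blinfun_apply) (simp add: linear_conv_bounded_linear)
  have inv: "Blinfun G o\<^sub>L Blinfun (vder \<phi> z0) = id_blinfun"
    using G(2) by (intro blinfun_eqI) (simp add: Gap ap fun_eq_iff)
  have der: "(\<phi> has_derivative blinfun_apply (Blinfun (vder \<phi> z))) (at z)" if "z \<in> A" for z
    unfolding ap using holomorphic_map_diff[OF A(3) that] by (rule has_derivative_vder)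
  show ?thesis
  proof (rule inverse_function_theorem[OF A(1) der cont A(2) inv])
    fix S V g g'
    assume S: "open S" "S \<subseteq> A" "z0 \<in> S" "open V" "\<phi> z0 \<in> V" and hom: "homeomorphism S V \<phi> g"
      and g: "\<And>y. y \<in> V \<Longrightarrow> (g has_derivative g' y) (at y)"
        "\<And>y. y \<in> V \<Longrightarrow> g' y = inv_into UNIV (blinfun_apply (Blinfun (vder \<phi> (g y))))"
        "\<And>y. y \<in> V \<Longrightarrow> bij (blinfun_apply (Blinfun (vder \<phi> (g y))))"
    note g = g[unfolded ap]
    have gl: "g' y (c *s v) = c *s g' y v" if "y \<in> V" for y c v
    proof -
      have "vder \<phi> (g y) (g' y w) = w" for w
        using surj_f_inv_f[OF bij_is_surj[OF g(3)[OF that]], of w] g(2)[OF that] by simp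
      then have "vder \<phi> (g y) (g' y (c *s v)) = vder \<phi> (g y) (c *s g' y v)"
        by (simp add: vder_scale)
      then show ?thesis using bij_is_inj[OF g(3)[OF that]] by (simp add: inj_eq)
    qed
    have "holomorphic_map g V"
      unfolding holomorphic_map_def holomorphic_fun_iff
    proof (intro allI ballI)
      fix k y assume y: "y \<in> V"
      show "complex_diff (\<lambda>w. g w $ k) y"
        by (rule complex_diffI[OF has_derivative_vec_nth[OF g(1)[OF y]]]) (simp add: gl[OF y])
    qed
    then have "biholomorphic \<phi> {w \<in> S. \<phi> w \<in> V}"
      using hom by (intro biholomorphicI[OF S(1) holomorphic_map_subset[OF A(3) S(2)] S(4)])
        (auto simp: homeomorphism_def)
    moreover have "{w \<in> S. \<phi> w \<in> V} = S" using hom by (auto simp: homeomorphism_def)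
    ultimately show "\<exists>S. z0 \<in> S \<and> S \<subseteq> A \<and> biholomorphic \<phi> S" using S by auto
  qed
qed

section \<open>Maps that respect multiplication and unit field\<close>

lemma F_compatible_iff:
  "F_compatible \<phi> S m e m' e' \<longleftrightarrow> biholomorphic \<phi> S \<and>
     (\<forall>z\<in>S. vder \<phi> z (e z) = e' (\<phi> z) \<and> (\<forall>u v. vder \<phi> z (m z u v) = m' (\<phi> z) (vder \<phi> z u) (vder \<phi> z v)))"
  unfolding F_compatible_def Let_def
  by (auto simp: frechet_derivative_eq_vder dest: biholomorphicD(3))

lemma F_compatible_inverse:
  assumes "F_compatible \<phi> S m e m' e'"
  shows "F_compatible (inv_into S \<phi>) (\<phi> ` S) m' e' m e"
proof -
  have b: "biholomorphic \<phi> S" using assms by (simp add: F_compatible_iff)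
  have "vder (inv_into S \<phi>) (\<phi> z) (e' (\<phi> z)) = e z \<and>
      vder (inv_into S \<phi>) (\<phi> z) (m' (\<phi> z) u v)
        = m z (vder (inv_into S \<phi>) (\<phi> z) u) (vder (inv_into S \<phi>) (\<phi> z) v)" if z: "z \<in> S" for z u v
  proof -
    have "vder \<phi> z (m z (vder (inv_into S \<phi>) (\<phi> z) u) (vder (inv_into S \<phi>) (\<phi> z) v)) = m' (\<phi> z) u v"
      using assms z by (simp add: F_compatible_iff vder_inverse[OF b z])
    moreover have "vder \<phi> z (e z) = e' (\<phi> z)" using assms z by (simp add: F_compatible_iff)
    ultimately show ?thesis using vder_inverse(1)[OF b z] by metis
  qed
  then show ?thesis
    using biholomorphic_inverse[OF b] biholomorphicD(6)[OF b] by (auto simp: F_compatible_iff)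
qed

lemma F_compatible_compose:
  assumes "F_compatible \<phi> S m e m' e'" "F_compatible \<psi> T m' e' m'' e''"
  shows "F_compatible (\<psi> \<circ> \<phi>) {z \<in> S. \<phi> z \<in> T} m e m'' e''"
proof -
  have b: "biholomorphic \<phi> S" "biholomorphic \<psi> T" using assms by (simp_all add: F_compatible_iff)
  have "vder (\<psi> \<circ> \<phi>) z h = vder \<psi> (\<phi> z) (vder \<phi> z h)" if "z \<in> S" "\<phi> z \<in> T" for z h
    unfolding comp_def by (rule vder_compose) (use b that in \<open>auto dest: biholomorphicD(3) intro: holomorphic_map_diff\<close>)
  then show ?thesis using assms biholomorphic_compose[OF b] by (auto simp: F_compatible_iff)
qed

lemma F_compatible_cong:
  assumes "F_compatible \<phi> S m e m' e'" "\<And>z. z \<in> S \<Longrightarrow> \<psi> z = \<phi> z"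
  shows "F_compatible \<psi> S m e m' e'"
proof -
  have b: "biholomorphic \<phi> S" using assms by (simp add: F_compatible_iff)
  have "vder \<psi> z = vder \<phi> z" if "z \<in> S" for z
    by (rule vder_cong_ev, rule eventually_mono[OF eventually_nhds_in_open[OF biholomorphicD(1)[OF b] that]])
      (rule assms(2))
  then show ?thesis
    using assms biholomorphic_cong[OF b assms(2)] by (auto simp: F_compatible_iff)
qed

lemma F_compatible_id:
  assumes "open S"
  shows "F_compatible id S m e m e"
proof -
  have "holomorphic_map (\<lambda>z. z) T" for T :: "(complex^'a) set"
    by (simp add: holomorphic_map_def holomorphic_fun_iff)
  then have "biholomorphic (\<lambda>z. z) {w \<in> S. w \<in> S}"
    by (intro biholomorphicI[OF assms _ assms, where \<beta> = "\<lambda>z. z"]) auto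
  then show ?thesis by (simp add: F_compatible_iff id_def vder_id)
qed

section \<open>Rectification of a holomorphic vector field\<close>

lemma rescale_in_ball: "z \<in> ball 0 r \<Longrightarrow> 0 \<le> s \<Longrightarrow> s \<le> 1 \<Longrightarrow> rescale i (of_real s) z \<in> ball 0 r"
  using norm_rescale_le[of "of_real s" i z] by simp

lemma holomorphic_primitive_ball: "holomorphic_fun g (ball 0 r) \<Longrightarrow> holomorphic_fun (primitive i g) (ball 0 r)"
  by (rule holomorphic_primitive[OF open_ball rescale_in_ball])

text \<open>The path of integration has length at most \<open>r\<close>; this small factor is what
  makes Picard's iteration contract.\<close>

lemma norm_primitive_diff_le:
  fixes g h :: "complex^'n \<Rightarrow> complex"
  assumes g: "holomorphic_fun g (ball 0 r)" and h: "holomorphic_fun h (ball 0 r)"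
    and le: "\<And>w. w \<in> ball 0 r \<Longrightarrow> norm (g w - h w) \<le> \<eta>" and t: "t \<in> ball 0 r"
  shows "norm (primitive i g t - primitive i h t) \<le> r * \<eta>"
proof -
  note cg = rescale_continuous'[OF open_ball rescale_in_ball g t, of i] and ch = rescale_continuous'[OF open_ball rescale_in_ball h t, of i]
  have "primitive i g t - primitive i h t = t $ i * integral {0..1} (\<lambda>s. g (rescale i (of_real s) t) - h (rescale i (of_real s) t))"
    unfolding primitive_def using cg ch
    by (subst integral_diff) (auto intro!: integrable_continuous_interval simp: right_diff_distrib)
  moreover have "norm (integral {0..1} (\<lambda>s. g (rescale i (of_real s) t) - h (rescale i (of_real s) t))) \<le> \<eta> * (1 - 0)"
    by (rule integral_bound[OF _ continuous_on_diff[OF cg ch]]) (use t in \<open>auto intro!: le rescale_in_ball simp del: mem_ball_0\<close>)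
  moreover have "norm (t $ i) \<le> r"
    using Finite_Cartesian_Product.norm_nth_le[of t i] t by simp
  moreover have "0 \<le> r" using t by (metis le_less_trans less_imp_le mem_ball_0 norm_ge_zero)
  ultimately show ?thesis
    by (simp add: norm_mult mult_mono)
qed

lemma norm_dirder_le:
  fixes f :: "complex^'n \<Rightarrow> complex"
  assumes "\<And>i. norm (pd i f z) \<le> B"
  shows "norm (dirder f z h) \<le> real CARD('n) * B * norm h"
  using norm_dirder_diff_le[of "\<lambda>i. pd i f z" "\<lambda>_. 0" B h] assms by (simp add: dirder_def)

text \<open>Mean value inequality on a convex ball, with the partial derivatives bounded by
  compactness.\<close>

lemma holomorphic_Lipschitz:
  fixes f :: "complex^'n \<Rightarrow> complex"
  assumes V: "open V" and f: "holomorphic_fun f V" and sub: "cball x0 R \<subseteq> V"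
  shows "\<exists>\<Lambda>\<ge>0. \<forall>x\<in>cball x0 R. \<forall>y\<in>cball x0 R. norm (f x - f y) \<le> \<Lambda> * norm (x - y)"
proof -
  have "\<exists>B. \<forall>z\<in>cball x0 R. norm (pd i f z) \<le> B" for i
  proof -
    have "compact (pd i f ` cball x0 R)"
      by (rule compact_continuous_image[OF continuous_on_subset[OF holomorphic_fun_continuous_on[OF holomorphic_pd[OF V f]] sub]])
        (rule compact_cball)
    from compact_imp_bounded[OF this] show ?thesis by (auto simp: bounded_iff)
  qed
  then obtain B where B: "\<And>i z. z \<in> cball x0 R \<Longrightarrow> norm (pd i f z) \<le> B i" by metis
  define B' where "B' = (\<Sum>i\<in>UNIV. \<bar>B i\<bar>)"
  have B': "norm (pd i f z) \<le> B'" if "z \<in> cball x0 R" for i z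
  proof -
    have "B i \<le> \<bar>B i\<bar>" by simp
    also have "\<dots> \<le> B'" unfolding B'_def by (rule member_le_sum) auto
    finally show ?thesis using B[OF that, of i] by simp
  qed
  have B0: "0 \<le> B'" unfolding B'_def by (rule sum_nonneg) simp
  show ?thesis
  proof (intro exI[of _ "real CARD('n) * B'"] conjI ballI)
    show "0 \<le> real CARD('n) * B'" using B0 by simp
    fix x y assume "x \<in> cball x0 R" "y \<in> cball x0 R"
    then show "norm (f x - f y) \<le> real CARD('n) * B' * norm (x - y)"
    proof (rule differentiable_bound[OF convex_cball, rotated 2])
      fix z assume z: "z \<in> cball x0 R"
      have "complex_diff f z" using f sub z by (auto intro: holomorphic_fun_diff)
      then show "(f has_derivative dirder f z) (at z within cball x0 R)"
        by (rule has_derivative_at_withinI[OF complex_diffD])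
      show "onorm (dirder f z) \<le> real CARD('n) * B'"
        by (rule onorm_bound) (use B0 in \<open>auto intro!: norm_dirder_le B'[OF z]\<close>)
    qed
  qed
qed

text \<open>Picard iteration on functions of all variables at once, with t_i as time and
  \<open>q\<close> as initial value. \<open>primitive\<close> and uniform limits preserve
  holomorphy, so the solution is holomorphic in time and initial values together.\<close>

lemma Picard_holomorphic:
  fixes e q :: "complex^'n \<Rightarrow> complex^'n"
  assumes V: "open V" "x0 \<in> V" and e: "holomorphic_map e V"
    and q: "holomorphic_map q UNIV" and q_le: "\<And>t k. norm (q t $ k - x0 $ k) \<le> norm t"
  shows "\<exists>\<psi> r. r > 0 \<and> holomorphic_map \<psi> (ball 0 r) \<and> \<psi> ` ball 0 r \<subseteq> V \<and>
    (\<forall>t\<in>ball 0 r. \<forall>k. \<psi> t $ k = q t $ k + primitive i (\<lambda>w. e (\<psi> w) $ k) t)"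
proof -
  obtain R where R: "R > 0" "cball x0 R \<subseteq> V" using V open_contains_cball by blast
  have ek: "holomorphic_fun (\<lambda>x. e x $ k) V" for k using e by (simp add: holomorphic_map_def)
  have "\<exists>K. \<forall>x\<in>cball x0 R. norm (e x) \<le> K"
  proof -
    have "compact (e ` cball x0 R)"
      by (rule compact_continuous_image[OF continuous_on_subset[OF holomorphic_map_continuous_on[OF e] R(2)] compact_cball])
    from compact_imp_bounded[OF this] show ?thesis by (auto simp: bounded_iff)
  qed
  then obtain K where K: "\<And>x. x \<in> cball x0 R \<Longrightarrow> norm (e x) \<le> K" by blast
  have K0: "0 \<le> K" using order_trans[OF norm_ge_zero K[of x0]] R(1) by simp
  have "\<forall>k. \<exists>\<Lambda>\<ge>0. \<forall>x\<in>cball x0 R. \<forall>y\<in>cball x0 R. norm (e x $ k - e y $ k) \<le> \<Lambda> * norm (x - y)"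
    by (rule allI, rule holomorphic_Lipschitz[OF V(1) ek R(2)])
  then obtain \<Lambda>k where \<Lambda>k: "\<And>k. 0 \<le> \<Lambda>k k"
    "\<And>k x y. x \<in> cball x0 R \<Longrightarrow> y \<in> cball x0 R \<Longrightarrow> norm (e x $ k - e y $ k) \<le> \<Lambda>k k * norm (x - y)"
    by metis
  define \<Lambda> where "\<Lambda> = (\<Sum>k\<in>UNIV. \<Lambda>k k)"
  have \<Lambda>0: "0 \<le> \<Lambda>" unfolding \<Lambda>_def by (rule sum_nonneg) (rule \<Lambda>k)
  have \<Lambda>: "norm (e x $ k - e y $ k) \<le> \<Lambda> * norm (x - y)" if "x \<in> cball x0 R" "y \<in> cball x0 R" for x y k
  proof -
    have "\<Lambda>k k \<le> \<Lambda>" unfolding \<Lambda>_def by (rule member_le_sum) (auto simp: \<Lambda>k)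
    then have "\<Lambda>k k * norm (x - y) \<le> \<Lambda> * norm (x - y)" by (rule mult_right_mono) simp
    with \<Lambda>k(2)[OF that, of k] show ?thesis by linarith
  qed
  define N where "N = real CARD('n)"
  have N: "N > 0" by (simp add: N_def)
  \<comment> \<open>The first bound keeps the iterates in \<open>cball x0 R\<close>, the second
    makes the iteration contract by 1/2. The factor \<open>N\<close> is the price for passing from
    component bounds to the norm.\<close>
  define r where "r = min (R / (N * (1 + K))) (1 / (2 * N * (\<Lambda> + 1)))"
  have r: "r > 0" using R(1) N K0 \<Lambda>0 by (simp add: r_def)
  have rK: "N * (r + r * K) \<le> R"
  proof -
    have "r \<le> R / (N * (1 + K))" by (simp add: r_def)
    then have "r * (N * (1 + K)) \<le> R" using N K0 by (subst (asm) pos_le_divide_eq) auto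
    then show ?thesis by (simp add: algebra_simps)
  qed
  have r\<Lambda>: "N * (r * (\<Lambda> * d)) \<le> d / 2" if "0 \<le> d" for d
  proof -
    have "r \<le> 1 / (2 * N * (\<Lambda> + 1))" by (simp add: r_def)
    then have "r * (2 * N * (\<Lambda> + 1)) \<le> 1" using N \<Lambda>0 by (subst (asm) pos_le_divide_eq) auto
    moreover have "0 \<le> N * r" using N r by simp
    ultimately have "N * r * \<Lambda> \<le> 1 / 2" by (simp add: algebra_simps)
    then have "(N * r * \<Lambda>) * d \<le> (1 / 2) * d" using that by (rule mult_right_mono)
    then show ?thesis by (simp add: mult_ac)
  qed
  define \<Phi> where "\<Phi> = (\<lambda>(\<psi> :: complex^'n \<Rightarrow> complex^'n) t. \<chi> k. q t $ k + primitive i (\<lambda>w. e (\<psi> w) $ k) t)"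
  define good where "good = (\<lambda>\<psi> :: complex^'n \<Rightarrow> complex^'n. holomorphic_map \<psi> (ball 0 r) \<and> (\<forall>t\<in>ball 0 r. \<psi> t \<in> cball x0 R))"
  have hol_e: "holomorphic_fun (\<lambda>w. e (\<psi> w) $ k) (ball 0 r)" if "good \<psi>" for \<psi> k
    using holomorphic_map_compose[OF _ e, of \<psi> "ball 0 r"] that R(2)
    unfolding good_def holomorphic_map_def[of "\<lambda>w. e (\<psi> w)"] by blast
  have q_in: "norm (q t $ k - x0 $ k) \<le> r" if "t \<in> ball 0 r" for t k
    using q_le[of t k] that by simp
  have in_cball: "y \<in> cball x0 R" if "\<And>k. norm (y $ k - x0 $ k) \<le> r + r * K" for y
    using norm_le_card_mult[of "y - x0" "r + r * K"] that rK by (simp add: dist_norm norm_minus_commute N_def)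
  have hol_q: "holomorphic_fun (\<lambda>t. q t $ k) (ball 0 r)" for k
    using q by (auto simp: holomorphic_map_def intro: holomorphic_fun_subset)
  have good_q: "good q"
    unfolding good_def
  proof (intro conjI ballI)
    show "holomorphic_map q (ball 0 r)" by (rule holomorphic_map_subset[OF q]) simp
    fix t :: "complex^'n" assume t: "t \<in> ball 0 r"
    have "0 \<le> r * K" using r K0 by simp
    then show "q t \<in> cball x0 R" using q_in[OF t] by (intro in_cball) (meson add_increasing2)
  qed
  have good_\<Phi>: "good (\<Phi> \<psi>)" if "good \<psi>" for \<psi>
    unfolding good_def
  proof (intro conjI ballI)
    show "holomorphic_map (\<Phi> \<psi>) (ball 0 r)"
      unfolding holomorphic_map_def \<Phi>_def
      using hol_q holomorphic_primitive_ball[OF hol_e[OF that]]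
      by (simp add: holomorphic_fun_iff complex_diff_add)
    fix t :: "complex^'n" assume t: "t \<in> ball 0 r"
    show "\<Phi> \<psi> t \<in> cball x0 R"
    proof (rule in_cball)
      fix k
      have "norm (primitive i (\<lambda>w. e (\<psi> w) $ k) t - primitive i (\<lambda>w. 0) t) \<le> r * K"
      proof (rule norm_primitive_diff_le[OF hol_e[OF that] _ _ t])
        show "holomorphic_fun (\<lambda>w. 0) (ball 0 r)" by (simp add: holomorphic_fun_iff)
        fix w :: "complex^'n" assume "w \<in> ball 0 r"
        then have "norm (e (\<psi> w)) \<le> K" using that by (intro K) (simp add: good_def)
        then show "norm (e (\<psi> w) $ k - 0) \<le> K"
          using Finite_Cartesian_Product.norm_nth_le[of "e (\<psi> w)" k] by simp
      qed
      then have "norm (primitive i (\<lambda>w. e (\<psi> w) $ k) t) \<le> r * K" by (simp add: primitive_def)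
      then show "norm (\<Phi> \<psi> t $ k - x0 $ k) \<le> r + r * K"
        using q_in[OF t, of k] norm_triangle_ineq[of "q t $ k - x0 $ k" "primitive i (\<lambda>w. e (\<psi> w) $ k) t"]
        by (simp add: \<Phi>_def algebra_simps)
    qed
  qed
  have comp_contr: "norm (\<Phi> \<psi> t $ k - \<Phi> \<psi>' t $ k) \<le> r * (\<Lambda> * d)"
    if g: "good \<psi>" "good \<psi>'" and d: "\<And>w. w \<in> ball 0 r \<Longrightarrow> norm (\<psi> w - \<psi>' w) \<le> d" and t: "t \<in> ball 0 r"
    for \<psi> \<psi>' d t k
  proof -
    have "norm (primitive i (\<lambda>w. e (\<psi> w) $ k) t - primitive i (\<lambda>w. e (\<psi>' w) $ k) t) \<le> r * (\<Lambda> * d)"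
    proof (rule norm_primitive_diff_le[OF hol_e[OF g(1)] hol_e[OF g(2)] _ t])
      fix w :: "complex^'n" assume w: "w \<in> ball 0 r"
      have "norm (e (\<psi> w) $ k - e (\<psi>' w) $ k) \<le> \<Lambda> * norm (\<psi> w - \<psi>' w)"
        using g w by (intro \<Lambda>) (simp_all add: good_def)
      also have "\<dots> \<le> \<Lambda> * d" using d[OF w] \<Lambda>0 by (rule mult_left_mono)
      finally show "norm (e (\<psi> w) $ k - e (\<psi>' w) $ k) \<le> \<Lambda> * d" .
    qed
    then show ?thesis by (simp add: \<Phi>_def)
  qed
  define P where "P = (\<lambda>n. (\<Phi> ^^ n) q)"
  have goodP: "good (P n)" for n by (induction n) (simp_all add: P_def good_q good_\<Phi>)
  \<comment> \<open>The first two iterates both lie in \<open>cball x0 R\<close>, hence the constant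
    \<open>2 * R\<close>.\<close>
  have step: "norm (P (Suc n) t - P n t) \<le> 2 * R * (1 / 2) ^ n" if "t \<in> ball 0 r" for n t
    using that
  proof (induction n arbitrary: t)
    case 0
    have "dist x0 (P (Suc 0) t) \<le> R" "dist x0 (P 0 t) \<le> R"
      using goodP[of "Suc 0"] goodP[of 0] 0 by (simp_all add: good_def)
    then show ?case using dist_triangle3[of "P (Suc 0) t" "P 0 t" x0] by (simp add: dist_norm)
  next
    case (Suc n)
    have d0: "0 \<le> 2 * R * (1 / 2) ^ n" using R(1) by simp
    have "norm (P (Suc (Suc n)) t - P (Suc n) t) \<le> real CARD('n) * (r * (\<Lambda> * (2 * R * (1 / 2) ^ n)))"
    proof (rule norm_le_card_mult)
      fix k
      show "norm ((P (Suc (Suc n)) t - P (Suc n) t) $ k) \<le> r * (\<Lambda> * (2 * R * (1 / 2) ^ n))"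
        using comp_contr[OF goodP[of "Suc n"] goodP[of n] Suc.IH Suc.prems, of k] by (simp add: P_def)
    qed
    also have "\<dots> \<le> 2 * R * (1 / 2) ^ n / 2" using r\<Lambda>[OF d0] by (simp add: N_def)
    finally show ?case by simp
  qed
  have "summable (\<lambda>n. 2 * R * (1 / 2) ^ n)" by (intro summable_mult summable_geometric) simp
  from Weierstrass_m_test[of "ball 0 r" "\<lambda>n t. P (Suc n) t - P n t", OF step this]
  have "uniform_limit (ball 0 r) (\<lambda>n t. \<Sum>j<n. P (Suc j) t - P j t) (\<lambda>t. \<Sum>j. P (Suc j) t - P j t) sequentially"
    by simp
  moreover have "(\<Sum>j<n. P (Suc j) t - P j t) = P n t - P 0 t" for n t
    using sum_lessThan_telescope[of "\<lambda>j. P j t" n] by simp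
  ultimately have ul0: "uniform_limit (ball 0 r) (\<lambda>n t. P n t - P 0 t) (\<lambda>t. \<Sum>j. P (Suc j) t - P j t) sequentially"
    by (simp only:)
  define \<psi> where "\<psi> = (\<lambda>t. P 0 t + (\<Sum>j. P (Suc j) t - P j t))"
  have ul: "uniform_limit (ball 0 r) P \<psi> sequentially"
    using ul0 unfolding uniform_limit_iff \<psi>_def by (simp add: dist_norm algebra_simps)
  have lim: "(\<lambda>n. P n t) \<longlonglongrightarrow> \<psi> t" if "t \<in> ball 0 r" for t
    using ul that by (rule tendsto_uniform_limitI)
  have good_\<psi>: "good \<psi>"
    unfolding good_def
  proof (intro conjI ballI)
    show "holomorphic_map \<psi> (ball 0 r)"
      unfolding holomorphic_map_def
    proof
      fix k
      show "holomorphic_fun (\<lambda>t. \<psi> t $ k) (ball 0 r)"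
        using goodP by (intro holomorphic_uniform_limit[OF open_ball _ bounded_linear.uniform_limit[OF bounded_linear_vec_nth ul]])
          (simp add: good_def holomorphic_map_def)
    qed
    show "\<psi> t \<in> cball x0 R" if "t \<in> ball 0 r" for t
      using closed_sequentially[OF closed_cball _ lim[OF that], of x0 R] goodP that by (simp add: good_def)
  qed
  have fix_pt: "\<psi> t $ k = \<Phi> \<psi> t $ k" if t: "t \<in> ball 0 r" for t k
  proof (rule LIMSEQ_unique)
    show "(\<lambda>n. P (Suc n) t $ k) \<longlonglongrightarrow> \<psi> t $ k"
      using tendsto_vec_nth[OF lim[OF t], of k] by (rule LIMSEQ_Suc)
    show "(\<lambda>n. P (Suc n) t $ k) \<longlonglongrightarrow> \<Phi> \<psi> t $ k"
    proof (rule tendstoI)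
      fix \<epsilon> :: real assume \<epsilon>: "\<epsilon> > 0"
      \<comment> \<open>The \<open>+ 1\<close> covers the case \<Lambda> = 0.\<close>
      define d where "d = \<epsilon> / (r * \<Lambda> + 1)"
      have d: "d > 0" "r * (\<Lambda> * d) < \<epsilon>"
      proof -
        have p: "0 < r * \<Lambda> + 1" using r \<Lambda>0 by (simp add: add_nonneg_pos)
        then show "d > 0" using \<epsilon> by (simp add: d_def)
        have "(r * \<Lambda> + 1) * d = \<epsilon>" using p by (simp add: d_def)
        then show "r * (\<Lambda> * d) < \<epsilon>" using \<open>d > 0\<close> by (simp add: algebra_simps)
      qed
      have "\<forall>\<^sub>F n in sequentially. \<forall>w\<in>ball 0 r. dist (P n w) (\<psi> w) < d"
        using ul d(1) by (simp add: uniform_limit_iff)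
      then show "\<forall>\<^sub>F n in sequentially. dist (P (Suc n) t $ k) (\<Phi> \<psi> t $ k) < \<epsilon>"
      proof eventually_elim
        case (elim n)
        have "norm (\<Phi> (P n) t $ k - \<Phi> \<psi> t $ k) \<le> r * (\<Lambda> * d)"
          by (rule comp_contr[OF goodP good_\<psi> _ t]) (use elim in \<open>auto simp: dist_norm less_imp_le\<close>)
        then show ?case using d(2) by (simp add: P_def dist_norm)
      qed
    qed
  qed
  show ?thesis
    using good_\<psi> fix_pt r R(2)
    by (intro exI[of _ \<psi>] exI[of _ r]) (auto simp: good_def \<Phi>_def simp del: mem_ball_0 mem_cball)
qed

text \<open>The flow of \<open>e\<close> with time t_i, started on the hyperplane through
  \<open>x0\<close> where the \<open>p\<close>-th coordinate is constant. It is transversal to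
  \<open>e\<close> because the \<open>p\<close>-th component of \<open>e x0\<close> is not
  0.\<close>

lemma flow_box:
  fixes e :: "complex^'n \<Rightarrow> complex^'n" and i :: 'n
  assumes V: "open V" "x0 \<in> V" and e: "holomorphic_map e V" and nz: "e x0 \<noteq> 0"
  shows "\<exists>\<psi> r. r > 0 \<and> holomorphic_map \<psi> (ball 0 r) \<and> \<psi> ` ball 0 r \<subseteq> V \<and> \<psi> 0 = x0 \<and>
    (\<forall>t\<in>ball 0 r. vder \<psi> t (axis i 1) = e (\<psi> t)) \<and> (\<forall>h. vder \<psi> 0 h = 0 \<longrightarrow> h = 0)"
proof -
  obtain p where p: "e x0 $ p \<noteq> 0" using nz by (auto simp: vec_eq_iff)
  \<comment> \<open>Initial values: the \<open>p\<close>-th coordinate stays that of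
    \<open>x0\<close>, and since t_i is used up as time, t_p takes the free place of the
    \<open>i\<close>-th coordinate.\<close>
  define q where "q = (\<lambda>t::complex^'n. \<chi> k. x0 $ k + (if k = p then 0 else if k = i then t $ p else t $ k))"
  have qd: "complex_diff (\<lambda>t. q t $ k) t" for t k
    by (cases "k = p"; cases "k = i") (simp_all add: q_def complex_diff_add)
  have qp: "pd j (\<lambda>t. q t $ k) t = (if k = p then 0 else if k = i then (if j = p then 1 else 0) else if j = k then 1 else 0)" for j t k
    by (cases "k = p"; cases "k = i") (simp_all add: q_def pd_add pd_coord)
  have "norm (q t $ k - x0 $ k) \<le> norm t" for t k
    by (simp add: q_def Finite_Cartesian_Product.norm_nth_le)
  moreover have "holomorphic_map q UNIV" using qd by (simp add: holomorphic_map_def holomorphic_fun_iff)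
  ultimately have "\<exists>\<psi> r. r > 0 \<and> holomorphic_map \<psi> (ball 0 r) \<and> \<psi> ` ball 0 r \<subseteq> V \<and>
    (\<forall>t\<in>ball 0 r. \<forall>k. \<psi> t $ k = q t $ k + primitive i (\<lambda>w. e (\<psi> w) $ k) t)"
    by (intro Picard_holomorphic[OF V e])
  then obtain \<psi> r where r: "r > 0" and hol: "holomorphic_map \<psi> (ball 0 r)" and im: "\<psi> ` ball 0 r \<subseteq> V"
    and eq: "\<And>t k. t \<in> ball 0 r \<Longrightarrow> \<psi> t $ k = q t $ k + primitive i (\<lambda>w. e (\<psi> w) $ k) t"
    by blast
  have hk: "holomorphic_fun (\<lambda>w. e (\<psi> w) $ k) (ball 0 r)" for k
    using holomorphic_map_compose[OF hol e im] by (simp add: holomorphic_map_def)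
  have \<psi>pd: "pd j (\<lambda>w. \<psi> w $ k) t = pd j (\<lambda>w. q w $ k) t + pd j (primitive i (\<lambda>w. e (\<psi> w) $ k)) t"
    if t: "t \<in> ball 0 r" for t j k
  proof -
    have "\<forall>\<^sub>F w in nhds t. \<psi> w $ k = q w $ k + primitive i (\<lambda>w. e (\<psi> w) $ k) w"
      using eventually_nhds_in_open[OF open_ball t] by (rule eventually_mono) (rule eq)
    from pd_cong_ev[OF this] show ?thesis
      using pd_add[OF qd holomorphic_fun_diff[OF holomorphic_primitive_ball[OF hk] t]] by simp
  qed
  have 0: "(0 :: complex^'n) \<in> ball 0 r" using r by simp
  have \<psi>0: "\<psi> 0 = x0"
    using eq[OF 0] by (simp add: vec_eq_iff q_def primitive_def)
  have flow: "vder \<psi> t (axis i 1) = e (\<psi> t)" if "t \<in> ball 0 r" for t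
    using \<psi>pd[OF that] qp[of i] pd_primitive[OF open_ball rescale_in_ball hk that] by (auto simp: vec_eq_iff)
  \<comment> \<open>\<open>primitive i g\<close> has the factor t_i, so it vanishes along the other
    axes through 0.\<close>
  have pd0: "pd j (primitive i g) 0 = 0" if "j \<noteq> i" for j and g :: "complex^'n \<Rightarrow> complex"
    using that by (simp add: pd_def primitive_def axis_def)
  have "h = 0" if h: "vder \<psi> 0 h = 0" for h
  proof -
    have "dirder (\<lambda>w. \<psi> w $ k) 0 h = h $ i * e x0 $ k + (\<Sum>j\<in>UNIV. if j = i then 0 else h $ j * pd j (\<lambda>w. q w $ k) 0)" for k
    proof -
      have "h $ j * pd j (\<lambda>w. \<psi> w $ k) 0 = (if j = i then h $ i * e x0 $ k else 0)
          + (if j = i then 0 else h $ j * pd j (\<lambda>w. q w $ k) 0)" for j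
        using flow[OF 0] \<psi>0 \<psi>pd[OF 0, of j k] pd0[of j] by (auto simp: vec_eq_iff)
      then show ?thesis by (simp add: dirder_def sum.distrib)
    qed
    then have hk: "h $ i * e x0 $ k + (\<Sum>j\<in>UNIV. if j = i then 0 else h $ j * pd j (\<lambda>w. q w $ k) 0) = 0" for k
      using h by (metis vder_nth zero_index)
    \<comment> \<open>The initial values do not move in direction \<open>p\<close>, so the
      \<open>p\<close>-th equation contains only the multiple of \<open>e x0 $ p\<close>.\<close>
    have hi: "h $ i = 0" using hk[of p] p by (simp add: qp cong: if_cong)
    have "(\<Sum>j\<in>UNIV. if j = i then 0 else h $ j * pd j (\<lambda>w. q w $ k) 0)
        = (if k = p then 0 else if k = i then h $ p else h $ k)" for k
      using hi by (cases "k = p"; cases "k = i")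
        (auto simp: qp if_distrib[of "\<lambda>x. _ * x"] sum.If_cases intro!: sum.neutral cong: if_cong)
    then have "(if k = p then 0 else if k = i then h $ p else h $ k) = 0" for k
      using hk[of k] hi by simp
    note c = this
    have "h $ k = 0" for k
      using c[of k] c[of i] hi by (cases "k = p"; cases "k = i"; cases "i = p") auto
    then show ?thesis by (simp add: vec_eq_iff)
  qed
  then show ?thesis using r hol im \<psi>0 flow by blast
qed

section \<open>Multiplications determined by a one-form\<close>

text \<open>Covectors are encoded by their coefficients. Unlike an inner product, this pairing is
  complex linear in both arguments.\<close>

definition pair :: "complex^'n \<Rightarrow> complex^'n \<Rightarrow> complex" where
  "pair a u = (\<Sum>j\<in>UNIV. a $ j * u $ j)"

lemma pair_simps:
  "pair (a + b) u = pair a u + pair b u" "pair a (u + v) = pair a u + pair a v"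
  "pair (a - b) u = pair a u - pair b u" "pair a (u - v) = pair a u - pair a v"
  "pair (c *s a) u = c * pair a u" "pair a (c *s u) = c * pair a u"
  "pair 0 u = 0" "pair a 0 = 0"
  by (simp_all add: pair_def sum.distrib sum_subtractf sum_distrib_left algebra_simps)

lemma pair_axis: "pair a (axis i 1) = a $ i"
  by (simp add: pair_def axis_def if_distrib[of "\<lambda>x. _ * x"] cong: if_cong)

lemma
  assumes "\<And>k. complex_diff (\<lambda>w. l w $ k) t" "\<And>k. complex_diff (\<lambda>w. A w $ k) t"
  shows complex_diff_pair: "complex_diff (\<lambda>w. pair (l w) (A w)) t"
    and dirder_pair: "dirder (\<lambda>w. pair (l w) (A w)) t h = pair (vder l t h) (A t) + pair (l t) (vder A t h)"
proof -
  have d: "complex_diff (\<lambda>w. l w $ k * A w $ k) t" for k by (rule complex_diff_mult[OF assms])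
  show "complex_diff (\<lambda>w. pair (l w) (A w)) t"
    unfolding pair_def by (rule complex_diff_sum) (rule d)
  have "dirder (\<lambda>w. \<Sum>k\<in>K. l w $ k * A w $ k) t h = (\<Sum>k\<in>K. dirder (\<lambda>w. l w $ k * A w $ k) t h)" for K
    by (simp add: dirder_def pd_sum[OF d] sum_distrib_left sum.swap[of _ K])
  then show "dirder (\<lambda>w. pair (l w) (A w)) t h = pair (vder l t h) (A t) + pair (l t) (vder A t h)"
    by (simp add: pair_def dirder_fmult[OF assms] sum.distrib add.commute)
qed

lemma lie_bracket_vder: "lie_bracket X Y t = vder Y t (X t) - vder X t (Y t)"
  by (simp add: lie_bracket_def vec_eq_iff dirder_def sum_subtractf)

definition nilmult :: "complex^'n \<Rightarrow> complex^'n \<Rightarrow> complex^'n \<Rightarrow> complex^'n \<Rightarrow> complex^'n" where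
  "nilmult l e u v = pair l u *s v + pair l v *s u - (pair l u * pair l v) *s e"

text \<open>The last two terms multiply derivatives of \<open>A\<close> and \<open>B\<close>; in a
  Lie derivative they cancel against the brackets, which leaves only derivatives of
  \<open>l\<close>, of \<open>e\<close> and of the field differentiated along.\<close>

lemma
  fixes X A B :: "complex^'n \<Rightarrow> complex^'n"
  assumes l: "\<And>k. complex_diff (\<lambda>w. l w $ k) t" and e: "\<And>k. complex_diff (\<lambda>w. e w $ k) t"
    and A: "\<And>k. complex_diff (\<lambda>w. A w $ k) t" and B: "\<And>k. complex_diff (\<lambda>w. B w $ k) t"
  shows complex_diff_nilmult: "complex_diff (\<lambda>w. nilmult (l w) (e w) (A w) (B w) $ k) t"
    and vder_nilmult: "vder (\<lambda>w. nilmult (l w) (e w) (A w) (B w)) t h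
      = pair (vder l t h) (A t) *s B t + pair (vder l t h) (B t) *s A t
        - (pair (vder l t h) (A t) * pair (l t) (B t) + pair (l t) (A t) * pair (vder l t h) (B t)) *s e t
        - (pair (l t) (A t) * pair (l t) (B t)) *s vder e t h
        + nilmult (l t) (e t) (vder A t h) (B t) + nilmult (l t) (e t) (A t) (vder B t h)"
proof -
  let ?a = "\<lambda>w. pair (l w) (A w)" and ?b = "\<lambda>w. pair (l w) (B w)"
  have a: "complex_diff ?a t" and b: "complex_diff ?b t" by (intro complex_diff_pair l A B)+
  \<comment> \<open>Writing the difference with a factor \<open>- 1\<close> leaves only sums and
    products to differentiate.\<close>
  have eq: "(\<lambda>w. nilmult (l w) (e w) (A w) (B w) $ k)
      = (\<lambda>w. (?a w * B w $ k + ?b w * A w $ k) + (- 1 * (?a w * ?b w)) * e w $ k)" for k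
    by (simp add: nilmult_def fun_eq_iff)
  note d = complex_diff_mult[OF a B] complex_diff_mult[OF b A] complex_diff_mult[OF a b]
  note d' = complex_diff_mult[OF complex_diff_const[of "-1"] d(3)]
  show "complex_diff (\<lambda>w. nilmult (l w) (e w) (A w) (B w) $ k) t"
    unfolding eq by (intro complex_diff_add d complex_diff_mult[OF d' e])
  have "dirder (\<lambda>w. (?a w * B w $ k + ?b w * A w $ k) + (- 1 * (?a w * ?b w)) * e w $ k) t h
     = (?a t * dirder (\<lambda>w. B w $ k) t h + dirder ?a t h * B t $ k)
       + (?b t * dirder (\<lambda>w. A w $ k) t h + dirder ?b t h * A t $ k)
       + ((- 1 * (?a t * ?b t)) * dirder (\<lambda>w. e w $ k) t h
       + (- 1 * (?a t * dirder ?b t h + dirder ?a t h * ?b t)) * e t $ k)" for k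
  proof -
    have "dirder (\<lambda>w. - 1 :: complex) t h = 0" by (simp add: dirder_def)
    then show ?thesis
      by (simp only: dirder_fadd[OF complex_diff_add[OF d(1,2)] complex_diff_mult[OF d' e]]
          dirder_fadd[OF d(1,2)] dirder_fmult[OF d' e] dirder_fmult[OF complex_diff_const[of "-1"] d(3)]
          dirder_fmult[OF a b] dirder_fmult[OF a B] dirder_fmult[OF b A] mult_zero_left add_0_right)
  qed
  note dk = this
  show "vder (\<lambda>w. nilmult (l w) (e w) (A w) (B w)) t h
      = pair (vder l t h) (A t) *s B t + pair (vder l t h) (B t) *s A t
        - (pair (vder l t h) (A t) * pair (l t) (B t) + pair (l t) (A t) * pair (vder l t h) (B t)) *s e t
        - (pair (l t) (A t) * pair (l t) (B t)) *s vder e t h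
        + nilmult (l t) (e t) (vder A t h) (B t) + nilmult (l t) (e t) (A t) (vder B t h)"
    unfolding vec_eq_iff
  proof
    fix k
    show "vder (\<lambda>w. nilmult (l w) (e w) (A w) (B w)) t h $ k
      = (pair (vder l t h) (A t) *s B t + pair (vder l t h) (B t) *s A t
        - (pair (vder l t h) (A t) * pair (l t) (B t) + pair (l t) (A t) * pair (vder l t h) (B t)) *s e t
        - (pair (l t) (A t) * pair (l t) (B t)) *s vder e t h
        + nilmult (l t) (e t) (vder A t h) (B t) + nilmult (l t) (e t) (A t) (vder B t h)) $ k"
      unfolding vder_nth eq dk dirder_pair[OF l A] dirder_pair[OF l B]
      by (simp add: nilmult_def algebra_simps)
  qed
qed

text \<open>The value of the Lie derivative of the one-form \<open>l\<close> along \<open>X\<close> on \<open>u\<close>.\<close>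

definition lie_form :: "(complex^'n \<Rightarrow> complex^'n) \<Rightarrow> (complex^'n \<Rightarrow> complex^'n) \<Rightarrow> complex^'n \<Rightarrow> complex^'n \<Rightarrow> complex" where
  "lie_form X l t u = pair (vder l t (X t)) u + pair (l t) (vder X t u)"

lemma lie_form_linear:
  "lie_form X l t (u + v) = lie_form X l t u + lie_form X l t v"
  "lie_form X l t (c *s u) = c * lie_form X l t u"
  by (simp_all add: lie_form_def pair_simps vder_add vder_scale algebra_simps)

text \<open>The Lie derivative is a derivation, applied here to l(u) v + l(v) u - l(u) l(v) e: each
  occurrence of \<open>l\<close> and \<open>e\<close> is differentiated once. Only the values of
  \<open>A\<close> and \<open>B\<close> at \<open>t\<close> remain, so constant fields suffice as
  tests later.\<close>

lemma lie_mult_nilmult: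
  fixes X A B :: "complex^'n \<Rightarrow> complex^'n"
  assumes m: "\<forall>\<^sub>F w in nhds t. m w = nilmult (l w) (e w)"
    and l: "\<And>k. complex_diff (\<lambda>w. l w $ k) t" and e: "\<And>k. complex_diff (\<lambda>w. e w $ k) t"
    and A: "\<And>k. complex_diff (\<lambda>w. A w $ k) t" and B: "\<And>k. complex_diff (\<lambda>w. B w $ k) t"
  shows "lie_mult m X A B t =
      lie_form X l t (A t) *s B t + lie_form X l t (B t) *s A t
      - (lie_form X l t (A t) * pair (l t) (B t) + pair (l t) (A t) * lie_form X l t (B t)) *s e t
      - (pair (l t) (A t) * pair (l t) (B t)) *s lie_bracket X e t"
proof -
  have mt: "m t = nilmult (l t) (e t)" using m by (rule eventually_nhds_x_imp_x)
  have "\<forall>\<^sub>F w in nhds t. vmult m A B w = nilmult (l w) (e w) (A w) (B w)"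
    using m by (rule eventually_mono) (simp add: vmult_def)
  from vder_cong_ev[OF this] have v: "vder (vmult m A B) t h = vder (\<lambda>w. nilmult (l w) (e w) (A w) (B w)) t h" for h
    by simp
  show ?thesis
    unfolding lie_mult_def lie_bracket_vder v vder_nilmult[OF l e A B]
    unfolding vmult_def mt lie_form_def
    by (simp add: nilmult_def pair_simps vder_add vder_diff vder_scale)
       (simp add: vec_eq_iff algebra_simps)
qed

text \<open>The Lie derivative of l along fX is f Lie_X l + l(X) df. Over the three summands of X
  \<circ> Y the differentials add up to d(l(X) l(Y)) - l(e) d(l(X) l(Y)) = 0. For the bracket, Lie_e
  l = 0 makes bracketing with e a derivation of the product; the right side is [X, e] \<circ> Y + X
  \<circ> [Y, e] written out.\<close>

lemma
  fixes X Y :: "complex^'n \<Rightarrow> complex^'n"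
  assumes m: "\<forall>\<^sub>F w in nhds t. m w = nilmult (l w) (e w)"
    and l: "\<And>k. complex_diff (\<lambda>w. l w $ k) t" and e: "\<And>k. complex_diff (\<lambda>w. e w $ k) t"
    and X: "\<And>k. complex_diff (\<lambda>w. X w $ k) t" and Y: "\<And>k. complex_diff (\<lambda>w. Y w $ k) t"
    and le: "pair (l t) (e t) = 1" and inv: "\<And>u. lie_form e l t u = 0"
  shows lie_form_vmult: "lie_form (vmult m X Y) l t u
      = pair (l t) (X t) * lie_form Y l t u + pair (l t) (Y t) * lie_form X l t u"
    and lie_bracket_vmult_unit: "lie_bracket (vmult m X Y) e t
      = pair (l t) (X t) *s lie_bracket Y e t + pair (l t) (Y t) *s lie_bracket X e t
        + pair (l t) (lie_bracket X e t) *s Y t + pair (l t) (lie_bracket Y e t) *s X t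
        - (pair (l t) (lie_bracket X e t) * pair (l t) (Y t) + pair (l t) (X t) * pair (l t) (lie_bracket Y e t)) *s e t"
proof -
  have mt: "m t = nilmult (l t) (e t)" using m by (rule eventually_nhds_x_imp_x)
  have "\<forall>\<^sub>F w in nhds t. vmult m X Y w = nilmult (l w) (e w) (X w) (Y w)"
    using m by (rule eventually_mono) (simp add: vmult_def)
  from vder_cong_ev[OF this] have v: "vder (vmult m X Y) t h = vder (\<lambda>w. nilmult (l w) (e w) (X w) (Y w)) t h" for h
    by simp
  have i: "pair (vder l t (e t)) u = - pair (l t) (vder e t u)" for u
    using inv[of u] by (simp add: lie_form_def add_eq_0_iff2)
  show "lie_form (vmult m X Y) l t u
      = pair (l t) (X t) * lie_form Y l t u + pair (l t) (Y t) * lie_form X l t u"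
    unfolding lie_form_def v vder_nilmult[OF l e X Y]
    unfolding vmult_def mt
    by (simp add: nilmult_def pair_simps vder_add vder_diff vder_scale le i algebra_simps)
  show "lie_bracket (vmult m X Y) e t
      = pair (l t) (X t) *s lie_bracket Y e t + pair (l t) (Y t) *s lie_bracket X e t
        + pair (l t) (lie_bracket X e t) *s Y t + pair (l t) (lie_bracket Y e t) *s X t
        - (pair (l t) (lie_bracket X e t) * pair (l t) (Y t) + pair (l t) (X t) * pair (l t) (lie_bracket Y e t)) *s e t"
    unfolding lie_bracket_vder v vder_nilmult[OF l e X Y]
    unfolding vmult_def mt
    by (simp add: nilmult_def pair_simps vder_add vder_diff vder_scale)
       (simp add: vec_eq_iff i algebra_simps)
qed

text \<open>The algebra laws follow from l(e) = 1. Once the two product formulas are inserted, both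
  sides of the integrability condition are polynomial in values at \<open>t\<close> and agree term
  by term.\<close>

lemma nilmult_F_structure:
  fixes l e :: "complex^'n \<Rightarrow> complex^'n"
  assumes V: "open V" and l: "holomorphic_map l V" and e: "holomorphic_map e V"
    and m: "\<And>t. t \<in> V \<Longrightarrow> m t = nilmult (l t) (e t)"
    and le: "\<And>t. t \<in> V \<Longrightarrow> pair (l t) (e t) = 1" and inv: "\<And>t u. t \<in> V \<Longrightarrow> lie_form e l t u = 0"
  shows "F_structure V m e"
  unfolding F_structure_def
proof (intro conjI allI ballI impI)
  show "open V" by fact
  show "holomorphic_map e V" by fact
  have ev: "\<forall>\<^sub>F w in nhds t. m w = nilmult (l w) (e w)" if "t \<in> V" for t
    using eventually_nhds_in_open[OF V that] by (rule eventually_mono) (rule m)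
  show "holomorphic_map (\<lambda>t. m t u v) V" for u v
  proof (rule holomorphic_map_cong[OF V])
    show "holomorphic_map (\<lambda>t. nilmult (l t) (e t) u v) V"
      unfolding holomorphic_map_def holomorphic_fun_iff
      by (intro allI ballI complex_diff_nilmult[OF holomorphic_map_diff[OF l] holomorphic_map_diff[OF e]]) simp_all
  qed (simp add: m)
  fix t assume t: "t \<in> V"
  show "m t (u + v) w = m t u w + m t v w" "m t (c *s u) v = c *s m t u v" "m t u v = m t v u"
    "m t (m t u v) w = m t u (m t v w)" "m t (e t) v = v" for u v w c
    by (simp_all add: m[OF t] nilmult_def pair_simps le[OF t]) (simp_all add: vec_eq_iff algebra_simps)
next
  fix W and X Y A B :: "complex^'n \<Rightarrow> complex^'n" and t
  assume W: "open W \<and> W \<subseteq> V \<and> holomorphic_map X W \<and> holomorphic_map Y W \<and> holomorphic_map A W \<and> holomorphic_map B W"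
    and tW: "t \<in> W"
  then have t: "t \<in> V" by auto
  have ev: "\<forall>\<^sub>F w in nhds t. m w = nilmult (l w) (e w)"
    using eventually_nhds_in_open[OF V t] by (rule eventually_mono) (rule m)
  note d = holomorphic_map_diff[OF l t] holomorphic_map_diff[OF e t]
  have dX: "complex_diff (\<lambda>w. X w $ k) t" "complex_diff (\<lambda>w. Y w $ k) t"
      "complex_diff (\<lambda>w. A w $ k) t" "complex_diff (\<lambda>w. B w $ k) t" for k
    using W tW by (auto intro: holomorphic_map_diff)
  note lm = lie_mult_nilmult[OF ev d dX(3,4)]
  show "lie_mult m (vmult m X Y) A B t
        = m t (X t) (lie_mult m Y A B t) + m t (Y t) (lie_mult m X A B t)"
    unfolding lm lie_form_vmult[OF ev d dX(1,2) le[OF t] inv[OF t]]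
      lie_bracket_vmult_unit[OF ev d dX(1,2) le[OF t] inv[OF t]] m[OF t]
    by (simp add: nilmult_def pair_simps le[OF t]) (simp add: vec_eq_iff algebra_simps)
qed

section \<open>The algebra Q1 in coordinates, and recovery of the one-form\<close>

lemma Q1_gens: "Q1_x1\<^sup>2 = [:[:0, 0, 1:]:]" "Q1_x1 * Q1_x2 = [:0, [:0, 1:]:]" "Q1_x2\<^sup>2 = [:0, 0, 1:]"
  by (simp_all add: Q1_x1_def Q1_x2_def power2_eq_square)

text \<open>The ideal consists of the polynomials without monomials of degree less than 2. In
  \<open>coeff (coeff p j) i\<close> the exponent of x_2 is \<open>j\<close> and that of x_1 is
  \<open>i\<close>; splitting off the three low coefficients leaves multiples of x_1^2, x_1 x_2 and
  x_2^2.\<close>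

lemma Q1_rel_iff_coeff:
  "Q1_rel p q \<longleftrightarrow> coeff (coeff p 0) 0 = coeff (coeff q 0) 0 \<and> coeff (coeff p 0) 1 = coeff (coeff q 0) 1
     \<and> coeff (coeff p 1) 0 = coeff (coeff q 1) 0" (is "_ \<longleftrightarrow> ?C")
proof
  assume "Q1_rel p q"
  then obtain a b c where "p - q = a * Q1_x1\<^sup>2 + b * (Q1_x1 * Q1_x2) + c * Q1_x2\<^sup>2"
    unfolding Q1_rel_def by blast
  then have "p = q + (a * Q1_x1\<^sup>2 + b * (Q1_x1 * Q1_x2) + c * Q1_x2\<^sup>2)"
    by (simp add: algebra_simps)
  then show ?C
    by (simp add: Q1_gens coeff_mult)
next
  assume C: ?C
  define d where "d = p - q"
  have d: "coeff (coeff d 0) 0 = 0" "coeff (coeff d 0) 1 = 0" "coeff (coeff d 1) 0 = 0"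
    using C by (simp_all add: d_def)
  obtain d0 d1 d2 where d012: "d = pCons d0 (pCons d1 d2)" by (metis pCons_cases)
  obtain x0 x1 r0 where r0: "d0 = pCons x0 (pCons x1 r0)" by (metis pCons_cases)
  obtain y0 r1 where r1: "d1 = pCons y0 r1" by (metis pCons_cases)
  have "x0 = 0" "x1 = 0" "y0 = 0" using d by (simp_all add: d012 r0 r1)
  then have "d = [:r0:] * Q1_x1\<^sup>2 + [:r1:] * (Q1_x1 * Q1_x2) + d2 * Q1_x2\<^sup>2"
    by (simp add: d012 r0 r1 Q1_gens)
  then show "Q1_rel p q" unfolding Q1_rel_def d_def by blast
qed

lift_definition Q1_c0 :: "Q1 \<Rightarrow> complex" is "\<lambda>p. coeff (coeff p 0) 0" by (simp add: Q1_rel_iff_coeff)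
lift_definition Q1_c1 :: "Q1 \<Rightarrow> complex" is "\<lambda>p. coeff (coeff p 0) 1" by (simp add: Q1_rel_iff_coeff)
lift_definition Q1_c2 :: "Q1 \<Rightarrow> complex" is "\<lambda>p. coeff (coeff p 1) 0" by (simp add: Q1_rel_iff_coeff)
lift_definition Q1_of :: "complex \<Rightarrow> complex \<Rightarrow> complex \<Rightarrow> Q1" is "\<lambda>x y z. [:[:x, y:], [:z:]:]" .

lemma Q1_eq_iff: "a = b \<longleftrightarrow> Q1_c0 a = Q1_c0 b \<and> Q1_c1 a = Q1_c1 b \<and> Q1_c2 a = Q1_c2 b"
  by transfer (simp add: Q1_rel_iff_coeff)

lemma Q1_coeffs [simp]:
  "Q1_c0 (Q1_of x y z) = x" "Q1_c1 (Q1_of x y z) = y" "Q1_c2 (Q1_of x y z) = z"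
  "Q1_c0 (Q1_const x) = x" "Q1_c1 (Q1_const x) = 0" "Q1_c2 (Q1_const x) = 0"
  "Q1_c0 1 = 1" "Q1_c1 1 = 0" "Q1_c2 1 = 0"
  "Q1_c0 (a + b) = Q1_c0 a + Q1_c0 b" "Q1_c1 (a + b) = Q1_c1 a + Q1_c1 b" "Q1_c2 (a + b) = Q1_c2 a + Q1_c2 b"
  "Q1_c0 (a - b) = Q1_c0 a - Q1_c0 b" "Q1_c1 (a - b) = Q1_c1 a - Q1_c1 b" "Q1_c2 (a - b) = Q1_c2 a - Q1_c2 b"
  "Q1_c0 (a * b) = Q1_c0 a * Q1_c0 b" "Q1_c1 (a * b) = Q1_c0 a * Q1_c1 b + Q1_c1 a * Q1_c0 b"
  "Q1_c2 (a * b) = Q1_c0 a * Q1_c2 b + Q1_c2 a * Q1_c0 b"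
  by (transfer, simp add: coeff_mult one_pCons)+

text \<open>The form is the constant term \<kappa> carried over from \<open>Q1\<close>. With n =
  \<open>CARD('n)\<close>, the trace of multiplication by the \<open>j\<close>-th axis vector is n
  l_j + l_j - l_j l(u), and l(u) = 1. The resulting formula mentions no isomorphism, which gives
  holomorphy in the base point later.\<close>

lemma algebra_iso_Q1_imp_nilmult:
  assumes "algebra_iso_Q1 \<mu> (u :: complex^'n)"
  obtains l where "\<mu> = nilmult l u" "pair l u = 1"
    "l = (\<chi> j. (\<Sum>i\<in>UNIV. \<mu> (axis j 1) (axis i 1) $ i) / of_nat CARD('n))"
proof -
  obtain \<phi> :: "Q1 \<Rightarrow> complex^'n" where \<phi>: "bij \<phi>" "\<And>a b. \<phi> (a + b) = \<phi> a + \<phi> b"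
    "\<And>c a. \<phi> (Q1_const c * a) = c *s \<phi> a" "\<And>a b. \<phi> (a * b) = \<mu> (\<phi> a) (\<phi> b)" "\<phi> 1 = u"
    using assms unfolding algebra_iso_Q1_def by blast
  define g where "g = inv_into UNIV \<phi>"
  have g: "\<phi> (g v) = v" "g (\<phi> a) = a" for v a
    using \<phi>(1) by (simp_all add: g_def bij_is_surj surj_f_inv_f bij_is_inj inv_into_f_f)
  define \<kappa> where "\<kappa> = (\<lambda>v. Q1_c0 (g v))"
  have ga: "g (v + w) = g v + g w" "g (c *s v) = Q1_const c * g v" for v w c
    using g \<phi>(2,3) by metis+
  have \<kappa>: "\<kappa> (v + w) = \<kappa> v + \<kappa> w" "\<kappa> (c *s v) = c * \<kappa> v" "\<kappa> u = 1" for v w c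
    using g(2)[of 1] \<phi>(5) by (simp_all add: \<kappa>_def ga)
  have \<phi>diff: "\<phi> (a - b) = \<phi> a - \<phi> b" for a b
    using \<phi>(2)[of "a - b" b] by simp
  have mu: "\<mu> v w = \<kappa> v *s w + \<kappa> w *s v - (\<kappa> v * \<kappa> w) *s u" for v w
  proof -
    \<comment> \<open>The maximal ideal has square zero, so two elements minus their constant terms
      multiply to 0.\<close>
    have "g v * g w = Q1_const (\<kappa> v) * g w + Q1_const (\<kappa> w) * g v - Q1_const (\<kappa> v * \<kappa> w) * 1"
      by (simp add: Q1_eq_iff \<kappa>_def algebra_simps)
    note eq = this
    have "\<mu> v w = \<phi> (g v * g w)" by (simp add: \<phi>(4) g)
    also have "\<dots> = \<kappa> v *s w + \<kappa> w *s v - (\<kappa> v * \<kappa> w) *s u"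
      unfolding eq \<phi>diff \<phi>(2,3,5) g ..
    finally show ?thesis .
  qed
  define l where "l = (\<chi> j. \<kappa> (axis j 1))"
  have l: "\<kappa> v = pair l v" for v
  proof -
    have "\<kappa> (\<Sum>j\<in>J. v $ j *s axis j 1) = (\<Sum>j\<in>J. l $ j * v $ j)" if "finite J" for J
      using that
    proof (induction J)
      case empty
      show ?case using \<kappa>(2)[of 0 0] by simp
    qed (simp add: \<kappa> l_def mult.commute)
    from this[of UNIV] show ?thesis by (simp add: basis_expansion pair_def)
  qed
  show ?thesis
  proof (rule that)
    show mu': "\<mu> = nilmult l u" by (intro ext) (simp add: mu nilmult_def l)
    show "pair l u = 1" using \<kappa>(3) by (simp add: l)
    have "(\<Sum>i\<in>UNIV. \<mu> (axis j 1) (axis i 1) $ i) = of_nat CARD('n) * l $ j" for j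
    proof -
      have "(\<Sum>i\<in>UNIV. \<mu> (axis j 1) (axis i 1) $ i)
          = (\<Sum>i\<in>UNIV. l $ j + l $ i * axis j 1 $ i - l $ j * (l $ i * u $ i))"
        by (simp add: mu' nilmult_def pair_axis mult.assoc)
      also have "\<dots> = of_nat CARD('n) * l $ j + pair l (axis j 1) - l $ j * pair l u"
        by (simp add: sum.distrib sum_subtractf pair_def sum_distrib_left)
      finally show ?thesis using \<kappa>(3) by (simp add: pair_axis l)
    qed
    then show "l = (\<chi> j. (\<Sum>i\<in>UNIV. \<mu> (axis j 1) (axis i 1) $ i) / of_nat CARD('n))"
      by (simp add: vec_eq_iff)
  qed
qed

text \<open>Two different indices guarantee dimension at least 2. On a line every vector is a
  multiple of the unit, and the vanishing of Lie_e(\<circ>) would say nothing about Lie_e l.\<close>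

lemma F_structure_nilmult:
  fixes e :: "complex^'n \<Rightarrow> complex^'n"
  assumes F: "F_structure V m e" and iso: "\<And>t. t \<in> V \<Longrightarrow> algebra_iso_Q1 (m t) (e t)"
    and dim: "a \<noteq> (b :: 'n)"
  obtains l where "holomorphic_map l V" "\<And>t. t \<in> V \<Longrightarrow> m t = nilmult (l t) (e t)"
    "\<And>t. t \<in> V \<Longrightarrow> pair (l t) (e t) = 1" "\<And>t u. t \<in> V \<Longrightarrow> lie_form e l t u = 0"
proof -
  define l where "l = (\<lambda>t. (\<chi> j. (\<Sum>i\<in>UNIV. m t (axis j 1) (axis i 1) $ i) / of_nat CARD('n)))"
  have V: "open V" and e: "holomorphic_map e V" and mh: "\<And>u v. holomorphic_map (\<lambda>t. m t u v) V"
    using F by (simp_all add: F_structure_def)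
  have ml: "m t = nilmult (l t) (e t)" "pair (l t) (e t) = 1" if "t \<in> V" for t
    unfolding l_def by (rule algebra_iso_Q1_imp_nilmult[OF iso[OF that]], simp)+
  have lh: "holomorphic_map l V"
    unfolding holomorphic_map_def holomorphic_fun_iff
  proof (intro allI ballI)
    fix k t assume t: "t \<in> V"
    have "complex_diff (\<lambda>t. \<Sum>i\<in>UNIV. m t (axis k 1) (axis i 1) $ i) t"
      by (rule complex_diff_sum) (rule holomorphic_map_diff[OF mh t])
    from complex_diff_mult[OF this complex_diff_const]
    show "complex_diff (\<lambda>w. l w $ k) t" by (simp add: l_def divide_inverse)
  qed
  have inv: "lie_form e l t u = 0" if t: "t \<in> V" for t u
  proof -
    have ev: "\<forall>\<^sub>F w in nhds t. m w = nilmult (l w) (e w)"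
      using eventually_nhds_in_open[OF V t] by (rule eventually_mono) (rule ml)
    have unit: "\<forall>\<^sub>F w in nhds t. vmult m e e w = e w"
      using eventually_nhds_in_open[OF V t]
    proof (rule eventually_mono)
      fix w assume "w \<in> V" then show "vmult m e e w = e w"
        using ml[of w] by (simp add: vmult_def nilmult_def)
    qed
    have zero: "lie_form e l t x *s y + lie_form e l t y *s x
      - (lie_form e l t x * pair (l t) y + pair (l t) x * lie_form e l t y) *s e t = 0" for x y
    proof -
      let ?T = "lie_mult m e (\<lambda>_. x) (\<lambda>_. y) t"
      have c: "holomorphic_map (\<lambda>_. z) V" for z :: "complex^'n"
        by (simp add: holomorphic_map_def holomorphic_fun_iff)
      have "lie_mult m (vmult m e e) (\<lambda>_. x) (\<lambda>_. y) t = m t (e t) ?T + m t (e t) ?T"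
        using F[unfolded F_structure_def, THEN conjunct2, THEN conjunct2, THEN conjunct2, THEN conjunct2,
            rule_format, of V e e "\<lambda>_. x" "\<lambda>_. y" t] t e c V by simp
      moreover have "m t (e t) z = z" for z
        using ml[OF t] by (simp add: nilmult_def)
      \<comment> \<open>Since e \<circ> e = e near \<open>t\<close>, integrability reads
        \<open>?T = ?T + ?T\<close>.\<close>
      moreover have "lie_mult m (vmult m e e) (\<lambda>_. x) (\<lambda>_. y) t = ?T"
        unfolding lie_mult_def lie_bracket_vder vmult_def[of m "lie_bracket _ _"] vmult_def[of m _ "lie_bracket _ _"]
          vder_cong_ev[OF unit] eventually_nhds_x_imp_x[OF unit] ..
      ultimately have "?T = 0" by simp
      then show ?thesis
        by (subst (asm) lie_mult_nilmult[OF ev holomorphic_map_diff[OF lh t] holomorphic_map_diff[OF e t]])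
          (simp_all add: lie_bracket_vder)
    qed
    have span: "x = pair (l t) x *s e t" if "lie_form e l t x \<noteq> 0" for x
    proof -
      have "(2 * lie_form e l t x) *s (x - pair (l t) x *s e t) = 0"
        using zero[of x x] by (simp add: vec_eq_iff algebra_simps)
      then show ?thesis using that by (simp add: vec_eq_iff)
    qed
    show ?thesis
    proof (rule ccontr)
      assume u: "lie_form e l t u \<noteq> 0"
      \<comment> \<open>If the form vanishes on \<open>x\<close>, it does not vanish on
        \<open>u + x\<close>; either way \<open>x\<close> is a multiple of the unit.\<close>
      have all: "x = pair (l t) x *s e t" for x
      proof (cases "lie_form e l t x = 0")
        case True
        then have "u + x = pair (l t) (u + x) *s e t" using u by (intro span) (simp add: lie_form_linear)
        with span[OF u] show ?thesis by (simp add: pair_simps vec_eq_iff algebra_simps) 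
      qed (rule span)
      have "axis a 1 $ b = pair (l t) (axis a 1) * e t $ b" "axis a 1 $ a = pair (l t) (axis a 1) * e t $ a"
        "axis b 1 $ b = pair (l t) (axis b 1) * e t $ b"
        using arg_cong[OF all[of "axis a 1"], of "\<lambda>v. v $ b"] arg_cong[OF all[of "axis a 1"], of "\<lambda>v. v $ a"]
          arg_cong[OF all[of "axis b 1"], of "\<lambda>v. v $ b"] by simp_all
      then show False using dim by (auto simp: axis_def)
    qed
  qed
  show ?thesis using that[OF lh ml(1) ml(2) inv] .
qed

section \<open>The normal form\<close>

lemma one_neq_two_3: "(1::3) \<noteq> 2"
  by simp

lemma pr23_nth [simp]: "pr23 t $ 1 = t $ 2" "pr23 t $ 2 = t $ 3"
  by (simp_all add: pr23_def vector_2)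

lemma complex_diff_pr23 [simp]: "complex_diff (\<lambda>t. pr23 t $ k) t"
  using exhaust_2[of k] by auto

lemma pr23_0 [simp]: "pr23 0 = 0"
  by (simp add: vec_eq_iff forall_2)

lemma continuous_on_pr23: "continuous_on S pr23"
  by (rule holomorphic_map_continuous_on) (simp add: holomorphic_map_def holomorphic_fun_iff)

lemma
  assumes "complex_diff b (pr23 t)"
  shows complex_diff_b_pr23: "complex_diff (\<lambda>t. b (pr23 t)) t"
    and pd_b_pr23: "pd 1 (\<lambda>t. b (pr23 t)) t = 0" "pd 2 (\<lambda>t. b (pr23 t)) t = pd 1 b (pr23 t)"
      "pd 3 (\<lambda>t. b (pr23 t)) t = pd 2 b (pr23 t)"
  by (simp_all add: complex_diff_compose[of b pr23, OF assms] pd_compose[of b pr23, OF assms] sum_2 pd_coord)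

lemma eventually_pr23:
  assumes "\<forall>\<^sub>F z in nhds 0. P z"
  shows "\<forall>\<^sub>F t in nhds 0. P (pr23 t)"
proof (rule eventually_compose_filterlim[OF assms])
  have "isCont pr23 0" using continuous_on_pr23[of UNIV] by (simp add: continuous_on_eq_continuous_at)
  then show "filterlim pr23 (nhds 0) (nhds 0)"
    using tendsto_at_iff_tendsto_nhds[of pr23 0] by (simp add: isCont_def)
qed

text \<open>The covector dt_1 + b dt_3. Its kernel is spanned by \<partial>_2 and
  \<open>D3_field b\<close>, the fields whose products vanish in the normal form.\<close>

definition nf_form :: "(complex^2 \<Rightarrow> complex) \<Rightarrow> complex^3 \<Rightarrow> complex^3" where
  "nf_form b t = vector [1, 0, b (pr23 t)]"

lemma nf_form_nth [simp]: "nf_form b t $ 1 = 1" "nf_form b t $ 2 = 0" "nf_form b t $ 3 = b (pr23 t)"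
  by (simp_all add: nf_form_def)

lemma pair_3: "pair a u = a $ 1 * u $ 1 + a $ 2 * u $ 2 + a $ (3::3) * u $ 3"
  by (simp add: pair_def sum_3)

lemma pair_nf_form: "pair (nf_form b t) u = u $ 1 + b (pr23 t) * u $ 3"
  by (simp add: pair_3)

lemma axis_nth_3 [simp]:
  "axis (1::3) x $ 1 = x" "axis (1::3) x $ 2 = 0" "axis (1::3) x $ 3 = 0"
  "axis (2::3) x $ 1 = 0" "axis (2::3) x $ 2 = x" "axis (2::3) x $ 3 = 0"
  "axis (3::3) x $ 1 = 0" "axis (3::3) x $ 2 = 0" "axis (3::3) x $ 3 = x"
  by (simp_all add: axis_def)

lemma
  assumes "complex_diff b (pr23 t)"
  shows complex_diff_nf_form: "complex_diff (\<lambda>t. nf_form b t $ k) t"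
    and vder_nf_form: "vder (nf_form b) t h = axis 3 (dirder (\<lambda>t. b (pr23 t)) t h)"
proof -
  show "complex_diff (\<lambda>t. nf_form b t $ k) t"
    using exhaust_3[of k] complex_diff_b_pr23[OF assms] by auto
  show "vder (nf_form b) t h = axis 3 (dirder (\<lambda>t. b (pr23 t)) t h)"
    by (simp add: vec_eq_iff forall_3) (simp add: dirder_def)
qed

lemma vder_const: "vder (\<lambda>_. c) t h = 0"
  by (simp add: vec_eq_iff dirder_def)

lemma second_countable_euclidean: "second_countable (euclidean :: 'a::second_countable_topology topology)"
proof -
  obtain \<B> :: "'a set set" where \<B>: "countable \<B>" "topological_basis \<B>"
    using ex_countable_basis by blast
  have "\<exists>V\<in>\<B>. x \<in> V \<and> V \<subseteq> U" if "open U" "x \<in> U" for U x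
    using topological_basisE[OF \<B>(2) that] by metis
  then show ?thesis
    unfolding second_countable_def using \<B> topological_basis_open[OF \<B>(2)] by (intro exI[of _ \<B>]) simp
qed

lemma F_manifold_open_F_data_iff:
  fixes m :: "3 tmult"
  shows "F_manifold (open_F_data U m e) \<longleftrightarrow> F_structure U m e"
proof
  assume "F_manifold (open_F_data U m e)"
  then show "F_structure U m e" by (simp add: F_manifold_def open_F_data_def)
next
  assume F: "F_structure U m e"
  then have U: "open U" by (simp add: F_structure_def)
  have "F_compatible (id \<circ> inv_into U id) (id ` (U \<inter> U)) m e m e"
    by (rule F_compatible_cong[OF F_compatible_id]) (simp_all add: U inv_into_f_f[of id U, simplified])
  moreover have "second_countable (top_of_set U)"
    by (intro second_countable_subtopology) (rule second_countable_euclidean)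
  ultimately show "F_manifold (open_F_data U m e)"
    using F U by (simp add: F_manifold_def open_F_data_def Hausdorff_space_subtopology homeomorphic_map_id subtopology_subtopology)
qed

text \<open>The relations say that the kernel of the form has square zero. Every vector is its value
  under the form times \<partial>_1 plus a kernel vector, so bilinearity and the unit determine
  \<open>m t\<close>.\<close>

lemma normal_formD:
  assumes "normal_form b2 U m"
  shows "open U" "0 \<in> U" "F_structure U m (coord_field 1)" "b2 \<in> convergent_series"
    and "t \<in> U \<Longrightarrow> m t = nilmult (nf_form b2 t) (axis 1 1)"
proof -
  show F: "F_structure U m (coord_field 1)" and 0: "0 \<in> U" and "b2 \<in> convergent_series"
    using assms by (auto simp: normal_form_def F_manifold_open_F_data_iff t2_multiples_def)
  then show "open U" by (simp add: F_structure_def)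
  assume t: "t \<in> U"
  define D where "D = D3_field b2 t"
  have D: "D = axis 3 1 - b2 (pr23 t) *s axis 1 1" by (simp add: D_def D3_field_def coord_field_def)
  have rel: "m t (axis 2 1) (axis 2 1) = 0" "m t (axis 2 1) D = 0" "m t D D = 0"
    using assms t by (auto simp: normal_form_def vmult_def coord_field_def D_def)
  have bil: "m t (u + v) w = m t u w + m t v w" "m t (c *s u) v = c *s m t u v" and comm: "m t u v = m t v u"
    and unit: "m t (axis 1 1) v = v" for u v w c
    using F t unfolding F_structure_def by (auto simp: coord_field_def)
  have bil': "m t w (u + v) = m t w u + m t w v" "m t v (c *s u) = c *s m t v u" for u v w c
    using bil comm by metis+
  have dec: "u = pair (nf_form b2 t) u *s axis 1 1 + (u $ 2 *s axis 2 1 + u $ 3 *s D)" for u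
    by (simp add: vec_eq_iff forall_3 D pair_nf_form)
  show "m t = nilmult (nf_form b2 t) (axis 1 1)"
  proof (intro ext)
    fix u v
    have "m t u v = m t (pair (nf_form b2 t) u *s axis 1 1 + (u $ 2 *s axis 2 1 + u $ 3 *s D))
                (pair (nf_form b2 t) v *s axis 1 1 + (v $ 2 *s axis 2 1 + v $ 3 *s D))"
      using dec[of u] dec[of v] by simp
    also have "\<dots> = pair (nf_form b2 t) u *s (pair (nf_form b2 t) v *s axis 1 1 + (v $ 2 *s axis 2 1 + v $ 3 *s D))
        + pair (nf_form b2 t) v *s (u $ 2 *s axis 2 1 + u $ 3 *s D)"
      unfolding bil bil' unit
      by (simp add: bil bil' unit rel comm[of _ "axis 1 1"] comm[of D "axis 2 1"])
         (simp add: vec_eq_iff algebra_simps)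
    also have "\<dots> = nilmult (nf_form b2 t) (axis 1 1) u v"
      by (simp add: nilmult_def vec_eq_iff forall_3 D pair_nf_form algebra_simps)
    finally show "m t u v = nilmult (nf_form b2 t) (axis 1 1) u v" .
  qed
qed

text \<open>The isomorphism sends x_1 to \<partial>_2 and x_2 to \<partial>_3 - b \<partial>_1;
  hence the correction by \<open>Q1_c2 a\<close> in the first component.\<close>

lemma algebra_iso_Q1_nf: "algebra_iso_Q1 (nilmult (nf_form b t) (axis 1 1)) (axis 1 1)"
proof -
  define \<phi> :: "Q1 \<Rightarrow> complex^3" where
    "\<phi> = (\<lambda>a. vector [Q1_c0 a - b (pr23 t) * Q1_c2 a, Q1_c1 a, Q1_c2 a])"
  have nth: "\<phi> a $ 1 = Q1_c0 a - b (pr23 t) * Q1_c2 a" "\<phi> a $ 2 = Q1_c1 a" "\<phi> a $ 3 = Q1_c2 a" for a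
    by (simp_all add: \<phi>_def)
  have "bij \<phi>"
  proof (rule bijI)
    show "inj \<phi>" by (rule injI) (auto simp: vec_eq_iff forall_3 nth Q1_eq_iff)
    show "surj \<phi>"
    proof (rule surjI)
      show "\<phi> (Q1_of (v $ 1 + b (pr23 t) * v $ 3) (v $ 2) (v $ 3)) = v" for v
        by (simp add: vec_eq_iff forall_3 nth)
    qed
  qed
  then show ?thesis
    unfolding algebra_iso_Q1_def
    by (intro exI[of _ \<phi>])
      (simp add: vec_eq_iff forall_3 nth nilmult_def pair_nf_form algebra_simps)
qed

lemma normal_form_exists:
  assumes b: "b2 \<in> t2_multiples"
  shows "\<exists>U m. normal_form b2 U m \<and> tangent_algebras_Q1 (open_F_data U m (coord_field 1))"
proof -
  from b have "b2 \<in> convergent_series" by (simp add: t2_multiples_def)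
  then obtain r where r: "r > 0" and hol: "holomorphic_fun b2 (ball 0 r)"
    using convergent_series_iff by blast
  \<comment> \<open>A cylinder over the ball of holomorphy, since \<open>b2\<close> does not involve
    t_1; for the same reason the form is invariant under \<partial>_1.\<close>
  define U where "U = {t. pr23 t \<in> ball 0 r}"
  define m where "m = (\<lambda>t. nilmult (nf_form b2 t) (axis 1 1 :: complex^3))"
  have U: "open U"
    using open_vimage_Int[OF open_UNIV continuous_on_pr23 open_ball, of 0 r] by (simp add: U_def)
  have bd: "complex_diff b2 (pr23 t)" if "t \<in> U" for t
    using hol that unfolding U_def by (auto intro: holomorphic_fun_diff)
  have "F_structure U m (coord_field 1)"
  proof (rule nilmult_F_structure[OF U])
    show "holomorphic_map (nf_form b2) U"
      unfolding holomorphic_map_def holomorphic_fun_iff by (intro allI ballI complex_diff_nf_form bd)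
    show "holomorphic_map (coord_field 1) U"
      by (simp add: holomorphic_map_def holomorphic_fun_iff coord_field_def)
    fix t assume t: "t \<in> U"
    show "m t = nilmult (nf_form b2 t) (coord_field 1 t)" by (simp add: m_def coord_field_def)
    show "pair (nf_form b2 t) (coord_field 1 t) = 1" by (simp add: coord_field_def pair_nf_form)
    show "lie_form (coord_field 1) (nf_form b2) t u = 0" for u
      using pd_b_pr23(1)[OF bd[OF t]]
      by (simp add: lie_form_def coord_field_def vder_nf_form[OF bd[OF t]] vder_const pair_simps pair_3)
  qed
  then have "normal_form b2 U m"
    using b r unfolding normal_form_def F_manifold_open_F_data_iff
    by (auto simp: vec_eq_iff forall_3 vmult_def coord_field_def D3_field_def m_def nilmult_def pair_nf_form U_def)
  moreover have "tangent_algebras_Q1 (open_F_data U m (coord_field 1))"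
    by (simp add: tangent_algebras_Q1_def open_F_data_def m_def coord_field_def algebra_iso_Q1_nf)
  ultimately show ?thesis by blast
qed

section \<open>Functions of t_2 and t_3 alone\<close>

definition emb23 :: "complex^2 \<Rightarrow> complex^3" where
  "emb23 z = vector [0, z $ 1, z $ 2]"

lemma emb23_nth [simp]: "emb23 z $ 1 = 0" "emb23 z $ 2 = z $ 1" "emb23 z $ 3 = z $ 2"
  by (simp_all add: emb23_def)

lemma pr23_emb23 [simp]: "pr23 (emb23 z) = z"
  by (simp add: vec_eq_iff forall_2)

lemma emb23_pr23: "emb23 (pr23 t) = rescale 1 0 t"
  by (simp add: vec_eq_iff forall_3 rescale_def)

lemma complex_diff_emb23 [simp]: "complex_diff (\<lambda>t. emb23 t $ k) t"
  using exhaust_3[of k] by auto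

lemma emb23_0 [simp]: "emb23 0 = 0"
  by (simp add: vec_eq_iff forall_3)

lemma eventually_compose_holomorphic:
  fixes f :: "complex^'n \<Rightarrow> complex^'m"
  assumes "\<forall>\<^sub>F z in nhds w. P z" "\<And>k. complex_diff (\<lambda>z. f z $ k) z0" "f z0 = w"
  shows "\<forall>\<^sub>F t in nhds z0. P (f t)"
proof (rule eventually_compose_filterlim[OF assms(1)])
  have "isCont f z0" using has_derivative_vder[OF assms(2)] by (rule has_derivative_continuous)
  then show "filterlim f (nhds w) (nhds z0)"
    using tendsto_at_iff_tendsto_nhds[of f z0] assms(3) by (simp add: isCont_def)
qed

text \<open>The segment from \<open>t\<close> to its projection on t_1 = 0 stays in the ball, and
  the derivative along it integrates to 0.\<close>

lemma constant_along_first: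
  assumes f: "holomorphic_fun f (ball (0::complex^3) r)" and 0: "\<And>t. t \<in> ball 0 r \<Longrightarrow> pd 1 f t = 0"
    and t: "t \<in> ball 0 r"
  shows "f t = f (emb23 (pr23 t))"
proof -
  have "primitive 1 (pd 1 f) t = f t - f (rescale 1 0 t)"
    by (rule primitive_pd[OF open_ball rescale_in_ball f t])
  moreover have "integral {0..1} (\<lambda>s. pd 1 f (rescale 1 (complex_of_real s) t)) = integral {0..1} (\<lambda>s::real. 0 :: complex)"
    by (rule integral_cong, rule 0, rule rescale_in_ball[OF t]) simp_all
  ultimately show ?thesis by (simp add: primitive_def emb23_pr23)
qed

text \<open>Not involving t_1 becomes a differential equation, the form in which it comes out of the
  Euler condition; the series in two variables is the restriction to t_1 = 0.\<close>

lemma series_in_t23_iff: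
  assumes f: "f \<in> convergent_series"
  shows "series_in_t23 f \<longleftrightarrow> (\<forall>\<^sub>F t in nhds 0. pd 1 f t = 0)"
proof
  assume "series_in_t23 f"
  then obtain g where g: "g \<in> convergent_series" "\<forall>\<^sub>F t in nhds 0. f t = g (pr23 t)"
    unfolding series_in_t23_def by blast
  have "\<forall>\<^sub>F t in nhds 0. complex_diff g (pr23 t)"
    using g(1) by (intro eventually_pr23) (simp add: convergent_series_ev)
  moreover have "\<forall>\<^sub>F t in nhds 0. \<forall>\<^sub>F s in nhds t. f s = g (pr23 s)"
    using g(2) by (simp add: eventually_eventually)
  ultimately show "\<forall>\<^sub>F t in nhds 0. pd 1 f t = 0"
    by eventually_elim (simp add: pd_cong_ev pd_b_pr23)
next
  assume "\<forall>\<^sub>F t in nhds 0. pd 1 f t = 0"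
  moreover have "\<forall>\<^sub>F t in nhds 0. complex_diff f t" using f by (simp add: convergent_series_ev)
  ultimately have "\<forall>\<^sub>F t in nhds 0. complex_diff f t \<and> pd 1 f t = 0" by eventually_elim simp
  then obtain r where r: "r > 0" and *: "\<And>t. t \<in> ball 0 r \<Longrightarrow> complex_diff f t \<and> pd 1 f t = 0"
    unfolding eventually_nhds_metric by (metis dist_commute mem_ball)
  have f: "holomorphic_fun f (ball 0 r)" using * by (simp add: holomorphic_fun_iff)
  have "\<forall>\<^sub>F z in nhds 0. emb23 z \<in> ball 0 r"
    by (rule eventually_compose_holomorphic[OF eventually_nhds_in_open[OF open_ball]]) (use r in simp_all)
  then have "\<forall>\<^sub>F z in nhds 0. complex_diff (\<lambda>z. f (emb23 z)) z"
  proof eventually_elim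
    case (elim z)
    show ?case by (rule complex_diff_compose[of f emb23]) (simp_all add: *[OF elim])
  qed
  then have "(\<lambda>z. f (emb23 z)) \<in> convergent_series" by (simp add: convergent_series_ev)
  moreover have "\<forall>\<^sub>F t in nhds 0. f t = f (emb23 (pr23 t))"
  proof -
    have "\<forall>\<^sub>F t in nhds 0. t \<in> ball (0::complex^3) r" using r by (intro eventually_nhds_in_open) auto
    then show ?thesis
    proof eventually_elim
      case (elim t)
      show ?case by (rule constant_along_first[OF f _ elim]) (simp add: *)
    qed
  qed
  ultimately show "series_in_t23 f" unfolding series_in_t23_def by (intro bexI)
qed

section \<open>Euler fields\<close>

lemma dirder_3: "dirder f t u = u $ 1 * pd 1 f t + u $ 2 * pd 2 f t + u $ (3::3) * pd 3 f t"
  by (simp add: dirder_def sum_3)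

text \<open>The first three equations are [e, E] = e, the last two are Lie_E \<lambda> = \<lambda>
  on \<partial>_2 and \<partial>_3. Stated at one point, they can be split or joined under
  \<open>eventually\<close>.\<close>

definition Euler_at :: "(complex^2 \<Rightarrow> complex) \<Rightarrow> 3 vfield \<Rightarrow> complex^3 \<Rightarrow> bool" where
  "Euler_at b E t \<longleftrightarrow>
     pd 1 (\<lambda>t. E t $ 1) t = 1 \<and> pd 1 (\<lambda>t. E t $ 2) t = 0 \<and> pd 1 (\<lambda>t. E t $ 3) t = 0 \<and>
     pd 2 (\<lambda>t. E t $ 1) t = - b (pr23 t) * pd 2 (\<lambda>t. E t $ 3) t \<and>
     pd 3 (\<lambda>t. E t $ 1) t = - (E t $ 2) * pd 2 (b \<circ> pr23) t
       - pd 3 (\<lambda>t. E t $ 3 * b (pr23 t)) t + b (pr23 t)"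

text \<open>By \<open>lie_mult_nilmult\<close> both directions are algebra at \<open>t\<close>. For
  the converse, the pair (e, e) isolates the bracket [E, e]; the squares of \<partial>_2 and
  \<partial>_3 - b \<partial>_1, which vanish, isolate the values of Lie_E \<lambda> on these
  vectors.\<close>

lemma
  assumes m: "\<forall>\<^sub>F w in nhds t. m w = nilmult (nf_form b w) (axis 1 1)"
    and b: "complex_diff b (pr23 t)" and E: "\<And>k. complex_diff (\<lambda>w. E w $ k) t"
  shows Euler_at_imp_lie_mult: "\<lbrakk>Euler_at b E t; \<And>k. complex_diff (\<lambda>w. A w $ k) t; \<And>k. complex_diff (\<lambda>w. B w $ k) t\<rbrakk>
      \<Longrightarrow> lie_mult m E A B t = m t (A t) (B t)"
    and lie_mult_imp_Euler_at: "(\<And>x y. lie_mult m E (\<lambda>_. x) (\<lambda>_. y) t = m t x y) \<Longrightarrow> Euler_at b E t"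
proof -
  let ?a = "lie_form E (nf_form b) t"
  \<comment> \<open>The derivative of \<open>b \<circ> pr23\<close> along \<open>E\<close>; its
    \<partial>_1 part is 0.\<close>
  define \<beta> where "\<beta> = E t $ 2 * pd 2 (\<lambda>t. b (pr23 t)) t + E t $ 3 * pd 3 (\<lambda>t. b (pr23 t)) t"
  have mt: "m t = nilmult (nf_form b t) (axis 1 1)" using m by (rule eventually_nhds_x_imp_x)
  have a: "?a u = u $ 1 * (pd 1 (\<lambda>t. E t $ 1) t + b (pr23 t) * pd 1 (\<lambda>t. E t $ 3) t)
      + u $ 2 * (pd 2 (\<lambda>t. E t $ 1) t + b (pr23 t) * pd 2 (\<lambda>t. E t $ 3) t)
      + u $ 3 * (\<beta> + pd 3 (\<lambda>t. E t $ 1) t + b (pr23 t) * pd 3 (\<lambda>t. E t $ 3) t)" for u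
    by (simp add: lie_form_def vder_nf_form[OF b] pair_3 dirder_3 \<beta>_def pd_b_pr23(1)[OF b] algebra_simps)
  have pd3: "pd 3 (\<lambda>t. E t $ 3 * b (pr23 t)) t = E t $ 3 * pd 3 (\<lambda>t. b (pr23 t)) t + pd 3 (\<lambda>t. E t $ 3) t * b (pr23 t)"
    by (rule pd_mult[OF E complex_diff_b_pr23[OF b]])
  have br: "lie_bracket E (\<lambda>_. axis 1 1) t $ k = - pd 1 (\<lambda>t. E t $ k) t" for k
    by (simp add: lie_bracket_vder vder_const)
  note lm = lie_mult_nilmult[OF m complex_diff_nf_form[OF b] complex_diff_const]
  show "lie_mult m E A B t = m t (A t) (B t)"
    if C: "Euler_at b E t" and A: "\<And>k. complex_diff (\<lambda>w. A w $ k) t" and B: "\<And>k. complex_diff (\<lambda>w. B w $ k) t"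
  proof -
    have au: "?a u = pair (nf_form b t) u" for u
    proof -
      have p3: "pd 3 (\<lambda>t. E t $ 1) t = - \<beta> - pd 3 (\<lambda>t. E t $ 3) t * b (pr23 t) + b (pr23 t)"
        using C unfolding Euler_at_def comp_def pd3 \<beta>_def by simp
      have "pd 1 (\<lambda>t. E t $ 1) t = 1" "pd 1 (\<lambda>t. E t $ 3) t = 0"
        "pd 2 (\<lambda>t. E t $ 1) t = - b (pr23 t) * pd 2 (\<lambda>t. E t $ 3) t"
        using C by (simp_all add: Euler_at_def)
      then show ?thesis unfolding a pair_nf_form p3 by (simp add: algebra_simps)
    qed
    have "lie_bracket E (\<lambda>_. axis 1 1) t = - axis 1 1"
      using C by (simp add: vec_eq_iff forall_3 br Euler_at_def)
    then show ?thesis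
      unfolding lm[OF A B] au mt nilmult_def by (simp add: vec_eq_iff)
  qed
  show "Euler_at b E t" if H: "\<And>x y. lie_mult m E (\<lambda>_. x) (\<lambda>_. y) t = m t x y"
  proof -
    have eq: "?a x *s y + ?a y *s x
      - (?a x * pair (nf_form b t) y + pair (nf_form b t) x * ?a y) *s axis 1 1
      - (pair (nf_form b t) x * pair (nf_form b t) y) *s lie_bracket E (\<lambda>_. axis 1 1) t
      = nilmult (nf_form b t) (axis 1 1) x y" for x y
      using H[of x y] unfolding lm[OF complex_diff_const complex_diff_const] mt .
    define D where "D = axis 3 1 - b (pr23 t) *s (axis 1 1 :: complex^3)"
    have "- lie_bracket E (\<lambda>_. axis 1 1) t = axis 1 1"
      using eq[of "axis 1 1" "axis 1 1"]
      by (simp add: vec_eq_iff forall_3 pair_nf_form nilmult_def algebra_simps)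
    then have "lie_bracket E (\<lambda>_. axis 1 1) t = - axis 1 1"
      by (metis minus_minus)
    then have p1: "pd 1 (\<lambda>t. E t $ 1) t = 1" "pd 1 (\<lambda>t. E t $ 2) t = 0" "pd 1 (\<lambda>t. E t $ 3) t = 0"
      using br[of 1] br[of 2] br[of 3] by simp_all
    have "?a (axis 2 1) = 0"
      using arg_cong[OF eq[of "axis 2 1" "axis 2 1"], of "\<lambda>v. v $ 2"]
      by (simp add: pair_nf_form nilmult_def)
    moreover have "?a D = 0"
      using arg_cong[OF eq[of D D], of "\<lambda>v. v $ 3"]
      by (simp add: pair_nf_form nilmult_def D_def)
    ultimately show ?thesis
      using p1 by (simp add: a D_def Euler_at_def pd3 comp_def \<beta>_def) (simp add: algebra_simps add_eq_0_iff2)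
  qed
qed

lemma normal_form_ev:
  assumes "normal_form b2 U m" "t \<in> U"
  shows "\<forall>\<^sub>F w in nhds t. m w = nilmult (nf_form b2 w) (axis 1 1)"
  using eventually_nhds_in_open[OF normal_formD(1)[OF assms(1)] assms(2)]
  by (rule eventually_mono) (rule normal_formD(5)[OF assms(1)])

text \<open>One direction tests with constant fields. For the other, the pointwise conditions are
  collected on a common open \<open>W\<close>, which becomes the domain of the Euler field.\<close>

lemma normal_form_Euler_iff:
  assumes nf: "normal_form b2 U m" and E: "\<And>i. (\<lambda>t. E t $ i) \<in> convergent_series"
  shows "(\<exists>W. 0 \<in> W \<and> W \<subseteq> U \<and> Euler_field W m E) \<longleftrightarrow> (\<forall>\<^sub>F t in nhds 0. Euler_at b2 E t)"
proof -
  have Ed: "\<forall>\<^sub>F t in nhds 0. \<forall>i. complex_diff (\<lambda>t. E t $ i) t"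
    using E by (simp add: convergent_series_ev eventually_all_finite)
  have bd: "\<forall>\<^sub>F t in nhds 0. complex_diff b2 (pr23 t)"
    using normal_formD(4)[OF nf] by (intro eventually_pr23) (simp add: convergent_series_ev)
  have inU: "\<forall>\<^sub>F t in nhds 0. t \<in> U"
    using normal_formD(1,2)[OF nf] by (rule eventually_nhds_in_open)
  show ?thesis
  proof
    assume "\<exists>W. 0 \<in> W \<and> W \<subseteq> U \<and> Euler_field W m E"
    then obtain W where W: "0 \<in> W" "W \<subseteq> U" "Euler_field W m E" by blast
    have "open W" using W(3) by (simp add: Euler_field_def)
    then have "\<forall>\<^sub>F t in nhds 0. t \<in> W" using W(1) by (rule eventually_nhds_in_open)
    with Ed bd show "\<forall>\<^sub>F t in nhds 0. Euler_at b2 E t"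
    proof eventually_elim
      case (elim t)
      have tU: "t \<in> U" using elim(3) W(2) by blast
      have c: "holomorphic_map (\<lambda>_. z) W" for z :: "complex^3"
        by (simp add: holomorphic_map_def holomorphic_fun_iff)
      show ?case
      proof (rule lie_mult_imp_Euler_at[OF normal_form_ev[OF nf tU] elim(2)])
        show "complex_diff (\<lambda>w. E w $ k) t" for k using elim(1) by blast
        show "lie_mult m E (\<lambda>_. x) (\<lambda>_. y) t = m t x y" for x y
          using W(3)[unfolded Euler_field_def, THEN conjunct2, THEN conjunct2, rule_format,
              of W "\<lambda>_. x" "\<lambda>_. y" t] elim(3) \<open>open W\<close> c by simp
      qed
    qed
  next
    assume "\<forall>\<^sub>F t in nhds 0. Euler_at b2 E t"
    with Ed bd inU have "\<forall>\<^sub>F t in nhds 0. (\<forall>i. complex_diff (\<lambda>t. E t $ i) t) \<and> complex_diff b2 (pr23 t)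
        \<and> t \<in> U \<and> Euler_at b2 E t"
      by eventually_elim simp
    then obtain W where W: "open W" "0 \<in> W"
      and *: "\<And>t. t \<in> W \<Longrightarrow> (\<forall>i. complex_diff (\<lambda>t. E t $ i) t) \<and> complex_diff b2 (pr23 t) \<and> t \<in> U \<and> Euler_at b2 E t"
      unfolding eventually_nhds by metis
    have "Euler_field W m E"
      unfolding Euler_field_def
    proof (intro conjI allI impI ballI)
      show "open W" by fact
      show "holomorphic_map E W" using * by (simp add: holomorphic_map_def holomorphic_fun_iff)
      fix W' and X Y :: "3 vfield" and t
      assume H: "open W' \<and> W' \<subseteq> W \<and> holomorphic_map X W' \<and> holomorphic_map Y W'" and t: "t \<in> W'"
      have tW: "t \<in> W" using H t by blast
      have X: "complex_diff (\<lambda>w. X w $ k) t" and Y: "complex_diff (\<lambda>w. Y w $ k) t" for k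
        using holomorphic_map_diff[of X W' t] holomorphic_map_diff[of Y W' t] H t by simp_all
      show "lie_mult m E X Y t = m t (X t) (Y t)"
        by (rule Euler_at_imp_lie_mult[OF normal_form_ev[OF nf] _ _ _ X Y]) (use *[OF tW] in simp_all)
    qed
    then show "\<exists>W. 0 \<in> W \<and> W \<subseteq> U \<and> Euler_field W m E" using W * by blast
  qed
qed

lemma Euler_at_ev_iff:
  assumes E: "\<And>i. (\<lambda>t. E t $ i) \<in> convergent_series"
  shows "(\<forall>\<^sub>F t in nhds 0. Euler_at b2 E t) \<longleftrightarrow>
     series_in_t23 (\<lambda>t. E t $ 1 - t $ 1) \<and> series_in_t23 (\<lambda>t. E t $ 2) \<and> series_in_t23 (\<lambda>t. E t $ 3) \<and>
     (\<forall>\<^sub>F t in nhds 0. pd 2 (\<lambda>t. E t $ 1) t = - b2 (pr23 t) * pd 2 (\<lambda>t. E t $ 3) t) \<and>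
     (\<forall>\<^sub>F t in nhds 0. pd 3 (\<lambda>t. E t $ 1) t = - (E t $ 2) * pd 2 (b2 \<circ> pr23) t
        - pd 3 (\<lambda>t. E t $ 3 * b2 (pr23 t)) t + b2 (pr23 t))"
proof -
  have d: "\<forall>\<^sub>F t in nhds 0. complex_diff (\<lambda>t. E t $ 1) t" using E by (simp add: convergent_series_ev)
  then have "\<forall>\<^sub>F t in nhds 0. complex_diff (\<lambda>t. E t $ 1 - t $ 1) t"
    by eventually_elim (simp add: complex_diff_diff)
  then have "series_in_t23 (\<lambda>t. E t $ 1 - t $ 1) \<longleftrightarrow> (\<forall>\<^sub>F t in nhds 0. pd 1 (\<lambda>t. E t $ 1 - t $ 1) t = 0)"
    by (intro series_in_t23_iff) (simp add: convergent_series_ev)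
  also have "\<dots> \<longleftrightarrow> (\<forall>\<^sub>F t in nhds 0. pd 1 (\<lambda>t. E t $ 1) t = 1)"
    by (rule eventually_cong[OF d]) (simp add: pd_diff pd_coord)
  finally show ?thesis
    using series_in_t23_iff[OF E[of 2]] series_in_t23_iff[OF E[of 3]]
    by (simp only: Euler_at_def eventually_conj_iff)
qed

section \<open>Invariance of the ideal\<close>

lemma germ0_eq_iff: "germ0 f = germ0 g \<longleftrightarrow> (\<forall>\<^sub>F z in nhds 0. f z = g z)"
proof
  have "f \<in> germ0 f" by (simp add: germ0_def)
  moreover assume "germ0 f = germ0 g"
  ultimately have "f \<in> germ0 g" by simp
  then show "\<forall>\<^sub>F z in nhds 0. f z = g z" by (simp add: germ0_def)
next
  assume fg: "\<forall>\<^sub>F z in nhds 0. f z = g z"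
  have "(\<forall>\<^sub>F z in nhds 0. h z = f z) \<longleftrightarrow> (\<forall>\<^sub>F z in nhds 0. h z = g z)" for h
    by (rule eventually_cong[OF fg]) simp
  then show "germ0 f = germ0 g" by (simp add: germ0_def)
qed

lemma germ0_self: "f \<in> germ0 f"
  by (simp add: germ0_def)

lemma germ0_memD: "g \<in> germ0 f \<Longrightarrow> \<forall>\<^sub>F z in nhds 0. g z = f z"
  by (simp add: germ0_def)

lemma series_ring_mult: "germ0 f \<otimes>\<^bsub>series_ring\<^esub> germ0 g = germ0 (\<lambda>z. f z * g z)"
proof -
  have "germ0 (\<lambda>z. f' z * g' z) = germ0 (\<lambda>z. f z * g z)" if "f' \<in> germ0 f" "g' \<in> germ0 g" for f' g'
    unfolding germ0_eq_iff using germ0_memD[OF that(1)] germ0_memD[OF that(2)] by eventually_elim simp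
  then have "(\<Union>f'\<in>germ0 f. \<Union>g'\<in>germ0 g. germ0 (\<lambda>z. f' z * g' z)) = germ0 (\<lambda>z. f z * g z)"
    using germ0_self[of f] germ0_self[of g] by blast
  then show ?thesis by (simp add: series_ring_def)
qed

lemma series_ring_add: "germ0 f \<oplus>\<^bsub>series_ring\<^esub> germ0 g = germ0 (\<lambda>z. f z + g z)"
proof -
  have "germ0 (\<lambda>z. f' z + g' z) = germ0 (\<lambda>z. f z + g z)" if "f' \<in> germ0 f" "g' \<in> germ0 g" for f' g'
    unfolding germ0_eq_iff using germ0_memD[OF that(1)] germ0_memD[OF that(2)] by eventually_elim simp
  then have "(\<Union>f'\<in>germ0 f. \<Union>g'\<in>germ0 g. germ0 (\<lambda>z. f' z + g' z)) = germ0 (\<lambda>z. f z + g z)"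
    using germ0_self[of f] germ0_self[of g] by blast
  then show ?thesis by (simp add: series_ring_def)
qed

lemma series_ring_carrier: "carrier series_ring = germ0 ` convergent_series"
  and series_ring_one: "\<one>\<^bsub>series_ring\<^esub> = germ0 (\<lambda>z. 1)"
  by (simp_all add: series_ring_def)

lemma convergent_series_mult: "f \<in> convergent_series \<Longrightarrow> g \<in> convergent_series \<Longrightarrow> (\<lambda>z. f z * g z) \<in> convergent_series"
  unfolding convergent_series_ev by (elim eventually_rev_mp) (simp add: complex_diff_mult)

text \<open>Dimensions may differ and invertibility is left out, so that \<open>emb23\<close> and
  both members of a pair of inverse germs are covered.\<close>

definition germ_map :: "(complex^'n \<Rightarrow> complex^'m) \<Rightarrow> bool" where
  "germ_map \<alpha> \<longleftrightarrow> \<alpha> 0 = 0 \<and> (\<forall>\<^sub>F z in nhds 0. \<forall>k. complex_diff (\<lambda>w. \<alpha> w $ k) z)"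

lemma germ_map_eventually:
  assumes "germ_map \<alpha>" "\<forall>\<^sub>F z in nhds 0. P z"
  shows "\<forall>\<^sub>F z in nhds 0. P (\<alpha> z)"
  using assms(1) unfolding germ_map_def
  by (intro eventually_compose_holomorphic[OF assms(2)]) (auto dest: eventually_nhds_x_imp_x)

lemma convergent_series_compose:
  assumes "germ_map \<alpha>" "f \<in> convergent_series"
  shows "(\<lambda>z. f (\<alpha> z)) \<in> convergent_series"
proof -
  have "\<forall>\<^sub>F z in nhds 0. complex_diff f (\<alpha> z)"
    using assms(2) by (intro germ_map_eventually[OF assms(1)]) (simp add: convergent_series_ev)
  moreover have "\<forall>\<^sub>F z in nhds 0. \<forall>k. complex_diff (\<lambda>w. \<alpha> w $ k) z"
    using assms(1) by (simp add: germ_map_def)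
  ultimately have "\<forall>\<^sub>F z in nhds 0. complex_diff (\<lambda>z. f (\<alpha> z)) z"
    by eventually_elim (simp add: complex_diff_compose[of f \<alpha>])
  then show ?thesis by (simp add: convergent_series_ev)
qed

lemma pullback_germ0:
  assumes "germ_map \<alpha>"
  shows "pullback \<alpha> (germ0 f) = germ0 (\<lambda>z. f (\<alpha> z))"
proof -
  have "germ0 (f' \<circ> \<alpha>) = germ0 (\<lambda>z. f (\<alpha> z))" if "f' \<in> germ0 f" for f'
    unfolding germ0_eq_iff comp_def by (rule germ_map_eventually[OF assms germ0_memD[OF that]])
  then show ?thesis using germ0_self[of f] unfolding pullback_def by blast
qed

lemma germ_map_inverse_biholomorphic:
  fixes \<alpha> \<beta> :: "complex^'n \<Rightarrow> complex^'n"
  assumes \<alpha>: "germ_map \<alpha>" and \<beta>: "germ_map \<beta>"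
    and \<beta>\<alpha>: "\<forall>\<^sub>F z in nhds 0. \<beta> (\<alpha> z) = z" and \<alpha>\<beta>: "\<forall>\<^sub>F z in nhds 0. \<alpha> (\<beta> z) = z"
  shows "biholomorphic_germ \<alpha>"
proof -
  have "\<exists>A. open A \<and> 0 \<in> A \<and> holomorphic_map \<alpha> A \<and> (\<forall>z\<in>A. \<beta> (\<alpha> z) = z)"
    if "germ_map \<alpha>" "\<forall>\<^sub>F z in nhds 0. \<beta> (\<alpha> z) = z" for \<alpha> \<beta> :: "complex^'n \<Rightarrow> complex^'n"
  proof -
    have "\<forall>\<^sub>F z in nhds 0. \<forall>k. complex_diff (\<lambda>w. \<alpha> w $ k) z" using that(1) by (simp add: germ_map_def)
    with that(2) have "\<forall>\<^sub>F z in nhds 0. (\<forall>k. complex_diff (\<lambda>w. \<alpha> w $ k) z) \<and> \<beta> (\<alpha> z) = z"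
      by eventually_elim simp
    then obtain A where "open A" "0 \<in> A" "\<And>z. z \<in> A \<Longrightarrow> (\<forall>k. complex_diff (\<lambda>w. \<alpha> w $ k) z) \<and> \<beta> (\<alpha> z) = z"
      unfolding eventually_nhds by blast
    then show ?thesis by (intro exI[of _ A]) (simp add: holomorphic_map_def holomorphic_fun_iff)
  qed
  note loc = this
  from loc[of \<alpha> \<beta>, OF \<alpha> \<beta>\<alpha>] obtain A where A: "open A" "0 \<in> A" "holomorphic_map \<alpha> A" "\<And>z. z \<in> A \<Longrightarrow> \<beta> (\<alpha> z) = z"
    by blast
  from loc[of \<beta> \<alpha>, OF \<beta> \<alpha>\<beta>] obtain B where B: "open B" "0 \<in> B" "holomorphic_map \<beta> B" "\<And>z. z \<in> B \<Longrightarrow> \<alpha> (\<beta> z) = z"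
    by blast
  have "biholomorphic \<alpha> {w \<in> A. \<alpha> w \<in> B}"
    by (rule biholomorphicI[OF A(1,3) B(1,3)]) (simp_all add: A(4) B(4))
  moreover have \<alpha>0: "\<alpha> 0 = 0" using \<alpha> by (simp add: germ_map_def)
  moreover have "0 \<in> {w \<in> A. \<alpha> w \<in> B}" using A(2) B(2) \<alpha>0 by simp
  ultimately show ?thesis unfolding biholomorphic_germ_def by (intro conjI exI)
qed

lemma pullback_ring_iso:
  fixes \<alpha> \<beta> :: "complex^'n \<Rightarrow> complex^'n"
  assumes \<alpha>: "germ_map \<alpha>" and \<beta>: "germ_map \<beta>"
    and \<beta>\<alpha>: "\<forall>\<^sub>F z in nhds 0. \<beta> (\<alpha> z) = z" and \<alpha>\<beta>: "\<forall>\<^sub>F z in nhds 0. \<alpha> (\<beta> z) = z"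
  shows "pullback \<alpha> \<in> ring_iso series_ring series_ring"
proof -
  have inv: "pullback \<beta> (pullback \<alpha> (germ0 f)) = germ0 f"
    if "germ_map \<alpha>" "germ_map \<beta>" "\<forall>\<^sub>F z in nhds 0. \<alpha> (\<beta> z) = z" for \<alpha> \<beta> :: "complex^'n \<Rightarrow> complex^'n" and f
    unfolding pullback_germ0[OF that(1)] pullback_germ0[OF that(2)] germ0_eq_iff
    using that(3) by eventually_elim simp
  have cl: "pullback \<alpha> \<gamma> \<in> carrier series_ring" if "germ_map \<alpha>" "\<gamma> \<in> carrier series_ring"
    for \<alpha> :: "complex^'n \<Rightarrow> complex^'n" and \<gamma>
    using that convergent_series_compose[OF that(1)] by (auto simp: series_ring_carrier pullback_germ0)
  have "bij_betw (pullback \<alpha>) (carrier series_ring) (carrier series_ring)"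
    by (rule bij_betwI[where g = "pullback \<beta>"])
      (use cl[OF \<alpha>] cl[OF \<beta>] inv[of \<alpha> \<beta>, OF \<alpha> \<beta> \<alpha>\<beta>] inv[of \<beta> \<alpha>, OF \<beta> \<alpha> \<beta>\<alpha>] in \<open>auto simp: series_ring_carrier\<close>)
  moreover have "pullback \<alpha> \<in> ring_hom series_ring series_ring"
    using cl[OF \<alpha>]
    by (intro ring_hom_memI)
      (auto simp: series_ring_carrier series_ring_mult series_ring_add series_ring_one pullback_germ0[OF \<alpha>])
  ultimately show ?thesis by (simp add: ring_iso_def)
qed

text \<open>The identity for \<open>d\<close> gives one inclusion and that for \<open>d'\<close> the
  other: divisibility in both directions stands in for the invertibility of a Jacobian.\<close>

lemma pullback_PIdl:
  fixes \<alpha> \<beta> :: "complex^'n \<Rightarrow> complex^'n"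
  assumes \<alpha>: "germ_map \<alpha>" and \<beta>: "germ_map \<beta>" and \<alpha>\<beta>: "\<forall>\<^sub>F z in nhds 0. \<beta> (\<alpha> z) = z"
    and J: "J \<in> convergent_series" "\<forall>\<^sub>F z in nhds 0. d z = d' (\<beta> z) * J z"
    and J': "J' \<in> convergent_series" "\<forall>\<^sub>F z in nhds 0. d' z = d (\<alpha> z) * J' z"
  shows "pullback \<alpha> ` (PIdl\<^bsub>series_ring\<^esub> (germ0 d)) = PIdl\<^bsub>series_ring\<^esub> (germ0 d')"
proof -
  have PI: "PIdl\<^bsub>series_ring\<^esub> (germ0 d) = (\<lambda>r. germ0 (\<lambda>z. r z * d z)) ` convergent_series"
    for d :: "complex^'n \<Rightarrow> complex"
    by (simp add: cgenideal_def series_ring_carrier setcompr_eq_image image_image series_ring_mult)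
  show ?thesis
    unfolding PI image_image pullback_germ0[OF \<alpha>]
  proof (intro equalityI subsetI)
    fix \<gamma> assume "\<gamma> \<in> (\<lambda>r. germ0 (\<lambda>z. r (\<alpha> z) * d (\<alpha> z))) ` convergent_series"
    then obtain r where r: "r \<in> convergent_series" and \<gamma>: "\<gamma> = germ0 (\<lambda>z. r (\<alpha> z) * d (\<alpha> z))" by blast
    have "(\<lambda>z. r (\<alpha> z) * J (\<alpha> z)) \<in> convergent_series"
      by (intro convergent_series_mult convergent_series_compose[OF \<alpha>] r J)
    moreover have "\<gamma> = germ0 (\<lambda>z. r (\<alpha> z) * J (\<alpha> z) * d' z)"
      unfolding \<gamma> germ0_eq_iff using germ_map_eventually[OF \<alpha> J(2)] \<alpha>\<beta> by eventually_elim simp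
    ultimately show "\<gamma> \<in> (\<lambda>r. germ0 (\<lambda>z. r z * d' z)) ` convergent_series"
      by (intro image_eqI[where x = "\<lambda>z. r (\<alpha> z) * J (\<alpha> z)"])
  next
    fix \<gamma> assume "\<gamma> \<in> (\<lambda>r. germ0 (\<lambda>z. r z * d' z)) ` convergent_series"
    then obtain r where r: "r \<in> convergent_series" and \<gamma>: "\<gamma> = germ0 (\<lambda>z. r z * d' z)" by blast
    have "(\<lambda>z. r (\<beta> z) * J' (\<beta> z)) \<in> convergent_series"
      by (intro convergent_series_mult convergent_series_compose[OF \<beta>] r J')
    moreover have "\<gamma> = germ0 (\<lambda>z. r (\<beta> (\<alpha> z)) * J' (\<beta> (\<alpha> z)) * d (\<alpha> z))"
      unfolding \<gamma> germ0_eq_iff using J'(2) \<alpha>\<beta> by eventually_elim simp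
    ultimately show "\<gamma> \<in> (\<lambda>r. germ0 (\<lambda>z. r (\<alpha> z) * d (\<alpha> z))) ` convergent_series"
      by (intro image_eqI[where x = "\<lambda>z. r (\<beta> z) * J' (\<beta> z)"])
  qed
qed

section \<open>Isomorphisms of normal forms on the (t_2, t_3)-plane\<close>

text \<open>Subtracting l(u) e from u leaves a vector of square zero. Its image has square zero as
  well, and l' is multiplicative, so l' vanishes on the image.\<close>

lemma nilmult_hom_pair:
  assumes hom: "\<And>u v. vder \<phi> z (nilmult l e u v) = nilmult l' e' (vder \<phi> z u) (vder \<phi> z v)"
    and e: "vder \<phi> z e = e'" and le: "pair l e = 1" "pair l' e' = 1"
  shows "pair l' (vder \<phi> z u) = pair l u"
proof -
  define n where "n = u - pair l u *s e"
  define w where "w = vder \<phi> z n"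
  have "pair l n = 0" by (simp add: n_def pair_simps le)
  then have "nilmult l e n n = 0" by (simp add: nilmult_def)
  then have "nilmult l' e' w w = 0" using hom[of n n] vder_scale[of \<phi> z 0 0] by (simp add: w_def)
  then have "pair l' (nilmult l' e' w w) = 0" by (simp add: pair_simps)
  then have "pair l' w * pair l' w = 0" unfolding nilmult_def pair_simps le by simp
  then have "pair l' w = 0" by simp
  moreover have "vder \<phi> z u = pair l u *s e' + w"
    by (simp add: w_def n_def vder_diff vder_scale e)
  ultimately show ?thesis by (simp add: pair_simps le)
qed

text \<open>The multiplication has disappeared: by \<open>nilmult_hom_pair\<close> an isomorphism
  pulls the one-form back, and the argument on ideals works with \<partial>_1 and the forms
  alone.\<close>

definition nf_compatible :: "(complex^2 \<Rightarrow> complex) \<Rightarrow> (complex^2 \<Rightarrow> complex) \<Rightarrow> (complex^3 \<Rightarrow> complex^3) \<Rightarrow> (complex^3) set \<Rightarrow> bool" where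
  "nf_compatible b b' \<phi> S \<longleftrightarrow> open S \<and> 0 \<in> S \<and> \<phi> 0 = 0 \<and> holomorphic_map \<phi> S \<and>
     (\<forall>z\<in>S. vder \<phi> z (axis 1 1) = axis 1 1 \<and> (\<forall>u. pair (nf_form b' (\<phi> z)) (vder \<phi> z u) = pair (nf_form b z) u))"

lemma F_compatible_imp_nf_compatible:
  assumes F: "F_compatible \<phi> S m (coord_field 1) m' (coord_field 1)"
    and nf: "normal_form b U m" "normal_form b' U' m'" and S: "S \<subseteq> U" "\<phi> ` S \<subseteq> U'" "0 \<in> S" "\<phi> 0 = 0"
  shows "nf_compatible b b' \<phi> S"
proof -
  have bi: "biholomorphic \<phi> S" using F by (simp add: F_compatible_iff)
  have "vder \<phi> z (axis 1 1) = axis 1 1" if "z \<in> S" for z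
    using F that by (simp add: F_compatible_iff coord_field_def)
  moreover have "pair (nf_form b' (\<phi> z)) (vder \<phi> z u) = pair (nf_form b z) u" if z: "z \<in> S" for z u
  proof (rule nilmult_hom_pair)
    have "m z = nilmult (nf_form b z) (axis 1 1)" "m' (\<phi> z) = nilmult (nf_form b' (\<phi> z)) (axis 1 1)"
      using normal_formD(5)[OF nf(1)] normal_formD(5)[OF nf(2)] z S by blast+
    moreover have "vder \<phi> z (m z u v) = m' (\<phi> z) (vder \<phi> z u) (vder \<phi> z v)" for u v
      using F z unfolding F_compatible_iff by blast
    ultimately show "vder \<phi> z (nilmult (nf_form b z) (axis 1 1) u v)
        = nilmult (nf_form b' (\<phi> z)) (axis 1 1) (vder \<phi> z u) (vder \<phi> z v)" for u v
      by simp
  next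
    show "vder \<phi> z (axis 1 1) = axis 1 1" using F z by (simp add: F_compatible_iff coord_field_def)
  qed (simp_all add: pair_nf_form)
  ultimately show ?thesis
    using biholomorphicD(1,3)[OF bi] S by (simp add: nf_compatible_def)
qed

text \<open>The second and third component of \<phi> have zero derivative along \<partial>_1, so
  \<phi> descends to the (t_2, t_3)-plane.\<close>

lemma nf_compatible_pr23:
  assumes "nf_compatible b b' \<phi> S"
  shows "\<forall>\<^sub>F t in nhds 0. pr23 (\<phi> t) = pr23 (\<phi> (emb23 (pr23 t)))"
proof -
  obtain r where r: "r > 0" "ball 0 r \<subseteq> S"
    using assms open_contains_ball unfolding nf_compatible_def by blast
  have d: "holomorphic_fun (\<lambda>t. \<phi> t $ k) (ball 0 r)" for k
    using assms r(2) by (auto simp: nf_compatible_def holomorphic_map_def intro: holomorphic_fun_subset)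
  have "vder \<phi> t (axis 1 1) = axis 1 1" if "t \<in> ball 0 r" for t
    using assms that r(2) by (auto simp: nf_compatible_def)
  then have "pd 1 (\<lambda>t. \<phi> t $ k) t = axis 1 1 $ k" if "t \<in> ball 0 r" for t k
    using that vder_nth[of \<phi> t "axis 1 1" k] by simp
  from this[of _ 2] this[of _ 3]
  have p: "pd 1 (\<lambda>t. \<phi> t $ 2) t = 0" "pd 1 (\<lambda>t. \<phi> t $ 3) t = 0" if "t \<in> ball 0 r" for t
    using that by simp_all
  have "\<forall>\<^sub>F t in nhds 0. t \<in> ball (0::complex^3) r" using r by (intro eventually_nhds_in_open) auto
  then show ?thesis
  proof eventually_elim
    case (elim t)
    show ?case
      using constant_along_first[OF d p(1) elim] constant_along_first[OF d p(2) elim]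
      by (simp add: vec_eq_iff forall_2)
  qed
qed

text \<open>On the slice t_1 = 0 the condition on forms reads dG + \<beta> dq = b dt_3, where G and
  q are the first and third component of \<phi> and \<beta> = b' \<circ> \<psi>. Its exterior
  derivative is d\<beta> \<and> dq = (\<partial>_2 b) dt_2 \<and> dt_3. The dq part of d\<beta>
  drops out, so \<open>J\<close> is the Jacobian determinant of \<psi>.\<close>

lemma nf_compatible_Jacobian:
  assumes c: "nf_compatible b b' \<phi> S" and b: "b \<in> convergent_series" and b': "b' \<in> convergent_series"
  defines "\<psi> \<equiv> (\<lambda>z. pr23 (\<phi> (emb23 z)))"
  shows "germ_map \<psi>" "\<exists>J\<in>convergent_series. \<forall>\<^sub>F z in nhds 0. pd 1 b z = pd 1 b' (\<psi> z) * J z"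
proof -
  have S: "open S" "0 \<in> S" "\<phi> 0 = 0" "holomorphic_map \<phi> S" using c by (simp_all add: nf_compatible_def)
  have em: "germ_map emb23" by (simp add: germ_map_def)
  have inS: "\<forall>\<^sub>F z in nhds 0. emb23 z \<in> S"
    by (rule germ_map_eventually[OF em eventually_nhds_in_open[OF S(1,2)]])
  have \<phi>d: "complex_diff (\<lambda>z. \<phi> (emb23 z) $ k) z" if "emb23 z \<in> S" for z k
    using complex_diff_compose[of "\<lambda>w. \<phi> w $ k" emb23, OF holomorphic_map_diff[OF S(4) that] complex_diff_emb23] .
  have \<psi>d: "complex_diff (\<lambda>z. \<psi> z $ k) z" if "emb23 z \<in> S" for z k
    using exhaust_2[of k] \<phi>d[OF that] by (auto simp: \<psi>_def)
  show \<psi>: "germ_map \<psi>"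
    unfolding germ_map_def using inS by (auto simp: \<psi>_def S(3) elim!: eventually_mono intro: \<psi>d[unfolded \<psi>_def])
  have "\<forall>\<^sub>F z in nhds 0. complex_diff b' (\<psi> z)" "\<forall>\<^sub>F z in nhds 0. complex_diff b z"
    using b b' by (auto simp: convergent_series_ev intro: germ_map_eventually[OF \<psi>])
  with inS have "\<forall>\<^sub>F z in nhds 0. emb23 z \<in> S \<and> complex_diff b' (\<psi> z) \<and> complex_diff b z"
    by eventually_elim simp
  then obtain B where B: "open B" "0 \<in> B" and *: "\<And>z. z \<in> B \<Longrightarrow> emb23 z \<in> S \<and> complex_diff b' (\<psi> z) \<and> complex_diff b z"
    unfolding eventually_nhds by metis
  define G where "G = (\<lambda>z. \<phi> (emb23 z) $ 1)"
  define p q where "p = (\<lambda>z. \<psi> z $ 1)" and "q = (\<lambda>z. \<psi> z $ 2)"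
  define \<beta> where "\<beta> = (\<lambda>z. b' (\<psi> z))"
  have hol: "holomorphic_fun G B" "holomorphic_fun p B" "holomorphic_fun q B" "holomorphic_fun \<beta> B"
    using * \<phi>d \<psi>d by (simp_all add: holomorphic_fun_iff G_def p_def q_def \<beta>_def complex_diff_compose[of b' \<psi>])
  note hol' = hol[THEN holomorphic_fun_diff] hol[THEN holomorphic_pd[OF B(1)], THEN holomorphic_fun_diff]
  have eqs: "pd 1 G z + \<beta> z * pd 1 q z = 0" "pd 2 G z + \<beta> z * pd 2 q z = b z" if z: "z \<in> B" for z
  proof -
    have pe: "pd i (\<lambda>z. \<phi> (emb23 z) $ k) z = (if i = 1 then pd 2 (\<lambda>w. \<phi> w $ k) (emb23 z) else pd 3 (\<lambda>w. \<phi> w $ k) (emb23 z))" for i k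
      using pd_compose[of "\<lambda>w. \<phi> w $ k" emb23 z i] holomorphic_map_diff[OF S(4)] * z exhaust_2[of i]
      by (auto simp: sum_3 pd_coord)
    have l: "pair (nf_form b' (\<phi> (emb23 z))) (vder \<phi> (emb23 z) u) = pair (nf_form b (emb23 z)) u" for u
      using c * z by (simp add: nf_compatible_def)
    show "pd 1 G z + \<beta> z * pd 1 q z = 0" "pd 2 G z + \<beta> z * pd 2 q z = b z"
      using l[of "axis 2 1"] l[of "axis 3 1"] by (simp_all add: pair_nf_form G_def q_def \<psi>_def \<beta>_def pe)
  qed
  have pb: "pd i \<beta> z = pd 1 b' (\<psi> z) * pd i p z + pd 2 b' (\<psi> z) * pd i q z" if z: "z \<in> B" for z i
    using pd_compose[of b' \<psi> z i] * z \<psi>d by (simp add: \<beta>_def p_def q_def sum_2)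
  \<comment> \<open>The exterior derivative by hand: the first equation is differentiated in
    direction 2, the second in direction 1, and in the difference the mixed derivatives of
    \<open>G\<close> and \<open>q\<close> cancel.\<close>
  have key: "pd 1 b z = pd 1 b' (\<psi> z) * (pd 1 p z * pd 2 q z - pd 2 p z * pd 1 q z)" if z: "z \<in> B" for z
  proof -
    have "\<forall>\<^sub>F w in nhds z. pd 1 G w + \<beta> w * pd 1 q w = 0"
      using eventually_nhds_in_open[OF B(1) z] by (rule eventually_mono) (rule eqs)
    from pd_cong_ev[OF this, of 2]
    have 1: "pd 2 (pd 1 G) z + (\<beta> z * pd 2 (pd 1 q) z + pd 2 \<beta> z * pd 1 q z) = 0"
      using z by (simp add: pd_add complex_diff_mult pd_mult hol')
    have "\<forall>\<^sub>F w in nhds z. pd 2 G w + \<beta> w * pd 2 q w = b w"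
      using eventually_nhds_in_open[OF B(1) z] by (rule eventually_mono) (rule eqs)
    from pd_cong_ev[OF this, of 1]
    have 2: "pd 1 (pd 2 G) z + (\<beta> z * pd 1 (pd 2 q) z + pd 1 \<beta> z * pd 2 q z) = pd 1 b z"
      using z by (simp add: pd_add complex_diff_mult pd_mult hol')
    have "pd 1 b z = (pd 1 (pd 2 G) z + (\<beta> z * pd 1 (pd 2 q) z + pd 1 \<beta> z * pd 2 q z))
        - (pd 2 (pd 1 G) z + (\<beta> z * pd 2 (pd 1 q) z + pd 2 \<beta> z * pd 1 q z))"
      unfolding 1 2 by simp
    also have "\<dots> = pd 1 \<beta> z * pd 2 q z - pd 2 \<beta> z * pd 1 q z"
      unfolding pd_commute[OF B(1) hol(1) z, of 1 2] pd_commute[OF B(1) hol(3) z, of 1 2] by simp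
    finally have "pd 1 b z = pd 1 \<beta> z * pd 2 q z - pd 2 \<beta> z * pd 1 q z" .
    then show ?thesis by (simp add: pb[OF z] algebra_simps)
  qed
  have "(\<lambda>z. pd 1 p z * pd 2 q z - pd 2 p z * pd 1 q z) \<in> convergent_series"
    unfolding convergent_series_ev using eventually_nhds_in_open[OF B]
    by (rule eventually_mono) (intro complex_diff_diff complex_diff_mult hol')
  moreover have "\<forall>\<^sub>F z in nhds 0. pd 1 b z = pd 1 b' (\<psi> z) * (pd 1 p z * pd 2 q z - pd 2 p z * pd 1 q z)"
    using eventually_nhds_in_open[OF B] by (rule eventually_mono) (rule key)
  ultimately show "\<exists>J\<in>convergent_series. \<forall>\<^sub>F z in nhds 0. pd 1 b z = pd 1 b' (\<psi> z) * J z"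
    by (intro bexI[where x = "\<lambda>z. pd 1 p z * pd 2 q z - pd 2 p z * pd 1 q z"])
qed

text \<open>Since \<eta> descends along \<open>pr23\<close>, projecting \<phi>(z) to t_1 = 0 does
  not change the (t_2, t_3)-part of its image under \<eta>. So the descended maps invert each other
  as \<eta> and \<phi> do.\<close>

lemma nf_compatible_inverse:
  assumes c1: "nf_compatible b b' \<phi> S" and c2: "nf_compatible b' b \<eta> T"
    and inv: "\<And>z. z \<in> S \<Longrightarrow> \<eta> (\<phi> z) = z"
  shows "\<forall>\<^sub>F z in nhds 0. pr23 (\<eta> (emb23 (pr23 (\<phi> (emb23 z))))) = z"
proof -
  have S: "open S" "0 \<in> S" "\<phi> 0 = 0" "holomorphic_map \<phi> S" using c1 by (simp_all add: nf_compatible_def)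
  have em: "germ_map emb23" by (simp add: germ_map_def)
  have inS: "\<forall>\<^sub>F z in nhds 0. emb23 z \<in> S"
    by (rule germ_map_eventually[OF em eventually_nhds_in_open[OF S(1,2)]])
  have "germ_map \<phi>"
    using S(3) holomorphic_map_diff[OF S(4)]
    by (auto simp: germ_map_def intro: eventually_mono[OF eventually_nhds_in_open[OF S(1,2)]])
  from germ_map_eventually[OF this nf_compatible_pr23[OF c2]]
  have "\<forall>\<^sub>F z in nhds 0. pr23 (\<eta> (\<phi> z)) = pr23 (\<eta> (emb23 (pr23 (\<phi> z))))" .
  from germ_map_eventually[OF em this] inS show ?thesis
    by eventually_elim (simp add: inv)
qed

lemma normal_form_ideal_invariant:
  assumes nf: "normal_form b2 U m" "normal_form b2' U' m'"
    and iso: "F_germ_iso (open_F_data U m (coord_field 1)) 0 (open_F_data U' m' (coord_field 1)) 0"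
  shows "\<exists>\<phi>. biholomorphic_germ \<phi> \<and> pullback \<phi> \<in> ring_iso series_ring series_ring \<and>
     pullback \<phi> ` (PIdl\<^bsub>series_ring\<^esub> (germ0 (pd 1 b2))) = PIdl\<^bsub>series_ring\<^esub> (germ0 (pd 1 b2'))"
proof -
  obtain P f where P: "0 \<in> P" "f 0 = 0"
    and F0: "F_compatible (id \<circ> f \<circ> inv_into U id) (id ` {r \<in> U \<inter> P. f r \<in> U'}) m (coord_field 1) m' (coord_field 1)"
    using iso unfolding F_germ_iso_def open_F_data_def by auto
  define S where "S = {r \<in> U \<inter> P. f r \<in> U'}"
  have F: "F_compatible f S m (coord_field 1) m' (coord_field 1)"
  proof (rule F_compatible_cong)
    show "F_compatible (id \<circ> f \<circ> inv_into U id) S m (coord_field 1) m' (coord_field 1)"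
      using F0 by (simp add: S_def)
    show "f z = (id \<circ> f \<circ> inv_into U id) z" if "z \<in> S" for z
    proof -
      have "inv_into U id z = z" using that inv_into_f_f[of id U z] by (simp add: S_def)
      then show ?thesis by simp
    qed
  qed
  have bi: "biholomorphic f S" using F by (simp add: F_compatible_iff)
  have 0: "0 \<in> S" using P normal_formD(2)[OF nf(1)] normal_formD(2)[OF nf(2)] by (simp add: S_def)
  define \<eta> where "\<eta> = inv_into S f"
  have \<eta>f: "\<eta> (f z) = z" if "z \<in> S" for z using biholomorphicD(6)[OF bi that] by (simp add: \<eta>_def)
  have f\<eta>: "f (\<eta> w) = w" if "w \<in> f ` S" for w using f_inv_into_f[OF that] by (simp add: \<eta>_def)
  have c1: "nf_compatible b2 b2' f S"
    by (rule F_compatible_imp_nf_compatible[OF F nf]) (use 0 P in \<open>auto simp: S_def\<close>)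
  have c2: "nf_compatible b2' b2 \<eta> (f ` S)"
  proof (rule F_compatible_imp_nf_compatible[OF F_compatible_inverse[OF F, folded \<eta>_def] nf(2,1)])
    show "f ` S \<subseteq> U'" "\<eta> ` f ` S \<subseteq> U" using \<eta>f by (auto simp: S_def)
    show "0 \<in> f ` S" "\<eta> 0 = 0" using 0 P(2) \<eta>f[OF 0] by (auto simp: image_iff)
  qed
  note b = normal_formD(4)[OF nf(1)] and b' = normal_formD(4)[OF nf(2)]
  \<comment> \<open>\<open>pullback\<close> is contravariant: carrying \<open>b2\<close> to the side
    of \<open>b2'\<close> requires the descent \<open>?\<alpha>\<close> of the inverse.\<close>
  let ?\<beta> = "\<lambda>z. pr23 (f (emb23 z))" and ?\<alpha> = "\<lambda>z. pr23 (\<eta> (emb23 z))"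
  note gb = nf_compatible_Jacobian[OF c1 b b'] and ga = nf_compatible_Jacobian[OF c2 b' b]
  have \<alpha>\<beta>: "\<forall>\<^sub>F z in nhds 0. ?\<alpha> (?\<beta> z) = z" by (rule nf_compatible_inverse[OF c1 c2 \<eta>f])
  have \<beta>\<alpha>: "\<forall>\<^sub>F z in nhds 0. ?\<beta> (?\<alpha> z) = z" by (rule nf_compatible_inverse[OF c2 c1 f\<eta>])
  obtain J where J: "J \<in> convergent_series" "\<forall>\<^sub>F z in nhds 0. pd 1 b2 z = pd 1 b2' (?\<beta> z) * J z"
    using gb(2) by (rule bexE)
  obtain J' where J': "J' \<in> convergent_series" "\<forall>\<^sub>F z in nhds 0. pd 1 b2' z = pd 1 b2 (?\<alpha> z) * J' z"
    using ga(2) by (rule bexE)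
  show ?thesis
  proof (intro exI[of _ ?\<alpha>] conjI)
    show "biholomorphic_germ ?\<alpha>"
      by (rule germ_map_inverse_biholomorphic[OF ga(1) gb(1) \<beta>\<alpha> \<alpha>\<beta>])
    show "pullback ?\<alpha> \<in> ring_iso series_ring series_ring"
      by (rule pullback_ring_iso[OF ga(1) gb(1) \<beta>\<alpha> \<alpha>\<beta>])
    show "pullback ?\<alpha> ` (PIdl\<^bsub>series_ring\<^esub> (germ0 (pd 1 b2))) = PIdl\<^bsub>series_ring\<^esub> (germ0 (pd 1 b2'))"
      by (rule pullback_PIdl[OF ga(1) gb(1) \<beta>\<alpha> J J'])
  qed
qed

section \<open>Reduction to the normal form\<close>

lemma vder_sum_3: "vder \<psi> t (h :: complex^3)
   = h $ 1 *s vder \<psi> t (axis 1 1) + (h $ 2 *s vder \<psi> t (axis 2 1) + h $ 3 *s vder \<psi> t (axis 3 1))"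
  by (simp add: vec_eq_iff dirder_3)

text \<open>Because \<psi> carries \<partial>_i to \<open>e\<close>, the derivative along
  \<partial>_i of a coefficient of the pulled-back form is a value of Lie_e l. The derivative of the
  pushed-forward \<partial>_k comes from exchanging \<partial>_i and \<partial>_k and
  differentiating the flow equation.\<close>

lemma flow_box_form:
  fixes \<psi> :: "complex^'n \<Rightarrow> complex^'n"
  assumes B: "open B" and \<psi>: "holomorphic_map \<psi> B" and V: "open V" "\<psi> ` B \<subseteq> V"
    and l: "holomorphic_map l V" and e: "holomorphic_map e V"
    and flow: "\<And>t. t \<in> B \<Longrightarrow> vder \<psi> t (axis i 1) = e (\<psi> t)"
    and inv: "\<And>t u. t \<in> V \<Longrightarrow> lie_form e l t u = 0"
  shows "holomorphic_fun (\<lambda>t. pair (l (\<psi> t)) (vder \<psi> t (axis k 1))) B"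
    and "t \<in> B \<Longrightarrow> pd i (\<lambda>t. pair (l (\<psi> t)) (vder \<psi> t (axis k 1))) t = 0"
proof -
  have \<psi>j: "holomorphic_fun (\<lambda>w. \<psi> w $ j) B" for j using \<psi> by (simp add: holomorphic_map_def)
  have W: "complex_diff (\<lambda>t. vder \<psi> t (axis k 1) $ j) t" if "t \<in> B" for t j
    using holomorphic_fun_diff[OF holomorphic_pd[OF B \<psi>j] that] by simp
  have V\<psi>: "\<psi> t \<in> V" if "t \<in> B" for t using V(2) that by blast
  have l\<psi>: "complex_diff (\<lambda>t. l (\<psi> t) $ j) t" if "t \<in> B" for t j
    by (rule complex_diff_compose[of "\<lambda>w. l w $ j" \<psi>])
      (use holomorphic_map_diff[OF l V\<psi>[OF that]] holomorphic_map_diff[OF \<psi> that] in simp_all)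
  show "holomorphic_fun (\<lambda>t. pair (l (\<psi> t)) (vder \<psi> t (axis k 1))) B"
    unfolding holomorphic_fun_iff by (intro ballI complex_diff_pair l\<psi> W)
  assume t: "t \<in> B"
  have "vder (\<lambda>t. vder \<psi> t (axis k 1)) t (axis i 1) $ j = vder e (\<psi> t) (vder \<psi> t (axis k 1)) $ j" for j
  proof -
    have "vder (\<lambda>t. vder \<psi> t (axis k 1)) t (axis i 1) $ j = pd k (pd i (\<lambda>w. \<psi> w $ j)) t"
      by (simp add: pd_commute[OF B \<psi>j t, of i k])
    also have "\<dots> = pd k (\<lambda>w. e (\<psi> w) $ j) t"
    proof (rule pd_cong_ev, rule eventually_mono[OF eventually_nhds_in_open[OF B t]])
      fix w assume "w \<in> B"
      from flow[OF this] show "pd i (\<lambda>w. \<psi> w $ j) w = e (\<psi> w) $ j"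
        by (metis dirder_axis vder_nth)
    qed
    also have "\<dots> = vder (\<lambda>w. e (\<psi> w)) t (axis k 1) $ j" by simp
    also have "\<dots> = vder e (\<psi> t) (vder \<psi> t (axis k 1)) $ j"
      by (subst vder_compose) (use holomorphic_map_diff[OF e V\<psi>[OF t]] holomorphic_map_diff[OF \<psi> t] in simp_all)
    finally show ?thesis .
  qed
  then have vW: "vder (\<lambda>t. vder \<psi> t (axis k 1)) t (axis i 1) = vder e (\<psi> t) (vder \<psi> t (axis k 1))"
    by (intro vec_eq_iff[THEN iffD2] allI)
  have vl: "vder (\<lambda>t. l (\<psi> t)) t (axis i 1) = vder l (\<psi> t) (e (\<psi> t))"
    using vder_compose[of l \<psi> t "axis i 1", OF holomorphic_map_diff[OF l V\<psi>[OF t]] holomorphic_map_diff[OF \<psi> t]]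
      flow[OF t] by simp
  have "dirder (\<lambda>t. pair (l (\<psi> t)) (vder \<psi> t (axis k 1))) t (axis i 1)
      = lie_form e l (\<psi> t) (vder \<psi> t (axis k 1))"
    unfolding dirder_pair[OF l\<psi>[OF t] W[OF t]] vW vl lie_form_def ..
  then show "pd i (\<lambda>t. pair (l (\<psi> t)) (vder \<psi> t (axis k 1))) t = 0"
    using inv[OF V\<psi>[OF t]] by simp
qed

text \<open>Hadamard's lemma: the quotient is the mean of \<partial>_2 b over the segment to t_2 =
  0, and as a parameter integral it is holomorphic also on t_2 = 0.\<close>

lemma holomorphic_t2_multiple:
  assumes \<rho>: "\<rho> > 0" and b: "holomorphic_fun b (ball (0::complex^2) \<rho>)"
    and 0: "\<And>z. z \<in> ball 0 \<rho> \<Longrightarrow> b (rescale 1 0 z) = 0"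
  shows "b \<in> t2_multiples"
proof -
  define h where "h = (\<lambda>z. integral {0..1} (\<lambda>s. pd 1 b (rescale 1 (complex_of_real s) z)))"
  have "holomorphic_fun h (ball 0 \<rho>)"
    unfolding h_def by (rule holomorphic_rescale_integral[OF open_ball rescale_in_ball holomorphic_pd[OF open_ball b]])
  then have h: "h \<in> convergent_series" using \<rho> convergent_series_iff by blast
  have bh: "b z = z $ 1 * h z" if "z \<in> ball 0 \<rho>" for z
    using primitive_pd[OF open_ball rescale_in_ball b that, of 1] 0[OF that] by (simp add: primitive_def h_def)
  have "\<forall>\<^sub>F z in nhds 0. z \<in> ball (0::complex^2) \<rho>" using \<rho> by (intro eventually_nhds_in_open) simp_all
  then have "\<forall>\<^sub>F z in nhds 0. b z = z $ 1 * h z" by (rule eventually_mono) (rule bh)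
  moreover have "b \<in> convergent_series" using \<rho> b convergent_series_iff by blast
  ultimately show ?thesis using h unfolding t2_multiples_def by (intro CollectI conjI bexI[of _ h])
qed

text \<open>Replacing \<open>t\<^sub>1\<close> by \<open>t\<^sub>1 - f\<close> changes the form \<open>dt\<^sub>1 + a dt\<^sub>2 + b dt\<^sub>3\<close> by \<open>- df\<close>; the following \<open>f\<close>
  removes \<open>a\<close> and makes the coefficient of \<open>dt\<^sub>3\<close> vanish on \<open>t\<^sub>2 = 0\<close>.\<close>

lemma normalising_shear:
  assumes \<rho>: "\<rho> > 0" and a: "holomorphic_fun a (ball (0::complex^2) \<rho>)" and b: "holomorphic_fun b (ball 0 \<rho>)"
  obtains f where "holomorphic_fun f (ball 0 \<rho>)" "f 0 = 0" "\<And>z. z \<in> ball 0 \<rho> \<Longrightarrow> pd 1 f z = a z"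
    "(\<lambda>z. b z - pd 2 f z) \<in> t2_multiples"
proof -
  define g where "g = (\<lambda>z. b (rescale 1 (complex_of_real 0) z))"
  have g: "holomorphic_fun g (ball 0 \<rho>)"
    unfolding g_def by (rule rescale_holomorphic(1)[OF open_ball rescale_in_ball b]) simp_all
  \<comment> \<open>The first summand integrates \<open>a\<close> in t_2. The second integrates b(0,
    t_3) in t_3; it does not involve t_2 and corrects \<partial>_3 f on t_2 = 0, where the first
    summand vanishes.\<close>
  define f where "f = (\<lambda>z. primitive 1 a z + primitive 2 g z)"
  note pa = holomorphic_primitive_ball[OF a, of 1] and pg = holomorphic_primitive_ball[OF g, of 2]
  have f: "holomorphic_fun f (ball 0 \<rho>)"
    unfolding f_def using pa pg by (simp add: holomorphic_fun_iff complex_diff_add)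
  have "primitive 2 g (z + s *s axis 1 1) = primitive 2 g z" for z s
  proof -
    have "rescale 1 (complex_of_real 0) (rescale 2 u (z + s *s axis 1 1)) = rescale 1 (complex_of_real 0) (rescale 2 u z)" for u
      by (simp add: vec_eq_iff forall_2 rescale_def axis_def)
    moreover have "(z + s *s axis 1 1) $ 2 = z $ 2" by (simp add: axis_def)
    ultimately show ?thesis unfolding primitive_def g_def by simp
  qed
  then have "pd 1 (primitive 2 g) z = 0" for z by (simp add: pd_def)
  then have p1: "pd 1 f z = a z" if "z \<in> ball 0 \<rho>" for z
    unfolding f_def using pd_primitive[OF open_ball rescale_in_ball a that, of 1]
    by (simp add: pd_add holomorphic_fun_diff[OF pa that] holomorphic_fun_diff[OF pg that])
  have p2: "pd 2 f (rescale 1 0 z) = b (rescale 1 0 z)" if z: "z \<in> ball 0 \<rho>" for z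
  proof -
    have z0: "rescale 1 0 z \<in> ball 0 \<rho>" using rescale_in_ball[OF z, of 0 1] by simp
    have "primitive 1 a (rescale 1 0 z + s *s axis 2 1) = 0" for s
      by (simp add: primitive_def rescale_def axis_def)
    then have "pd 2 (primitive 1 a) (rescale 1 0 z) = 0" by (simp add: pd_def)
    moreover have "pd 2 (primitive 2 g) (rescale 1 0 z) = g (rescale 1 0 z)"
      by (rule pd_primitive[OF open_ball rescale_in_ball g z0])
    moreover have "g (rescale 1 0 z) = b (rescale 1 0 z)"
      by (simp add: g_def rescale_def cong: if_cong)
    ultimately show ?thesis
      unfolding f_def by (simp add: pd_add holomorphic_fun_diff[OF pa z0] holomorphic_fun_diff[OF pg z0])
  qed
  have "holomorphic_fun (\<lambda>z. b z - pd 2 f z) (ball 0 \<rho>)"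
    using b holomorphic_pd[OF open_ball f, of 2] by (simp add: holomorphic_fun_iff complex_diff_diff)
  then have "(\<lambda>z. b z - pd 2 f z) \<in> t2_multiples"
    by (rule holomorphic_t2_multiple[OF \<rho>]) (simp add: p2)
  moreover have "f 0 = 0" by (simp add: f_def primitive_def)
  ultimately show ?thesis using that[OF f _ p1] by blast
qed

lemma nilmult_homI:
  assumes "vder \<phi> z e = e'" "\<And>u. pair l' (vder \<phi> z u) = pair l u"
  shows "vder \<phi> z (nilmult l e u v) = nilmult l' e' (vder \<phi> z u) (vder \<phi> z v)"
  by (simp add: nilmult_def vder_add vder_diff vder_scale assms)

text \<open>\<Phi> is the flow box \<psi> after a shear \<tau>. By \<open>nilmult_homI\<close> a map
  that respects unit field and one-form respects the multiplication, so only these two are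
  transported.\<close>

lemma F_structure_normal_form:
  fixes e :: "3 vfield"
  assumes F: "F_structure V m e" and iso: "\<And>t. t \<in> V \<Longrightarrow> algebra_iso_Q1 (m t) (e t)" and x0: "x0 \<in> V"
  obtains b2 U m' S \<Phi> where "normal_form b2 U m'" "open S" "0 \<in> S" "S \<subseteq> U" "\<Phi> ` S \<subseteq> V" "\<Phi> 0 = x0"
    "F_compatible \<Phi> S m' (coord_field 1) m e"
proof -
  have V: "open V" and e: "holomorphic_map e V" using F by (simp_all add: F_structure_def)
  have "\<exists>l. holomorphic_map l V \<and> (\<forall>t\<in>V. m t = nilmult (l t) (e t)) \<and>
      (\<forall>t\<in>V. pair (l t) (e t) = 1) \<and> (\<forall>t\<in>V. \<forall>u. lie_form e l t u = 0)"
    by (rule F_structure_nilmult[OF F iso one_neq_two_3], assumption)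
       (rule exI, intro conjI ballI allI, assumption, simp_all)
  then obtain l where l: "holomorphic_map l V" and ml: "\<forall>t\<in>V. m t = nilmult (l t) (e t)"
      "\<forall>t\<in>V. pair (l t) (e t) = 1" "\<forall>t\<in>V. \<forall>u. lie_form e l t u = 0"
    by (elim exE conjE)
  note m = ml(1)[rule_format] and le = ml(2)[rule_format] and inv = ml(3)[rule_format]
  have "e x0 \<noteq> 0" using le[OF x0] by (auto simp: pair_simps)
  from flow_box[OF V x0 e this, of 1]
  obtain \<psi> :: "complex^3 \<Rightarrow> complex^3" and r where r: "r > 0" and \<psi>: "holomorphic_map \<psi> (ball 0 r)" "\<psi> ` ball 0 r \<subseteq> V" "\<psi> 0 = x0"
    and flow': "\<forall>t\<in>ball 0 r. vder \<psi> t (axis 1 1) = e (\<psi> t)" and inj': "\<forall>h. vder \<psi> 0 h = 0 \<longrightarrow> h = 0"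
    by (elim exE conjE) (rule that)
  note flow = flow'[rule_format] and inj = inj'[rule_format]
  have \<psi>V: "\<psi> w \<in> V" if "w \<in> ball 0 r" for w
    using \<psi>(2) imageI[OF that] by (rule subsetD)
  \<comment> \<open>The coefficients of the pulled-back form; the first one is \<lambda>(e) = 1 by
    the flow equation.\<close>
  define L where "L = (\<lambda>k t. pair (l (\<psi> t)) (vder \<psi> t (axis k 1)))"
  have L: "holomorphic_fun (L k) (ball 0 r)" "t \<in> ball 0 r \<Longrightarrow> pd 1 (L k) t = 0" for k t
    unfolding L_def
    by (rule flow_box_form[OF open_ball \<psi>(1) V \<psi>(2) l e flow inv]; assumption)+
  have Lc: "L k t = L k (emb23 (pr23 t))" if "t \<in> ball 0 r" for k t
    by (rule constant_along_first[OF L(1) L(2) that])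
  have "\<forall>\<^sub>F z in nhds 0. emb23 z \<in> ball 0 r"
    by (rule eventually_compose_holomorphic[OF eventually_nhds_in_open[OF open_ball]]) (use r in simp_all)
  then obtain \<rho> where \<rho>: "\<rho> > 0" and emb: "\<And>z. z \<in> ball 0 \<rho> \<Longrightarrow> emb23 z \<in> ball 0 r"
    unfolding eventually_nhds_metric by (metis dist_commute mem_ball)
  define a b where "a = (\<lambda>z. L 2 (emb23 z))" and "b = (\<lambda>z. L 3 (emb23 z))"
  have Le: "holomorphic_fun (\<lambda>z. L k (emb23 z)) (ball 0 \<rho>)" for k
    unfolding holomorphic_fun_iff
    by (intro ballI complex_diff_compose[of "L k" emb23] holomorphic_fun_diff[OF L(1) emb] complex_diff_emb23)
  have ab: "holomorphic_fun a (ball 0 \<rho>)" "holomorphic_fun b (ball 0 \<rho>)"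
    unfolding a_def b_def by (rule Le)+
  have "\<exists>f. holomorphic_fun f (ball 0 \<rho>) \<and> f 0 = 0 \<and> (\<forall>z\<in>ball 0 \<rho>. pd 1 f z = a z)
      \<and> (\<lambda>z. b z - pd 2 f z) \<in> t2_multiples"
    by (rule normalising_shear[OF \<rho> ab]) (rule exI, intro conjI ballI, assumption, simp_all)
  then obtain f where f: "holomorphic_fun f (ball 0 \<rho>)" "f 0 = 0" and f': "\<forall>z\<in>ball 0 \<rho>. pd 1 f z = a z"
    and b2: "(\<lambda>z. b z - pd 2 f z) \<in> t2_multiples"
    by (elim exE conjE)
  note f = f f'[rule_format]
  define b2 where "b2 = (\<lambda>z. b z - pd 2 f z)"
  from normal_form_exists[OF b2, folded b2_def] obtain U m' where nf: "normal_form b2 U m'"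
    by (elim exE conjE)
  \<comment> \<open>Pulling dt_1 back along this shear gives dt_1 - df.\<close>
  define \<tau> where "\<tau> = (\<lambda>t. t - f (pr23 t) *s (axis 1 1 :: complex^3))"
  define A0 where "A0 = {t. pr23 t \<in> ball 0 \<rho>}"
  have A0: "open A0"
    using open_vimage_Int[OF open_UNIV continuous_on_pr23 open_ball, of 0 \<rho>] by (simp add: A0_def)
  have fd: "complex_diff f (pr23 t)" if "t \<in> A0" for t
    using f(1) that unfolding A0_def by (auto intro: holomorphic_fun_diff)
  have \<tau>1: "complex_diff (\<lambda>t. \<tau> t $ k) t" "dirder (\<lambda>t. \<tau> t $ k) t h = h $ k - dirder (\<lambda>t. f (pr23 t)) t h * axis 1 1 $ k"
    if "t \<in> A0" for t k h
  proof -
    note d = complex_diff_mult[OF complex_diff_b_pr23[OF fd[OF that]] complex_diff_const, of "- (axis 1 1 $ k)"]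
    have eq: "(\<lambda>t. \<tau> t $ k) = (\<lambda>t. t $ k + f (pr23 t) * - (axis 1 1 $ k))" by (simp add: \<tau>_def fun_eq_iff)
    show "complex_diff (\<lambda>t. \<tau> t $ k) t" unfolding eq by (rule complex_diff_add[OF complex_diff_coord d])
    have "vder (\<lambda>t. t) t h $ k = h $ k" by (simp only: vder_id)
    then have "dirder (\<lambda>t. t $ k) t h = h $ k" by (simp only: vder_nth)
    then show "dirder (\<lambda>t. \<tau> t $ k) t h = h $ k - dirder (\<lambda>t. f (pr23 t)) t h * axis 1 1 $ k"
      unfolding eq
      by (simp only: dirder_fadd[OF complex_diff_coord d] dirder_fmult[OF complex_diff_b_pr23[OF fd[OF that]] complex_diff_const])
         (simp add: dirder_def)
  qed
  have v\<tau>: "vder \<tau> t h = h - dirder (\<lambda>t. f (pr23 t)) t h *s axis 1 1" if "t \<in> A0" for t h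
    by (simp add: vec_eq_iff \<tau>1(2)[OF that])
  define A where "A = {t \<in> A0. \<tau> t \<in> ball 0 r}"
  have h\<tau>: "holomorphic_map \<tau> A0" using \<tau>1(1) by (simp add: holomorphic_map_def holomorphic_fun_iff)
  have A: "open A"
    unfolding A_def by (rule open_vimage_Int[OF A0 holomorphic_map_continuous_on[OF h\<tau>] open_ball])
  have \<tau>0: "\<tau> 0 = 0" using f(2) by (simp add: \<tau>_def)
  have A00: "0 \<in> A0" using \<rho> by (simp add: A0_def)
  then have 0: "0 \<in> A" using r \<tau>0 by (simp add: A_def)
  define \<Phi> where "\<Phi> = (\<lambda>t. \<psi> (\<tau> t))"
  have h\<Phi>: "holomorphic_map \<Phi> A"
    unfolding \<Phi>_def by (rule holomorphic_map_compose[OF holomorphic_map_subset[OF h\<tau>] \<psi>(1)]) (auto simp: A_def)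
  have v\<Phi>: "vder \<Phi> t h = vder \<psi> (\<tau> t) (vder \<tau> t h)" if "t \<in> A" for t h
  proof -
    have "t \<in> A0" "\<tau> t \<in> ball 0 r" using that unfolding A_def by blast+
    then show ?thesis
      unfolding \<Phi>_def by (intro vder_compose holomorphic_map_diff[OF \<psi>(1)] \<tau>1(1))
  qed
  have "\<exists>S. 0 \<in> S \<and> S \<subseteq> A \<and> biholomorphic \<Phi> S"
  proof (rule holomorphic_inverse_function[OF A 0 h\<Phi>])
    fix h assume "vder \<Phi> 0 h = 0"
    then have "vder \<tau> 0 h = 0" using v\<Phi>[OF 0] \<tau>0 by (simp add: inj)
    \<comment> \<open>Hence \<open>h\<close> is a multiple of \<partial>_1, along which
      \<open>f \<circ> pr23\<close> has derivative 0.\<close>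
    then have h: "h = dirder (\<lambda>t. f (pr23 t)) 0 h *s axis 1 1" using v\<tau>[OF A00] by simp
    have "h $ 2 = 0" "h $ 3 = 0"
      using arg_cong[OF h, of "\<lambda>v. v $ 2"] arg_cong[OF h, of "\<lambda>v. v $ 3"] by simp_all
    moreover have "pd 1 (\<lambda>t. f (pr23 t)) 0 = 0" by (rule pd_b_pr23(1)[OF fd[OF A00]])
    ultimately have "dirder (\<lambda>t. f (pr23 t)) 0 h = 0" by (simp add: dirder_3)
    with h show "h = 0" by (simp only: vector_smult_lzero)
  qed
  then obtain S0 where S0: "0 \<in> S0" "S0 \<subseteq> A" "biholomorphic \<Phi> S0" by blast
  define S where "S = S0 \<inter> U"
  have S: "open S" "0 \<in> S" "S \<subseteq> U" "S \<subseteq> A"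
    using S0 biholomorphicD(1)[OF S0(3)] normal_formD(1,2)[OF nf] by (auto simp: S_def)
  have bi: "biholomorphic \<Phi> S" by (rule biholomorphic_subset[OF S0(3) S(1)]) (simp add: S_def)
  have imV: "\<Phi> t \<in> V" if "t \<in> S" for t
    unfolding \<Phi>_def using that S(4) by (intro \<psi>V) (auto simp: A_def)
  have e1: "vder \<Phi> t (axis 1 1) = e (\<Phi> t)" if "t \<in> S" for t
  proof -
    have t: "t \<in> A" "t \<in> A0" "\<tau> t \<in> ball 0 r" using that S(4) by (auto simp: A_def)
    have "vder \<tau> t (axis 1 1) = axis 1 1" by (simp add: v\<tau>[OF t(2)] pd_b_pr23(1)[OF fd[OF t(2)]])
    then show ?thesis using v\<Phi>[OF t(1)] flow[OF t(3)] by (simp add: \<Phi>_def)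
  qed
  have form: "pair (l (\<Phi> t)) (vder \<Phi> t u) = pair (nf_form b2 t) u" if "t \<in> S" for t u
  proof -
    have t: "t \<in> A" "t \<in> A0" "\<tau> t \<in> ball 0 r" using that S(4) by (auto simp: A_def)
    have pr: "pr23 (\<tau> t) = pr23 t" by (simp add: vec_eq_iff forall_2 \<tau>_def)
    have L1: "L 1 (\<tau> t) = 1" using flow[OF t(3)] le[OF \<psi>V[OF t(3)]] by (simp add: L_def)
    have "pair (l (\<psi> (\<tau> t))) (vder \<psi> (\<tau> t) h) = h $ 1 * L 1 (\<tau> t) + (h $ 2 * L 2 (\<tau> t) + h $ 3 * L 3 (\<tau> t))" for h
      unfolding vder_sum_3[of \<psi> "\<tau> t" h] L_def by (simp only: pair_simps)
    moreover have "L 2 (\<tau> t) = a (pr23 t)" "L 3 (\<tau> t) = b (pr23 t)"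
      using Lc[OF t(3)] by (simp_all add: pr a_def b_def)
    moreover have "pd 1 f (pr23 t) = a (pr23 t)" using f(3) t(2) by (simp add: A0_def)
    ultimately show ?thesis
      unfolding \<Phi>_def[symmetric] v\<Phi>[OF t(1)]
      by (simp add: \<Phi>_def v\<tau>[OF t(2)] L1 pair_nf_form b2_def dirder_3 pd_b_pr23[OF fd[OF t(2)]] algebra_simps)
  qed
  have "F_compatible \<Phi> S m' (coord_field 1) m e"
    unfolding F_compatible_iff
  proof (intro conjI ballI allI bi)
    fix t assume t: "t \<in> S"
    show "vder \<Phi> t (coord_field 1 t) = e (\<Phi> t)" using e1[OF t] by (simp add: coord_field_def)
    have "m' t = nilmult (nf_form b2 t) (axis 1 1)" using normal_formD(5)[OF nf] S(3) t by blast
    then show "vder \<Phi> t (m' t u v) = m (\<Phi> t) (vder \<Phi> t u) (vder \<Phi> t v)" for u v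
      unfolding m[OF imV[OF t]] by (simp only: nilmult_homI[OF e1[OF t] form[OF t]])
  qed
  moreover have "\<Phi> 0 = x0" by (simp add: \<Phi>_def \<tau>0 \<psi>(3))
  ultimately show ?thesis using that[OF nf S(1-3)] imV by blast
qed

section \<open>From one chart to the germ of the manifold\<close>

text \<open>The germ isomorphism is the inverse of \<Phi> after one chart \<open>x\<close> around
  \<open>p\<close>. In any other chart it is compatible because the transition map to
  \<open>x\<close> is.\<close>

lemma F_manifold_normal_form:
  fixes M :: "('a, 3) F_data"
  assumes M: "F_manifold M" and p: "p \<in> topspace (pts M)" and Q: "tangent_algebras_Q1 M"
  shows "\<exists>b2 U m. normal_form b2 U m \<and> F_germ_iso M p (open_F_data U m (coord_field 1)) 0"
proof -
  have "p \<in> \<Union> (fst ` atlas M)" using M p by (simp add: F_manifold_def)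
  then obtain U0 x where U0: "(U0, x) \<in> atlas M" "p \<in> U0" by auto
  note charts = M[unfolded F_manifold_def, THEN conjunct2, THEN conjunct2, THEN conjunct2, THEN conjunct1]
    and transitions = M[unfolded F_manifold_def, THEN conjunct2, THEN conjunct2, THEN conjunct2, THEN conjunct2]
  have chart: "openin (pts M) U" "open (y ` U)" "homeomorphic_map (subtopology (pts M) U) (top_of_set (y ` U)) y"
      "F_structure (y ` U) (fmult M (U, y)) (funit M (U, y))" if "(U, y) \<in> atlas M" for U y
    using bspec[OF charts that] by simp_all
  have trans: "F_compatible (z \<circ> inv_into U y) (y ` (U \<inter> V))
          (fmult M (U, y)) (funit M (U, y)) (fmult M (V, z)) (funit M (V, z))"
    if "(U, y) \<in> atlas M" "(V, z) \<in> atlas M" for U y V z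
    using bspec[OF bspec[OF transitions that(1), unfolded prod.case] that(2)] by simp
  have top: "topspace (subtopology (pts M) U) = U" if "(U, y) \<in> atlas M" for U y
    using openin_subset[OF chart(1)[OF that]] by auto
  have inj: "inj_on y U" if "(U, y) \<in> atlas M" for U y
    using homeomorphic_imp_injective_map[OF chart(3)[OF that]] top[OF that] by simp
  define m where "m = fmult M (U0, x)"
  define e where "e = funit M (U0, x)"
  have iso: "algebra_iso_Q1 (m t) (e t)" if "t \<in> x ` U0" for t
    using bspec[OF Q[unfolded tangent_algebras_Q1_def] U0(1)] that by (auto simp: m_def e_def)
  obtain b2 U m' S \<Phi> where nf: "normal_form b2 U m'" and S: "open S" "0 \<in> S" "S \<subseteq> U" "\<Phi> ` S \<subseteq> x ` U0" "\<Phi> 0 = x p"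
    and F: "F_compatible \<Phi> S m' (coord_field 1) m e"
    by (rule F_structure_normal_form[OF chart(4)[OF U0(1), folded m_def e_def] iso imageI[OF U0(2)]], assumption)
      (rule that)
  have bi: "biholomorphic \<Phi> S" using F by (simp add: F_compatible_iff)
  define G where "G = inv_into S \<Phi>"
  have G\<Phi>: "G (\<Phi> t) = t" if "t \<in> S" for t using biholomorphicD(6)[OF bi that] by (simp add: G_def)
  have \<Phi>G: "\<Phi> (G w) = w" "G w \<in> S" if "w \<in> \<Phi> ` S" for w
    using f_inv_into_f[OF that] inv_into_into[OF that] by (simp_all add: G_def)
  have FG: "F_compatible G (\<Phi> ` S) m e m' (coord_field 1)"
    using F_compatible_inverse[OF F] by (simp add: G_def)
  obtain x' where x': "homeomorphic_maps (subtopology (pts M) U0) (top_of_set (x ` U0)) x x'"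
    using chart(3)[OF U0(1)] homeomorphic_map_maps by blast
  have xx': "x' (x r) = r" if "r \<in> U0" for r
    using x' that top[OF U0(1)] by (simp add: homeomorphic_maps_def)
  define P where "P = {r \<in> U0. x r \<in> \<Phi> ` S}"
  have xP: "x ` P = \<Phi> ` S"
  proof
    show "x ` P \<subseteq> \<Phi> ` S" by (auto simp: P_def)
    show "\<Phi> ` S \<subseteq> x ` P"
    proof
      fix w assume w: "w \<in> \<Phi> ` S"
      then obtain r where "r \<in> U0" "w = x r" using S(4) by blast
      with w show "w \<in> x ` P" by (simp add: P_def)
    qed
  qed
  have P: "openin (pts M) P"
  proof -
    have "openin (subtopology (pts M) U0) {r \<in> topspace (subtopology (pts M) U0). x r \<in> \<Phi> ` S}"
      using x' biholomorphicD(2)[OF bi] S(4)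
      by (intro openin_continuous_map_preimage[of _ "top_of_set (x ` U0)"])
         (auto simp: homeomorphic_maps_def openin_open)
    then have "openin (subtopology (pts M) U0) P" unfolding top[OF U0(1)] P_def .
    then show ?thesis using openin_open_subtopology[OF chart(1)[OF U0(1)]] by blast
  qed
  define f where "f = G \<circ> x"
  have fP: "f r \<in> S" if "r \<in> P" for r using that \<Phi>G(2) by (simp add: f_def P_def)
  have hom: "homeomorphic_map (subtopology (pts M) P) (top_of_set S) f"
    unfolding homeomorphic_map_maps homeomorphic_maps_def
  proof (intro exI[of _ "x' \<circ> \<Phi>"] conjI ballI)
    have PU: "P \<subseteq> U0" by (auto simp: P_def)
    have "continuous_map (subtopology (pts M) P) (top_of_set (\<Phi> ` S)) x"
      using x' PU xP unfolding homeomorphic_maps_def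
      by (auto simp: continuous_map_in_subtopology intro: continuous_map_from_subtopology_mono)
    moreover have "continuous_map (top_of_set (\<Phi> ` S)) (top_of_set S) G"
      using holomorphic_map_continuous_on[OF biholomorphicD(4)[OF bi]] \<Phi>G(2)
      by (auto simp: G_def[symmetric] continuous_map_in_subtopology)
    ultimately show "continuous_map (subtopology (pts M) P) (top_of_set S) f"
      unfolding f_def by (rule continuous_map_compose)
    have "continuous_map (top_of_set S) (top_of_set (\<Phi> ` S)) \<Phi>"
      using holomorphic_map_continuous_on[OF biholomorphicD(3)[OF bi]]
      by (auto simp: continuous_map_in_subtopology)
    moreover have "continuous_map (top_of_set (\<Phi> ` S)) (subtopology (pts M) P) x'"
      unfolding continuous_map_in_subtopology
    proof
      have "continuous_map (top_of_set (x ` U0)) (pts M) x'"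
        using x' by (simp add: homeomorphic_maps_def continuous_map_in_subtopology)
      then show "continuous_map (top_of_set (\<Phi> ` S)) (pts M) x'"
        by (rule continuous_map_from_subtopology_mono) (rule S(4))
      show "x' \<in> topspace (top_of_set (\<Phi> ` S)) \<rightarrow> P"
        using xP xx' PU by (auto simp: image_iff subset_iff) (metis xP imageE image_eqI subsetD)
    qed
    ultimately show "continuous_map (top_of_set S) (subtopology (pts M) P) (x' \<circ> \<Phi>)"
      by (rule continuous_map_compose)
    show "(x' \<circ> \<Phi>) (f r) = r" if "r \<in> topspace (subtopology (pts M) P)" for r
      using that \<Phi>G(1) xx' by (simp add: f_def P_def)
    show "f ((x' \<circ> \<Phi>) s) = s" if "s \<in> topspace (top_of_set S)" for s
    proof -
      have "\<Phi> s \<in> x ` U0" using that S(4) by auto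
      then have "x (x' (\<Phi> s)) = \<Phi> s" using xx' by auto
      then show ?thesis using G\<Phi> that by (simp add: f_def)
    qed
  qed
  have pP: "p \<in> P" "f p = 0"
    using U0(2) imageI[OF S(2), of \<Phi>] S(5) G\<Phi>[OF S(2)] by (simp_all add: P_def f_def)
  have comp: "F_compatible (id \<circ> f \<circ> inv_into V y) (y ` {r \<in> V \<inter> P. f r \<in> U})
      (fmult M (V, y)) (funit M (V, y)) m' (coord_field 1)" if V: "(V, y) \<in> atlas M" for V y
  proof -
    have iv: "inv_into V y (y r) = r" if "r \<in> V" for r using inj[OF V] that by (rule inv_into_f_f)
    \<comment> \<open>The domain demanded by \<open>F_germ_iso\<close> is matched with the one that
      composition with the transition map produces.\<close>
    have "y ` {r \<in> V \<inter> P. f r \<in> U} = {z \<in> y ` (V \<inter> U0). (x \<circ> inv_into V y) z \<in> \<Phi> ` S}"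
    proof (intro equalityI subsetI)
      fix z assume "z \<in> y ` {r \<in> V \<inter> P. f r \<in> U}"
      then show "z \<in> {z \<in> y ` (V \<inter> U0). (x \<circ> inv_into V y) z \<in> \<Phi> ` S}"
        using iv by (auto simp: P_def)
    next
      fix z assume "z \<in> {z \<in> y ` (V \<inter> U0). (x \<circ> inv_into V y) z \<in> \<Phi> ` S}"
      then obtain r where r: "z = y r" "r \<in> V" "r \<in> U0" "x r \<in> \<Phi> ` S" using iv by auto
      then have "r \<in> P" by (simp add: P_def)
      with r S(3) fP show "z \<in> y ` {r \<in> V \<inter> P. f r \<in> U}" by blast
    qed
    moreover have "F_compatible (G \<circ> (x \<circ> inv_into V y)) {z \<in> y ` (V \<inter> U0). (x \<circ> inv_into V y) z \<in> \<Phi> ` S}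
        (fmult M (V, y)) (funit M (V, y)) m' (coord_field 1)"
      using F_compatible_compose[OF trans[OF V U0(1), folded m_def e_def] FG] .
    ultimately show ?thesis by (simp add: f_def comp_assoc)
  qed
  have "F_germ_iso M p (open_F_data U m' (coord_field 1)) 0"
    unfolding F_germ_iso_def
  proof (intro exI[of _ P] exI[of _ S] exI[of _ f] conjI)
    show "openin (pts (open_F_data U m' (coord_field 1))) S"
      using S(1,3) by (auto simp: open_F_data_def openin_open)
    show "homeomorphic_map (subtopology (pts M) P) (subtopology (pts (open_F_data U m' (coord_field 1))) S) f"
      using hom S(3) by (simp add: open_F_data_def subtopology_subtopology Int_absorb1)
    show "\<forall>(V, y)\<in>atlas M. \<forall>(V', y')\<in>atlas (open_F_data U m' (coord_field 1)).
           F_compatible (y' \<circ> f \<circ> inv_into V y) (y ` {r \<in> V \<inter> P. f r \<in> V'})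
             (fmult M (V, y)) (funit M (V, y)) (fmult (open_F_data U m' (coord_field 1)) (V', y'))
             (funit (open_F_data U m' (coord_field 1)) (V', y'))"
      using comp by (auto simp: open_F_data_def)
  qed (use P pP S(2) in auto)
  with nf show ?thesis by blast
qed

text \<open>On \<complex>^2 the variable t_2 has index 1, so \<open>pd 1 b2\<close> is \<partial>_2
  b_2; on \<complex>^3 the same derivative appears as \<open>pd 2 (b2 \<circ> pr23)\<close>. Euler
  fields are taken as germs, hence the neighbourhood \<open>W\<close> on one side and
  \<open>nhds 0\<close> on the other.\<close>

theorem theorem5p2:
  fixes M :: "('a, 3) F_data" and p :: 'a
  shows
    "(F_manifold M \<and> p \<in> topspace (pts M) \<and> tangent_algebras_Q1 M \<longrightarrow>
       (\<exists>b2 U m. normal_form b2 U m \<and>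
          F_germ_iso M p (open_F_data U m (coord_field 1)) 0))
   \<and> (\<forall>b2\<in>t2_multiples. \<exists>U m. normal_form b2 U m \<and>
          tangent_algebras_Q1 (open_F_data U m (coord_field 1)))
   \<and> (\<forall>b2 U m b2' U' m'.
        normal_form b2 U m \<and> normal_form b2' U' m' \<and>
        F_germ_iso (open_F_data U m (coord_field 1)) 0 (open_F_data U' m' (coord_field 1)) 0 \<longrightarrow>
        (\<exists>\<phi>. biholomorphic_germ \<phi> \<and> pullback \<phi> \<in> ring_iso series_ring series_ring \<and>
           pullback \<phi> ` (PIdl\<^bsub>series_ring\<^esub> (germ0 (pd 1 b2)))
             = PIdl\<^bsub>series_ring\<^esub> (germ0 (pd 1 b2'))))
   \<and> (\<forall>b2 U m E.
        normal_form b2 U m \<and> (\<forall>i. (\<lambda>t. E t $ i) \<in> convergent_series) \<longrightarrow>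
        ((\<exists>W. 0 \<in> W \<and> W \<subseteq> U \<and> Euler_field W m E) \<longleftrightarrow>
           series_in_t23 (\<lambda>t. E t $ 1 - t $ 1) \<and>
           series_in_t23 (\<lambda>t. E t $ 2) \<and> series_in_t23 (\<lambda>t. E t $ 3) \<and>
           (\<forall>\<^sub>F t in nhds 0.
              pd 2 (\<lambda>t. E t $ 1) t = - b2 (pr23 t) * pd 2 (\<lambda>t. E t $ 3) t) \<and>
           (\<forall>\<^sub>F t in nhds 0.
              pd 3 (\<lambda>t. E t $ 1) t =
                - (E t $ 2) * pd 2 (b2 \<circ> pr23) t
                - pd 3 (\<lambda>t. E t $ 3 * b2 (pr23 t)) t + b2 (pr23 t))))"
proof (intro conjI allI impI ballI, goal_cases)
  case 1
  then show ?case by (elim conjE) (rule F_manifold_normal_form)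
next
  case (2 b2)
  then show ?case by (rule normal_form_exists)
next
  case (3 b2 U m b2' U' m')
  then show ?case by (elim conjE) (rule normal_form_ideal_invariant)
next
  case (4 b2 U m E)
  then have E: "\<And>i. (\<lambda>t. E t $ i) \<in> convergent_series" by blast
  show ?case
    using normal_form_Euler_iff[OF conjunct1[OF 4] E] Euler_at_ev_iff[OF E] by (rule trans)
qed

end
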